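(* Let $n\ge2$ and let $V$ be an irreducible module for the toroidal Lie algebra $\tau=\mathfrak g\otimes A\oplus Z\oplus D$ which is a weight module with respect to $\tilde{\mathfrak h}$ with finite dimensional weight spaces. Then, after twisting $V$ by the automorphism of $\tau$ associated with some $B\in GL(n,\mathbb Z)$, the following operators are zero on $V$: $t^{\underline m}K_i$ for all $1\le i\le n-1$ and all $\underline m\in\mathbb Z^n$, and $t^{\underline m}K_n$ for all $\underline m\in\mathbb Z^n$ with $m_n\ne0$. Consequently, on the twisted module the kernel of the Lie algebra homomorphism $\varphi:\tau\to\mathfrak g_{\rm aff}\otimes A_{n-1}\oplus D$ defined in the context acts as zero, so that the twisted module is a module for $\mathfrak g_{\rm aff}\otimes A_{n-1}\oplus D$.
   Context: $\mathfrak g$ is a finite dimensional simple Lie algebra over $\mathbb C$ with a non-degenerate invariant symmetric bilinear form $(\cdot,\cdot)$, and $\mathfrak h$ is a Cartan subalgebra of $\mathfrak g$. $A=\mathbb C[t_1^{\pm1},\dots,t_n^{\pm1}]$, $t^{\underline m}=t_1^{m_1}\cdots t_n^{m_n}$, $X(\underline m)=X\otimes t^{\underline m}$. $Z$ is spanned by symbols $t^{\underline m}K_i$ ($1\le i\le n$, $\underline m\in\mathbb Z^n$) subject to $\sum_i m_i t^{\underline m}K_i=0$ for every $\underline m$; $K_i=t^{\underline 0}K_i$; $D$ is the span of $d_1,\dots,d_n$. Brackets on $\tau$: $[X(\underline r),Y(\underline s)]=[X,Y](\underline r+\underline s)+(X,Y)\,d(t^{\underline r})t^{\underline s}$ where $d(t^{\underline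 r})t^{\underline s}:=\sum_i r_i t^{\underline r+\underline s}K_i$; $Z$ is central in $\mathfrak g\otimes A\oplus Z$; $[d_i,X(\underline r)]=r_iX(\underline r)$, $[d_i,t^{\underline m}K_j]=m_it^{\underline m}K_j$, $[d_i,d_j]=0$. $\tilde{\mathfrak h}$ is the span of $\mathfrak h,K_1,\dots,K_n,d_1,\dots,d_n$; a weight module is the direct sum of its simultaneous eigenspaces (weight spaces) for $\tilde{\mathfrak h}$. Automorphisms: for $B\in GL(n,\mathbb Z)$ (integer matrices of determinant $\pm1$), the associated automorphism of $\tau$, again denoted $B$, is $B(X(\underline r))=X(\underline m)$, $B(d(t^{\underline r})t^{\underline s})=d(t^{\underline m})t^{\underline p}$ where $\underline m^T=B\underline r^T$, $\underline p^T=B\underline s^T$, and $B(d_i)=d_i'$ where $(d_1',\dots,d_n')^T=B^{-1}(d_1,\dots,d_n)^T$. Twisting $V$ by $B$ means letting $x\in\tau$ act on $V$ as $B(x)$ acts originally. $\mathfrak g_{\rm aff}=\mathfrak g\otimes\mathbb C[t_n^{\pm1}]\oplus\mathbb C K_n$ with $[x\otimes t_n^a,y\otimes t_n^b]=[x,y]\otimes t_n^{a+b}+a\,\delta_{a+b,0}(x,y)K_n$ and $K_n$ central. $A_{n-1}=\mathbb C[t_1^{\pm1},\dots,t_{n-1}^{\pm1}]$, and $\mathfrak g_{\rm aff}\otimes A_{n-1}$ has bracket $[X\otimes f,Y\otimes g]=[X,Y]\otimes fg$. In $\mathfrak g_{\rm aff}\otimes A_{n-1}\oplus D$ the $d_i$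 commute with each other and act as the degree derivations $t_i\frac{\partial}{\partial t_i}$ ($K_n$ having degree $0$). The homomorphism $\varphi$ is: $\varphi(X\otimes t^{\underline r})=(X\otimes t_n^{r_n})\otimes t_1^{r_1}\cdots t_{n-1}^{r_{n-1}}$ for $X\in\mathfrak g$; $\varphi(t^{\underline m}K_i)=0$ for $1\le i\le n-1$; $\varphi(t^{\underline m}K_n)=0$ if $m_n\neq0$; $\varphi(t^{\underline m}K_n)=K_n\otimes t_1^{m_1}\cdots t_{n-1}^{m_{n-1}}$ if $m_n=0$; $\varphi(d_i)=d_i$. *)

theory Defs
  imports "HOL-Analysis.Determinants" "HOL-Library.Poly_Mapping"
begin

section \<open>Lie algebras and their modules\<close>

definition (in vector_space) finite_dim :: "'b set \<Rightarrow> bool"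
  where "finite_dim S \<longleftrightarrow> (\<exists>B. finite B \<and> S \<subseteq> span B)"

definition (in vector_space) is_direct_sum :: "'b set set \<Rightarrow> bool"
  where "is_direct_sum \<W> \<longleftrightarrow>
    span (\<Union>\<W>) = UNIV \<and> (\<forall>W\<in>\<W>. W \<inter> span (\<Union>(\<W> - {W})) = {0})"

locale lie_algebra = vector_space scale
  for scale :: "complex \<Rightarrow> 'l::ab_group_add \<Rightarrow> 'l" +
  fixes bracket :: "'l \<Rightarrow> 'l \<Rightarrow> 'l"
  assumes bracket_add_left: "bracket (x + y) z = bracket x z + bracket y z"
    and bracket_add_right: "bracket x (y + z) = bracket x y + bracket x z"
    and bracket_scale_left: "bracket (scale c x) y = scale c (bracket x y)"
    and bracket_scale_right: "bracket x (scale c y) = scale c (bracket x y)"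
    and bracket_self: "bracket x x = 0"
    and jacobi: "bracket x (bracket y z) + bracket y (bracket z x) + bracket z (bracket x y) = 0"
begin

definition lie_ideal :: "'l set \<Rightarrow> bool"
  where "lie_ideal I \<longleftrightarrow> subspace I \<and> (\<forall>x. \<forall>y\<in>I. bracket x y \<in> I)"

definition lie_subalgebra :: "'l set \<Rightarrow> bool"
  where "lie_subalgebra S \<longleftrightarrow> subspace S \<and> (\<forall>x\<in>S. \<forall>y\<in>S. bracket x y \<in> S)"

primrec lower_central :: "'l set \<Rightarrow> nat \<Rightarrow> 'l set" where
  "lower_central S 0 = S"
| "lower_central S (Suc k) = span {bracket x y | x y. x \<in> S \<and> y \<in> lower_central S k}"

definition normalizer :: "'l set \<Rightarrow> 'l set"
  where "normalizer S = {x. \<forall>y\<in>S. bracket x y \<in> S}"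

definition cartan_subalgebra :: "'l set \<Rightarrow> bool"
  where "cartan_subalgebra H \<longleftrightarrow>
    lie_subalgebra H \<and> (\<exists>k. lower_central H k = {0}) \<and> normalizer H = H"

definition simple :: bool
  where "simple \<longleftrightarrow>
    (\<exists>x y. bracket x y \<noteq> 0) \<and> (\<forall>I. lie_ideal I \<longrightarrow> I = {0} \<or> I = UNIV)"

definition invariant_form :: "('l \<Rightarrow> 'l \<Rightarrow> complex) \<Rightarrow> bool"
  where "invariant_form form \<longleftrightarrow>
    (\<forall>x y z. form (x + y) z = form x z + form y z) \<and>
    (\<forall>c x y. form (scale c x) y = c * form x y) \<and>
    (\<forall>x y. form x y = form y x) \<and>
    (\<forall>x y z. form (bracket x y) z = form x (bracket y z))"

end

definition nondegenerate_form :: "('l::zero \<Rightarrow> 'l \<Rightarrow> complex) \<Rightarrow> bool"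
  where "nondegenerate_form form \<longleftrightarrow> (\<forall>x. (\<forall>y. form x y = 0) \<longrightarrow> x = 0)"

locale lie_module = lie_algebra scale bracket + V: vector_space scaleV
  for scale :: "complex \<Rightarrow> 'l::ab_group_add \<Rightarrow> 'l" and bracket :: "'l \<Rightarrow> 'l \<Rightarrow> 'l"
    and scaleV :: "complex \<Rightarrow> 'v::ab_group_add \<Rightarrow> 'v" +
  fixes act :: "'l \<Rightarrow> 'v \<Rightarrow> 'v"
  assumes act_add_left: "act (x + y) v = act x v + act y v"
    and act_scale_left: "act (scale c x) v = scaleV c (act x v)"
    and act_add_right: "act x (v + w) = act x v + act x w"
    and act_scale_right: "act x (scaleV c v) = scaleV c (act x v)"
    and act_bracket: "act (bracket x y) v = act x (act y v) - act y (act x v)"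
begin

definition irreducible :: bool
  where "irreducible \<longleftrightarrow> (\<exists>v::'v. v \<noteq> 0) \<and>
    (\<forall>W. V.subspace W \<and> (\<forall>x. \<forall>w\<in>W. act x w \<in> W) \<longrightarrow> W = {0} \<or> W = UNIV)"

text \<open>If \<open>\<mu>\<close> is not linear on the subspace \<open>T\<close>, then the space below is zero.\<close>

definition weight_space :: "'l set \<Rightarrow> ('l \<Rightarrow> complex) \<Rightarrow> 'v set"
  where "weight_space T \<mu> = {v. \<forall>h\<in>T. act h v = scaleV (\<mu> h) v}"

text \<open>The summands form a set of subspaces, since functions \<open>\<mu>\<close> that agree on \<open>T\<close>
  have the same weight space.\<close>

definition weight_module :: "'l set \<Rightarrow> bool"
  where "weight_module T \<longleftrightarrow> V.is_direct_sum (range (weight_space T))"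

end

section \<open>Finitely supported families\<close>

text \<open>\<open>L \<otimes> \<complex>[Q]\<close> is rendered as \<open>Q \<Rightarrow>\<^sub>0 L\<close>, with \<open>x \<otimes> t\<^sup>r\<close> being
  \<open>Poly_Mapping.single r x\<close>.\<close>

definition pm_scale :: "(complex \<Rightarrow> 'b \<Rightarrow> 'b) \<Rightarrow> complex \<Rightarrow> ('k \<Rightarrow>\<^sub>0 'b::zero) \<Rightarrow> 'k \<Rightarrow>\<^sub>0 'b"
  where "pm_scale sc c = Poly_Mapping.map (sc c)"

definition lin_ext :: "('k \<Rightarrow> 'b \<Rightarrow> 'c::comm_monoid_add) \<Rightarrow> ('k \<Rightarrow>\<^sub>0 'b::zero) \<Rightarrow> 'c"
  where "lin_ext T f = (\<Sum>k\<in>Poly_Mapping.keys f. T k (Poly_Mapping.lookup f k))"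

definition lin_ext2 ::
    "('k \<Rightarrow> 'b \<Rightarrow> 'k \<Rightarrow> 'b \<Rightarrow> 'c::comm_monoid_add) \<Rightarrow> ('k \<Rightarrow>\<^sub>0 'b::zero) \<Rightarrow> ('k \<Rightarrow>\<^sub>0 'b) \<Rightarrow> 'c"
  where "lin_ext2 T f g = lin_ext (\<lambda>r x. lin_ext (T r x) g) f"

lemma pm_induct [case_names single add]:
  assumes "\<And>k x. P (Poly_Mapping.single k x)"
    and "\<And>f g. P f \<Longrightarrow> P g \<Longrightarrow> P (f + g)"
  shows "P (f :: 'k \<Rightarrow>\<^sub>0 'b::monoid_add)"
proof (induction f rule: Poly_Mapping.update_induct)
  case const
  show ?case using assms(1)[of undefined 0] by simp
next
  case (update f a b)
  have "Poly_Mapping.update a b f = f + Poly_Mapping.single a b"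
    using update(1)
    by (intro poly_mapping_eqI)
      (auto simp: Poly_Mapping.lookup_update Poly_Mapping.lookup_add Poly_Mapping.lookup_single
        in_keys_iff when_def)
  then show ?case using assms update by simp
qed

lemma lin_ext_single:
  assumes "T k 0 = 0"
  shows "lin_ext T (Poly_Mapping.single k x) = T k x"
  using assms by (cases "x = 0") (auto simp: lin_ext_def)

lemma lin_ext_superset:
  assumes "\<And>k. T k 0 = 0" "finite S" "Poly_Mapping.keys f \<subseteq> S"
  shows "lin_ext T f = (\<Sum>k\<in>S. T k (Poly_Mapping.lookup f k))"
  unfolding lin_ext_def using assms
  by (intro sum.mono_neutral_left) (auto simp: in_keys_iff)

lemma lin_ext_add:
  fixes T :: "'k \<Rightarrow> 'b::ab_group_add \<Rightarrow> 'c::ab_group_add"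
  assumes "\<And>k x y. T k (x + y) = T k x + T k y"
  shows "lin_ext T (f + g) = lin_ext T f + lin_ext T g"
proof -
  have z: "T k 0 = 0" for k
    using assms[of k 0 0] by simp
  let ?S = "Poly_Mapping.keys f \<union> Poly_Mapping.keys g"
  have "lin_ext T h = (\<Sum>k\<in>?S. T k (Poly_Mapping.lookup h k))" if "Poly_Mapping.keys h \<subseteq> ?S" for h
    using that z by (intro lin_ext_superset) auto
  moreover have "Poly_Mapping.keys (f + g) \<subseteq> ?S"
    by (rule Poly_Mapping.keys_add)
  ultimately show ?thesis
    by (simp add: Poly_Mapping.lookup_add assms sum.distrib)
qed

lemma lin_ext_add_fun:
  "lin_ext (\<lambda>k x. T k x + U k x) f = lin_ext T f + lin_ext U f"
  by (simp add: lin_ext_def sum.distrib)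

lemma lin_ext2_single:
  assumes "\<And>r s x. T r x s 0 = 0" "\<And>r s y. T r 0 s y = 0"
  shows "lin_ext2 T (Poly_Mapping.single r x) (Poly_Mapping.single s y) = T r x s y"
  unfolding lin_ext2_def using assms by (simp add: lin_ext_single)

lemma lin_ext2_add_left:
  fixes T :: "'k \<Rightarrow> 'b::ab_group_add \<Rightarrow> 'k \<Rightarrow> 'b \<Rightarrow> 'c::ab_group_add"
  assumes "\<And>r s x x' y. T r (x + x') s y = T r x s y + T r x' s y"
  shows "lin_ext2 T (f + f') g = lin_ext2 T f g + lin_ext2 T f' g"
  unfolding lin_ext2_def
  by (rule lin_ext_add) (simp add: lin_ext_def assms sum.distrib)

lemma lin_ext2_add_right:
  fixes T :: "'k \<Rightarrow> 'b::ab_group_add \<Rightarrow> 'k \<Rightarrow> 'b \<Rightarrow> 'c::ab_group_add"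
  assumes "\<And>r s x y y'. T r x s (y + y') = T r x s y + T r x s y'"
  shows "lin_ext2 T f (g + g') = lin_ext2 T f g + lin_ext2 T f g'"
  unfolding lin_ext2_def
  by (simp add: lin_ext_add assms lin_ext_add_fun)

lemma pm_lookup_scale:
  assumes "sc c 0 = 0"
  shows "Poly_Mapping.lookup (pm_scale sc c f) k = sc c (Poly_Mapping.lookup f k)"
  using assms by (auto simp: pm_scale_def Poly_Mapping.map.rep_eq when_def)

lemma pm_scale_single:
  assumes "sc c 0 = 0"
  shows "pm_scale sc c (Poly_Mapping.single k x) = Poly_Mapping.single k (sc c x)"
  by (rule poly_mapping_eqI) (simp add: pm_lookup_scale assms Poly_Mapping.lookup_single when_def)

lemma vector_space_pm_scale:
  fixes sc :: "complex \<Rightarrow> 'b::ab_group_add \<Rightarrow> 'b"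
  assumes "vector_space sc"
  shows "vector_space (pm_scale sc :: complex \<Rightarrow> ('k \<Rightarrow>\<^sub>0 'b) \<Rightarrow> _)"
proof -
  interpret vector_space sc by fact
  show ?thesis
    by unfold_locales
      (auto intro!: poly_mapping_eqI simp: pm_lookup_scale Poly_Mapping.lookup_add
        scale_right_distrib scale_left_distrib)
qed

section \<open>General constructions of Lie brackets\<close>

definition current_bracket :: "('l::ab_group_add \<Rightarrow> 'l \<Rightarrow> 'l) \<Rightarrow>
    ('k::ab_group_add \<Rightarrow>\<^sub>0 'l) \<Rightarrow> ('k \<Rightarrow>\<^sub>0 'l) \<Rightarrow> ('k \<Rightarrow>\<^sub>0 'l)"
  where "current_bracket br = lin_ext2 (\<lambda>r X s Y. Poly_Mapping.single (r + s) (br X Y))"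

definition central_ext_bracket ::
    "('l \<Rightarrow> 'l \<Rightarrow> 'l) \<Rightarrow> ('l \<Rightarrow> 'l \<Rightarrow> 'z) \<Rightarrow> 'l \<times> 'z \<Rightarrow> 'l \<times> 'z \<Rightarrow> 'l \<times> 'z"
  where "central_ext_bracket br \<omega> = (\<lambda>(x, a) (y, b). (br x y, \<omega> x y))"

text \<open>Semidirect product with an abelian Lie algebra acting by the derivations \<open>\<delta> d\<close>.\<close>

definition semidirect_bracket :: "('l::ab_group_add \<Rightarrow> 'l \<Rightarrow> 'l) \<Rightarrow> ('d \<Rightarrow> 'l \<Rightarrow> 'l) \<Rightarrow>
    'l \<times> 'd::zero \<Rightarrow> 'l \<times> 'd \<Rightarrow> 'l \<times> 'd"
  where "semidirect_bracket br \<delta> = (\<lambda>(x, d) (y, e). (br x y + \<delta> d y - \<delta> e x, 0))"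

text \<open>The scalar by which \<open>\<Sum>\<^sub>i c\<^sub>i d\<^sub>i\<close> acts in degree \<open>m\<close>.\<close>

definition deg_val :: "complex^'n::finite \<Rightarrow> int^'n \<Rightarrow> complex"
  where "deg_val c m = (\<Sum>i\<in>UNIV. c $ i * of_int (m $ i))"

definition degree_deriv :: "(complex \<Rightarrow> 'b \<Rightarrow> 'b::ab_group_add) \<Rightarrow> complex^'n::finite \<Rightarrow>
    (int^'n \<Rightarrow>\<^sub>0 'b) \<Rightarrow> (int^'n \<Rightarrow>\<^sub>0 'b)"
  where "degree_deriv sc c f =
    lin_ext (\<lambda>m x. Poly_Mapping.single m (sc (deg_val c m) x)) f"

section \<open>The centre \<open>Z\<close>\<close>

text \<open>\<open>Poly_Mapping.single m v\<close> in the free space below stands for \<open>\<Sum>\<^sub>i v\<^sub>i t\<^sup>m K\<^sub>i\<close>.\<close>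

definition K_relations :: "(int^'n::finite \<Rightarrow>\<^sub>0 complex^'n) set"
  where "K_relations = module.span (pm_scale (*s))
    (range (\<lambda>m. Poly_Mapping.single m (\<chi> i. of_int (m $ i))))"

interpretation KF: vector_space "pm_scale (*s) :: complex \<Rightarrow> (int^'n::finite \<Rightarrow>\<^sub>0 complex^'n) \<Rightarrow> _"
  by (rule vector_space_pm_scale) (rule vec.vector_space_axioms)

lemma K_relations_subspace: "KF.subspace K_relations"
  unfolding K_relations_def by (rule KF.subspace_span)

lemma K_relations_generator: "Poly_Mapping.single m (\<chi> i. of_int (m $ i)) \<in> K_relations"
  unfolding K_relations_def by (rule KF.span_base) simp

quotient_type (overloaded) 'n centre =
  "int^'n::finite \<Rightarrow>\<^sub>0 complex^'n" / "\<lambda>f g. f - g \<in> K_relations"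
  morphisms rep_centre K_class
proof (rule equivpI)
  show "reflp (\<lambda>f g. f - g \<in> (K_relations :: (int^'n \<Rightarrow>\<^sub>0 complex^'n) set))"
    by (simp add: reflp_def KF.subspace_0[OF K_relations_subspace])
  show "symp (\<lambda>f g. f - g \<in> (K_relations :: (int^'n \<Rightarrow>\<^sub>0 complex^'n) set))"
    by (auto simp: symp_def dest: KF.subspace_neg[OF K_relations_subspace])
  show "transp (\<lambda>f g. f - g \<in> (K_relations :: (int^'n \<Rightarrow>\<^sub>0 complex^'n) set))"
    by (auto simp: transp_def dest: KF.subspace_add[OF K_relations_subspace])
qed

lemma K_class_eq_iff: "K_class f = K_class g \<longleftrightarrow> f - g \<in> K_relations"
  by (rule centre.abs_eq_iff)

instantiation centre :: (finite) ab_group_add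
begin

lift_definition zero_centre :: "'a centre" is 0 .

lift_definition plus_centre :: "'a centre \<Rightarrow> 'a centre \<Rightarrow> 'a centre" is "(+)"
  using KF.subspace_add[OF K_relations_subspace] by (fastforce simp: algebra_simps)

lift_definition minus_centre :: "'a centre \<Rightarrow> 'a centre \<Rightarrow> 'a centre" is "(-)"
  using KF.subspace_diff[OF K_relations_subspace] by (fastforce simp: algebra_simps)

lift_definition uminus_centre :: "'a centre \<Rightarrow> 'a centre" is uminus
  using KF.subspace_neg[OF K_relations_subspace] by fastforce

instance
  by standard (transfer, simp add: algebra_simps KF.subspace_0[OF K_relations_subspace])+

end

lift_definition K_scale :: "complex \<Rightarrow> 'n::finite centre \<Rightarrow> 'n centre" is "pm_scale (*s)"
  using KF.subspace_scale[OF K_relations_subspace]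
  by (fastforce simp: KF.scale_right_diff_distrib[symmetric])

interpretation K: vector_space K_scale
  by unfold_locales
    (transfer, simp add: KF.scale_right_distrib KF.scale_left_distrib
      KF.subspace_0[OF K_relations_subspace])+

definition tK :: "int^'n::finite \<Rightarrow> 'n \<Rightarrow> 'n centre"
  where "tK m i = K_class (Poly_Mapping.single m (axis i 1))"

text \<open>\<open>d(t\<^sup>r) t\<^sup>s\<close>\<close>

definition dt :: "int^'n::finite \<Rightarrow> int^'n \<Rightarrow> 'n centre"
  where "dt r s = (\<Sum>i\<in>UNIV. K_scale (of_int (r $ i)) (tK (r + s) i))"


lemma additive_zeroI:
  fixes F :: "'a::ab_group_add \<Rightarrow> 'b::ab_group_add"
  assumes "\<And>x y. F (x + y) = F x + F y"
  shows "F 0 = 0" "F (- x) = - F x" "F (x - y) = F x - F y"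
proof -
  interpret additive F by standard (rule assms)
  show "F 0 = 0" "F (- x) = - F x" "F (x - y) = F x - F y"
    by (simp_all add: zero minus diff)
qed

lemma lin_ext_scale:
  fixes T :: "'k \<Rightarrow> 'b::ab_group_add \<Rightarrow> 'c::ab_group_add"
  assumes "\<And>k x y. T k (x + y) = T k x + T k y"
    and "\<And>k x. T k (sc c x) = sc' (T k x)"
    and "\<And>x y. sc c (x + y) = sc c x + sc c y"
    and "\<And>x y. sc' (x + y) = sc' x + sc' y"
  shows "lin_ext T (pm_scale sc c f) = sc' (lin_ext T f)"
proof (induction f rule: pm_induct)
  case (single k x)
  have z: "T k 0 = 0" for k by (rule additive_zeroI) (rule assms)
  have "sc c 0 = 0" by (rule additive_zeroI) (rule assms)
  then show ?case by (simp add: pm_scale_single lin_ext_single z assms)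
next
  case (add f g)
  have "sc c 0 = 0" by (rule additive_zeroI) (rule assms)
  then have "pm_scale sc c (f + g) = pm_scale sc c f + pm_scale sc c g"
    by (intro poly_mapping_eqI) (simp add: pm_lookup_scale Poly_Mapping.lookup_add assms)
  with add show ?case by (simp add: lin_ext_add assms)
qed

lemma single_eqI: "x = y \<Longrightarrow> Poly_Mapping.single k x = Poly_Mapping.single k y"
  by simp

lemma deg_val_simps:
  "deg_val (c + d) m = deg_val c m + deg_val d m"
  "deg_val c (m + m') = deg_val c m + deg_val c m'"
  "deg_val (a *s c) m = a * deg_val c m"
  "deg_val 0 m = 0" "deg_val c 0 = 0"
  by (simp_all add: deg_val_def algebra_simps sum.distrib sum_distrib_left)

lemma degree_deriv_additive:
  assumes "vector_space sc"
  shows "degree_deriv sc c (f + g) = degree_deriv sc c f + degree_deriv sc c g"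
    and "degree_deriv sc c (pm_scale sc a f) = pm_scale sc a (degree_deriv sc c f)"
    and "degree_deriv sc c (Poly_Mapping.single m x) = Poly_Mapping.single m (sc (deg_val c m) x)"
proof -
  interpret vector_space sc by fact
  interpret P: vector_space "pm_scale sc" by (rule vector_space_pm_scale) fact
  show "degree_deriv sc c (f + g) = degree_deriv sc c f + degree_deriv sc c g"
    unfolding degree_deriv_def
    by (rule lin_ext_add) (simp add: scale_right_distrib Poly_Mapping.single_add)
  show "degree_deriv sc c (pm_scale sc a f) = pm_scale sc a (degree_deriv sc c f)"
    unfolding degree_deriv_def
    by (rule lin_ext_scale)
      (simp_all add: scale_right_distrib P.scale_right_distrib Poly_Mapping.single_add
        pm_scale_single mult.commute)
  show "degree_deriv sc c (Poly_Mapping.single m x) = Poly_Mapping.single m (sc (deg_val c m) x)"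
    unfolding degree_deriv_def by (simp add: lin_ext_single)
qed

lemma K_relations_induct:
  assumes "f \<in> K_relations"
    and "\<And>f g. F (f + g) = F f + F g"
    and "\<And>c f. F (pm_scale (*s) c f) = sc c (F f)"
    and "module.subspace sc S" "vector_space sc"
    and "\<And>m. F (Poly_Mapping.single m (\<chi> i. of_int (m $ i))) \<in> S"
  shows "F f \<in> S"
proof -
  interpret S: vector_space sc by fact
  have S: "S.subspace S" by fact
  have z: "F 0 = 0" by (rule additive_zeroI) (rule assms)
  show ?thesis
    using assms(1) unfolding K_relations_def
  proof (induction rule: KF.span_induct)
    case base
    show ?case
      using S by (auto intro!: KF.subspaceI simp: z assms S.subspace_def)
  next
    case (step x)
    then show ?case using assms(6) by auto
  qed
qed

lift_definition K_deriv :: "complex^'n::finite \<Rightarrow> 'n centre \<Rightarrow> 'n centre" is "degree_deriv (*s)"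
proof -
  fix c :: "complex^'n" and f g :: "int^'n \<Rightarrow>\<^sub>0 complex^'n"
  note A = degree_deriv_additive[OF vec.vector_space_axioms, of c]
  assume "f - g \<in> K_relations"
  then have "degree_deriv (*s) c (f - g) \<in> K_relations"
  proof (rule K_relations_induct[OF _ A(1,2) K_relations_subspace KF.vector_space_axioms])
    fix m :: "int^'n"
    have "pm_scale (*s) (deg_val c m) (Poly_Mapping.single m (\<chi> i. of_int (m $ i))) \<in> K_relations"
      by (rule KF.subspace_scale[OF K_relations_subspace K_relations_generator])
    then show "degree_deriv (*s) c (Poly_Mapping.single m (\<chi> i. of_int (m $ i))) \<in> K_relations"
      by (simp add: A(3) pm_scale_single)
  qed
  then show "degree_deriv (*s) c f - degree_deriv (*s) c g \<in> K_relations"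
    by (simp add: additive_zeroI(3)[of "degree_deriv (*s) c", OF A(1)])
qed

section \<open>The toroidal Lie algebra \<open>\<tau>\<close>\<close>

type_synonym ('g, 'n) toroidal = "((int^'n \<Rightarrow>\<^sub>0 'g) \<times> 'n centre) \<times> (complex^'n)"

definition toroidal_scale :: "(complex \<Rightarrow> 'g \<Rightarrow> 'g) \<Rightarrow> complex \<Rightarrow>
    ('g::ab_group_add, 'n::finite) toroidal \<Rightarrow> ('g, 'n) toroidal"
  where "toroidal_scale sg =
    module_prod.scale (module_prod.scale (pm_scale sg) K_scale) (*s)"

definition toroidal_cocycle :: "('g \<Rightarrow> 'g \<Rightarrow> complex) \<Rightarrow>
    (int^'n \<Rightarrow>\<^sub>0 'g::ab_group_add) \<Rightarrow> (int^'n \<Rightarrow>\<^sub>0 'g) \<Rightarrow> 'n::finite centre"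
  where "toroidal_cocycle form = lin_ext2 (\<lambda>r X s Y. K_scale (form X Y) (dt r s))"

definition toroidal_deriv :: "(complex \<Rightarrow> 'g \<Rightarrow> 'g) \<Rightarrow> complex^'n \<Rightarrow>
    (int^'n \<Rightarrow>\<^sub>0 'g::ab_group_add) \<times> 'n::finite centre \<Rightarrow> (int^'n \<Rightarrow>\<^sub>0 'g) \<times> 'n centre"
  where "toroidal_deriv sg c = (\<lambda>(f, z). (degree_deriv sg c f, K_deriv c z))"

definition toroidal_bracket :: "(complex \<Rightarrow> 'g \<Rightarrow> 'g) \<Rightarrow> ('g \<Rightarrow> 'g \<Rightarrow> 'g) \<Rightarrow> ('g \<Rightarrow> 'g \<Rightarrow> complex) \<Rightarrow>
    ('g::ab_group_add, 'n::finite) toroidal \<Rightarrow> ('g, 'n) toroidal \<Rightarrow> ('g, 'n) toroidal"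
  where "toroidal_bracket sg br form =
    semidirect_bracket
      (central_ext_bracket (current_bracket br) (toroidal_cocycle form))
      (toroidal_deriv sg)"

definition tau_X :: "'g::ab_group_add \<Rightarrow> int^'n \<Rightarrow> ('g, 'n::finite) toroidal"
  where "tau_X X m = ((Poly_Mapping.single m X, 0), 0)"

definition tau_K :: "int^'n \<Rightarrow> 'n \<Rightarrow> ('g::ab_group_add, 'n::finite) toroidal"
  where "tau_K m i = ((0, tK m i), 0)"

definition tau_d :: "'n \<Rightarrow> ('g::ab_group_add, 'n::finite) toroidal"
  where "tau_d i = ((0, 0), axis i 1)"

definition tau_cartan :: "(complex \<Rightarrow> 'g \<Rightarrow> 'g) \<Rightarrow> 'g set \<Rightarrow> ('g::ab_group_add, 'n::finite) toroidal set"
  where "tau_cartan sg H = module.span (toroidal_scale sg)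
    ((\<lambda>h. tau_X h 0) ` H \<union> range (tau_K 0) \<union> range tau_d)"

section \<open>The automorphism of \<open>\<tau>\<close> associated with an integer matrix\<close>

text \<open>Since \<open>t\<^sup>m K\<^sub>j = d(t\<^sup>e) t\<^sup>m\<^sup>-\<^sup>e\<close> with \<open>e\<close> the \<open>j\<close>-th unit vector, the prescription
  \<open>d(t\<^sup>r) t\<^sup>s \<mapsto> d(t\<^sup>B\<^sup>r) t\<^sup>B\<^sup>s\<close> amounts to \<open>t\<^sup>m K\<^sub>j \<mapsto> \<Sum>\<^sub>i B\<^sub>i\<^sub>j t\<^sup>B\<^sup>m K\<^sub>i\<close>;
  see \<open>K_aut_dt\<close> below.\<close>

definition K_aut_rep :: "int^'n^'n \<Rightarrow> (int^'n::finite \<Rightarrow>\<^sub>0 complex^'n) \<Rightarrow> (int^'n \<Rightarrow>\<^sub>0 complex^'n)"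
  where "K_aut_rep B = lin_ext (\<lambda>m v. Poly_Mapping.single (B *v m)
    (\<chi> i. \<Sum>j\<in>UNIV. of_int (B $ i $ j) * v $ j))"

lemma K_aut_rep_additive:
  "K_aut_rep B (f + g) = K_aut_rep B f + K_aut_rep B g"
  "K_aut_rep B (pm_scale (*s) c f) = pm_scale (*s) c (K_aut_rep B f)"
  "K_aut_rep B (Poly_Mapping.single m v) =
    Poly_Mapping.single (B *v m) (\<chi> i. \<Sum>j\<in>UNIV. of_int (B $ i $ j) * v $ j)"
proof -
  show "K_aut_rep B (f + g) = K_aut_rep B f + K_aut_rep B g"
    unfolding K_aut_rep_def
    by (rule lin_ext_add)
      (auto simp: Poly_Mapping.single_add[symmetric] vec_eq_iff algebra_simps sum.distrib
        intro!: single_eqI)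
  show "K_aut_rep B (pm_scale (*s) c f) = pm_scale (*s) c (K_aut_rep B f)"
    unfolding K_aut_rep_def
    by (rule lin_ext_scale)
      (auto simp: Poly_Mapping.single_add[symmetric] pm_scale_single vec_eq_iff algebra_simps
        sum.distrib sum_distrib_left KF.scale_right_distrib intro!: single_eqI)
  show "K_aut_rep B (Poly_Mapping.single m v) =
    Poly_Mapping.single (B *v m) (\<chi> i. \<Sum>j\<in>UNIV. of_int (B $ i $ j) * v $ j)"
    unfolding K_aut_rep_def
    by (rule lin_ext_single) (simp add: zero_vec_def[symmetric])
qed

lift_definition K_aut :: "int^'n^'n \<Rightarrow> 'n::finite centre \<Rightarrow> 'n centre" is K_aut_rep
proof -
  fix B :: "int^'n^'n" and f g :: "int^'n \<Rightarrow>\<^sub>0 complex^'n"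
  assume "f - g \<in> K_relations"
  then have "K_aut_rep B (f - g) \<in> K_relations"
  proof (rule K_relations_induct[OF _ K_aut_rep_additive(1,2) K_relations_subspace
        KF.vector_space_axioms])
    fix m :: "int^'n"
    have "(\<chi> i. \<Sum>j\<in>UNIV. of_int (B $ i $ j) * ((\<chi> i. of_int (m $ i)) :: complex^'n) $ j)
        = (\<chi> i. (of_int ((B *v m) $ i) :: complex))"
      by (simp add: matrix_vector_mult_def)
    then show "K_aut_rep B (Poly_Mapping.single m (\<chi> i. of_int (m $ i))) \<in> K_relations"
      unfolding K_aut_rep_additive(3) by (metis K_relations_generator)
  qed
  then show "K_aut_rep B f - K_aut_rep B g \<in> K_relations"
    by (simp add: additive_zeroI(3)[of "K_aut_rep B", OF K_aut_rep_additive(1)])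
qed

definition deg_aut :: "int^'n^'n \<Rightarrow> (int^'n::finite \<Rightarrow>\<^sub>0 'g::ab_group_add) \<Rightarrow> (int^'n \<Rightarrow>\<^sub>0 'g)"
  where "deg_aut B = lin_ext (\<lambda>r X. Poly_Mapping.single (B *v r) X)"

text \<open>On \<open>D\<close> the coefficient vector \<open>c\<close> of \<open>\<Sum>\<^sub>i c\<^sub>i d\<^sub>i\<close> is multiplied by the transpose of
  \<open>B\<^sup>-\<^sup>1\<close>.\<close>

definition D_aut :: "int^'n^'n \<Rightarrow> complex^'n::finite \<Rightarrow> complex^'n"
  where "D_aut B c = (\<chi> j. \<Sum>i\<in>UNIV. c $ i * of_int (matrix_inv B $ i $ j))"

definition toroidal_aut :: "int^'n^'n \<Rightarrow> ('g::ab_group_add, 'n::finite) toroidal \<Rightarrow> ('g, 'n) toroidal"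
  where "toroidal_aut B = (\<lambda>((f, z), c). ((deg_aut B f, K_aut B z), D_aut B c))"

definition twist :: "int^'n^'n \<Rightarrow> (('g::ab_group_add, 'n::finite) toroidal \<Rightarrow> 'v \<Rightarrow> 'v) \<Rightarrow>
    ('g, 'n) toroidal \<Rightarrow> 'v \<Rightarrow> 'v"
  where "twist B act x = act (toroidal_aut B x)"

section \<open>The Lie algebra \<open>\<g>\<^sub>a\<^sub>f\<^sub>f \<otimes> A\<^sub>n\<^sub>-\<^sub>1 \<oplus> D\<close> and the homomorphism \<open>\<phi>\<close>\<close>

text \<open>The variables \<open>t\<^sub>1, \<dots>, t\<^sub>n\<close> are indexed by \<open>'m option\<close> for a finite (nonempty) type \<open>'m\<close>:
  the index \<open>None\<close> is \<open>n\<close> and the indices \<open>Some i\<close> are \<open>1, \<dots>, n - 1\<close>.  Thus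
  \<open>n = CARD('m) + 1\<close> ranges over all integers \<open>\<ge> 2\<close>.\<close>

type_synonym 'g affine = "(int \<Rightarrow>\<^sub>0 'g) \<times> complex"

type_synonym ('g, 'm) multiloop_affine = "(int^'m \<Rightarrow>\<^sub>0 'g affine) \<times> (complex^('m option))"

definition affine_scale :: "(complex \<Rightarrow> 'g \<Rightarrow> 'g) \<Rightarrow> complex \<Rightarrow> 'g::ab_group_add affine \<Rightarrow> 'g affine"
  where "affine_scale sg = module_prod.scale (pm_scale sg) (*)"

definition affine_cocycle :: "('g \<Rightarrow> 'g \<Rightarrow> complex) \<Rightarrow>
    (int \<Rightarrow>\<^sub>0 'g::ab_group_add) \<Rightarrow> (int \<Rightarrow>\<^sub>0 'g) \<Rightarrow> complex"
  where "affine_cocycle form =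
    lin_ext2 (\<lambda>a x b y. if a + b = 0 then of_int a * form x y else 0)"

definition affine_bracket :: "('g \<Rightarrow> 'g \<Rightarrow> 'g) \<Rightarrow> ('g \<Rightarrow> 'g \<Rightarrow> complex) \<Rightarrow>
    'g::ab_group_add affine \<Rightarrow> 'g affine \<Rightarrow> 'g affine"
  where "affine_bracket br form =
    central_ext_bracket (current_bracket br) (affine_cocycle form)"

definition join_deg :: "int \<Rightarrow> int^'m::finite \<Rightarrow> int^('m option)"
  where "join_deg a m = (\<chi> i. case i of None \<Rightarrow> a | Some j \<Rightarrow> m $ j)"

definition init_deg :: "int^('m option) \<Rightarrow> int^'m::finite"
  where "init_deg r = (\<chi> j. r $ Some j)"

text \<open>The action of \<open>\<Sum>\<^sub>i c\<^sub>i d\<^sub>i\<close> on the coefficient of \<open>t\<^sup>m\<close>, which lies in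
  \<open>\<g>\<^sub>a\<^sub>f\<^sub>f\<close>.\<close>

definition affine_deriv_at :: "(complex \<Rightarrow> 'g \<Rightarrow> 'g) \<Rightarrow> complex^('m option) \<Rightarrow> int^'m::finite \<Rightarrow>
    'g::ab_group_add affine \<Rightarrow> 'g affine"
  where "affine_deriv_at sg c m = (\<lambda>(f, k).
    (lin_ext (\<lambda>a X. Poly_Mapping.single a (sg (deg_val c (join_deg a m)) X)) f,
     deg_val c (join_deg 0 m) * k))"

definition affine_deriv :: "(complex \<Rightarrow> 'g \<Rightarrow> 'g) \<Rightarrow> complex^('m option) \<Rightarrow>
    (int^'m::finite \<Rightarrow>\<^sub>0 'g::ab_group_add affine) \<Rightarrow> (int^'m \<Rightarrow>\<^sub>0 'g affine)"
  where "affine_deriv sg c =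
    lin_ext (\<lambda>m p. Poly_Mapping.single m (affine_deriv_at sg c m p))"

definition multiloop_affine_scale :: "(complex \<Rightarrow> 'g \<Rightarrow> 'g) \<Rightarrow> complex \<Rightarrow>
    ('g::ab_group_add, 'm::finite) multiloop_affine \<Rightarrow> ('g, 'm) multiloop_affine"
  where "multiloop_affine_scale sg = module_prod.scale (pm_scale (affine_scale sg)) (*s)"

definition multiloop_affine_bracket ::
    "(complex \<Rightarrow> 'g \<Rightarrow> 'g) \<Rightarrow> ('g \<Rightarrow> 'g \<Rightarrow> 'g) \<Rightarrow> ('g \<Rightarrow> 'g \<Rightarrow> complex) \<Rightarrow>
    ('g::ab_group_add, 'm::finite) multiloop_affine \<Rightarrow> ('g, 'm) multiloop_affine \<Rightarrow>
    ('g, 'm) multiloop_affine"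
  where "multiloop_affine_bracket sg br form =
    semidirect_bracket (current_bracket (affine_bracket br form)) (affine_deriv sg)"

definition K_proj_rep :: "(int^('m option) \<Rightarrow>\<^sub>0 complex^('m option)) \<Rightarrow> (int^'m::finite \<Rightarrow>\<^sub>0 complex)"
  where "K_proj_rep = lin_ext (\<lambda>m v.
    if m $ None = 0 then Poly_Mapping.single (init_deg m) (v $ None) else 0)"

lemma K_proj_rep_additive:
  "K_proj_rep (f + g) = K_proj_rep f + K_proj_rep g"
  "K_proj_rep (pm_scale (*s) c f) = pm_scale (*) c (K_proj_rep f)"
  "K_proj_rep (Poly_Mapping.single m v) =
    (if m $ None = 0 then Poly_Mapping.single (init_deg m) (v $ None) else 0)"
proof -
  interpret C: vector_space "pm_scale (*) :: complex \<Rightarrow> ('k \<Rightarrow>\<^sub>0 complex) \<Rightarrow> _"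
    by (rule vector_space_pm_scale) (rule vector_space_over_itself.vector_space_axioms)
  show "K_proj_rep (f + g) = K_proj_rep f + K_proj_rep g"
    unfolding K_proj_rep_def by (rule lin_ext_add) (simp add: Poly_Mapping.single_add)
  show "K_proj_rep (pm_scale (*s) c f) = pm_scale (*) c (K_proj_rep f)"
    unfolding K_proj_rep_def
    by (rule lin_ext_scale)
      (simp_all add: Poly_Mapping.single_add pm_scale_single algebra_simps C.scale_right_distrib)
  show "K_proj_rep (Poly_Mapping.single m v) =
    (if m $ None = 0 then Poly_Mapping.single (init_deg m) (v $ None) else 0)"
    unfolding K_proj_rep_def by (rule lin_ext_single) simp
qed

lift_definition K_proj :: "('m::finite option) centre \<Rightarrow> (int^'m \<Rightarrow>\<^sub>0 complex)" is K_proj_rep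
proof -
  fix f g :: "int^('m option) \<Rightarrow>\<^sub>0 complex^('m option)"
  interpret C: vector_space "pm_scale (*) :: complex \<Rightarrow> (int^'m \<Rightarrow>\<^sub>0 complex) \<Rightarrow> _"
    by (rule vector_space_pm_scale) (rule vector_space_over_itself.vector_space_axioms)
  assume "f - g \<in> K_relations"
  then have "K_proj_rep (f - g) \<in> {0}"
    by (rule K_relations_induct[OF _ K_proj_rep_additive(1,2) C.subspace_single_0
        C.vector_space_axioms]) (simp add: K_proj_rep_additive(3))
  then show "K_proj_rep f = K_proj_rep g"
    by (simp add: additive_zeroI(3)[of K_proj_rep, OF K_proj_rep_additive(1)])
qed

definition toroidal_phi ::
    "('g::ab_group_add, 'm::finite option) toroidal \<Rightarrow> ('g, 'm) multiloop_affine"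
  where "toroidal_phi = (\<lambda>((f, z), c).
    (lin_ext (\<lambda>r X. Poly_Mapping.single (init_deg r) (Poly_Mapping.single (r $ None) X, 0)) f
       + Poly_Mapping.map (\<lambda>k. (0, k)) (K_proj z),
     c))"

section \<open>Verification of the constructions\<close>

lemma lie_algebraI:
  fixes sc :: "complex \<Rightarrow> 'l::ab_group_add \<Rightarrow> 'l"
  assumes "vector_space sc"
    and "\<And>x y z. br (x + y) z = br x z + br y z"
    and "\<And>x y z. br x (y + z) = br x y + br x z"
    and "\<And>c x y. br (sc c x) y = sc c (br x y)"
    and "\<And>c x y. br x (sc c y) = sc c (br x y)"
    and anti: "\<And>x y. br x y = - br y x"
    and "\<And>x y z. br x (br y z) + br y (br z x) + br z (br x y) = 0"
  shows "lie_algebra sc br"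
proof -
  interpret vector_space sc by fact
  have "br x x = 0" for x
  proof -
    have "br x x + br x x = 0"
      using anti[of x x] by (metis add.right_inverse)
    then have "sc 2 (br x x) = 0"
      using scale_left_distrib[of 1 1 "br x x"] by simp
    then show ?thesis by simp
  qed
  then show ?thesis
    by unfold_locales (rule assms | blast)+
qed

context lie_algebra
begin

lemma bracket_anti: "bracket x y = - bracket y x"
proof -
  have "bracket (x + y) (x + y) = bracket y x + bracket x y"
    unfolding bracket_add_left bracket_add_right by (simp add: bracket_self)
  then show ?thesis
    unfolding bracket_self by (metis add.commute eq_neg_iff_add_eq_0)
qed

lemma bracket_zero: "bracket 0 x = 0" "bracket x 0 = 0"
  using bracket_add_left[of 0 0 x] bracket_add_right[of x 0 0] by simp_all

lemma bracket_diff: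
  "bracket (x - y) z = bracket x z - bracket y z"
  "bracket z (x - y) = bracket z x - bracket z y"
  using bracket_add_left[of "x - y" y z] bracket_add_right[of z "x - y" y]
  by (simp_all add: algebra_simps)

end

lemma current_bracket_props:
  fixes br :: "'l::ab_group_add \<Rightarrow> 'l \<Rightarrow> 'l" and f g h :: "'k::ab_group_add \<Rightarrow>\<^sub>0 'l"
  assumes "lie_algebra sc br"
  shows "current_bracket br (f + g) h = current_bracket br f h + current_bracket br g h"
    and "current_bracket br h (f + g) = current_bracket br h f + current_bracket br h g"
    and "current_bracket br (Poly_Mapping.single r x) (Poly_Mapping.single s y)
      = Poly_Mapping.single (r + s) (br x y)"
proof -
  interpret lie_algebra sc br by fact
  show "current_bracket br (f + g) h = current_bracket br f h + current_bracket br g h"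
    unfolding current_bracket_def
    by (rule lin_ext2_add_left) (simp add: bracket_add_left Poly_Mapping.single_add)
  show "current_bracket br h (f + g) = current_bracket br h f + current_bracket br h g"
    unfolding current_bracket_def
    by (rule lin_ext2_add_right) (simp add: bracket_add_right Poly_Mapping.single_add)
  show "current_bracket br (Poly_Mapping.single r x) (Poly_Mapping.single s y)
      = Poly_Mapping.single (r + s) (br x y)"
    unfolding current_bracket_def by (rule lin_ext2_single) (simp_all add: bracket_zero)
qed

lemma lie_algebra_current:
  fixes br :: "'l::ab_group_add \<Rightarrow> 'l \<Rightarrow> 'l"
  assumes "lie_algebra sc br"
  shows "lie_algebra (pm_scale sc) (current_bracket br :: ('k::ab_group_add \<Rightarrow>\<^sub>0 'l) \<Rightarrow> _)"
proof -
  interpret lie_algebra sc br by fact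
  note P = vector_space_pm_scale[OF vector_space_axioms]
  interpret P: vector_space "pm_scale sc :: complex \<Rightarrow> ('k \<Rightarrow>\<^sub>0 'l) \<Rightarrow> _" by (rule P)
  note B = current_bracket_props[OF assms]
  show ?thesis
  proof (rule lie_algebraI[OF P])
    fix c and f g h :: "'k \<Rightarrow>\<^sub>0 'l"
    show "current_bracket br (pm_scale sc c f) g = pm_scale sc c (current_bracket br f g)"
    proof (induction f rule: pm_induct)
      case (single k x)
      then show ?case
        by (induction g rule: pm_induct)
          (simp_all add: B pm_scale_single bracket_scale_left P.scale_right_distrib)
    qed (simp add: B P.scale_right_distrib)
    show "current_bracket br f (pm_scale sc c g) = pm_scale sc c (current_bracket br f g)"
    proof (induction f rule: pm_induct)
      case (single k x)
      then show ?case
        by (induction g rule: pm_induct)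
          (simp_all add: B pm_scale_single bracket_scale_right P.scale_right_distrib)
    qed (simp add: B P.scale_right_distrib)
    show "current_bracket br f g = - current_bracket br g f"
    proof (induction f rule: pm_induct)
      case (single k x)
      then show ?case
      proof (induction g rule: pm_induct)
        case (single l y)
        show ?case
          using bracket_anti[of x y] by (simp add: B Poly_Mapping.single_uminus add.commute)
      qed (simp add: B)
    qed (simp add: B)
    show "current_bracket br f (current_bracket br g h)
        + current_bracket br g (current_bracket br h f)
        + current_bracket br h (current_bracket br f g) = 0" (is "?J f g h = 0")
    proof (induction f rule: pm_induct)
      case (single k x)
      show ?case
      proof (induction g rule: pm_induct)
        case (single l y)
        show ?case
        proof (induction h rule: pm_induct)
          case (single m z)
          show ?case
            using jacobi[of x y z]
            by (simp add: B Poly_Mapping.single_add[symmetric] ac_simps)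
        next
          case (add h h')
          have "?J (Poly_Mapping.single k x) (Poly_Mapping.single l y) (h + h')
            = ?J (Poly_Mapping.single k x) (Poly_Mapping.single l y) h
            + ?J (Poly_Mapping.single k x) (Poly_Mapping.single l y) h'"
            by (simp add: B)
          with add show ?case by simp
        qed
      next
        case (add g g')
        have "?J (Poly_Mapping.single k x) (g + g') h
          = ?J (Poly_Mapping.single k x) g h + ?J (Poly_Mapping.single k x) g' h"
          by (simp add: B)
        with add show ?case by simp
      qed
    next
      case (add f f')
      have "?J (f + f') g h = ?J f g h + ?J f' g h"
        by (simp add: B)
      with add show ?case by simp
    qed
  qed (rule B)+
qed

lemma vector_space_prod_scale:
  assumes "vector_space s1" "vector_space s2"
  shows "vector_space (module_prod.scale s1 s2)"
    and "module_prod.scale s1 s2 c (a, b) = (s1 c a, s2 c b)"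
proof -
  interpret V1: vector_space s1 by fact
  interpret V2: vector_space s2 by fact
  interpret vector_space_prod s1 s2 ..
  show "vector_space (module_prod.scale s1 s2)" by (rule p.vector_space_axioms)
  show "module_prod.scale s1 s2 c (a, b) = (s1 c a, s2 c b)" by (rule scale_prod)
qed

lemma lie_algebra_central_ext:
  assumes "lie_algebra sc br" "vector_space sz"
    and "\<And>x y z. \<omega> (x + y) z = \<omega> x z + \<omega> y z"
    and "\<And>x y z. \<omega> x (y + z) = \<omega> x y + \<omega> x z"
    and "\<And>c x y. \<omega> (sc c x) y = sz c (\<omega> x y)"
    and "\<And>c x y. \<omega> x (sc c y) = sz c (\<omega> x y)"
    and "\<And>x y. \<omega> x y = - \<omega> y x"
    and "\<And>x y z. \<omega> x (br y z) + \<omega> y (br z x) + \<omega> z (br x y) = 0"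
  shows "lie_algebra (module_prod.scale sc sz) (central_ext_bracket br \<omega>)"
proof -
  interpret lie_algebra sc br by fact
  note P = vector_space_prod_scale[OF vector_space_axioms assms(2)]
  have P2: "module_prod.scale sc sz c p = (sc c (fst p), sz c (snd p))" for c p
    using P(2)[of c "fst p" "snd p"] by simp
  show ?thesis
  proof (rule lie_algebraI[OF P(1)])
    fix p q
    show "central_ext_bracket br \<omega> p q = - central_ext_bracket br \<omega> q p"
      using bracket_anti[of "fst p" "fst q"] assms(7)[of "fst p" "fst q"]
      by (simp add: central_ext_bracket_def prod_eq_iff split_beta)
  qed (simp_all add: P2 central_ext_bracket_def assms(3-6,8) bracket_add_left bracket_add_right
      bracket_scale_left bracket_scale_right jacobi prod_eq_iff split_beta)
qed

lemma lie_algebra_semidirect: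
  fixes sc :: "complex \<Rightarrow> 'l::ab_group_add \<Rightarrow> 'l" and sd :: "complex \<Rightarrow> 'd::ab_group_add \<Rightarrow> 'd"
  assumes "lie_algebra sc br" "vector_space sd"
    and add: "\<And>d x y. \<delta> d (x + y) = \<delta> d x + \<delta> d y"
    and addl: "\<And>d e x. \<delta> (d + e) x = \<delta> d x + \<delta> e x"
    and scl: "\<And>c d x. \<delta> d (sc c x) = sc c (\<delta> d x)"
    and scll: "\<And>c d x. \<delta> (sd c d) x = sc c (\<delta> d x)"
    and der: "\<And>d x y. \<delta> d (br x y) = br (\<delta> d x) y + br x (\<delta> d y)"
    and comm: "\<And>d e x. \<delta> d (\<delta> e x) = \<delta> e (\<delta> d x)"
  shows "lie_algebra (module_prod.scale sc sd) (semidirect_bracket br \<delta>)"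
proof -
  interpret lie_algebra sc br by fact
  note P = vector_space_prod_scale[OF vector_space_axioms assms(2)]
  interpret D: vector_space sd by fact
  have P2: "module_prod.scale sc sd c p = (sc c (fst p), sd c (snd p))" for c p
    using P(2)[of c "fst p" "snd p"] by simp
  have diff: "\<delta> d (x - y) = \<delta> d x - \<delta> d y" for d x y
    by (rule additive_zeroI) (rule add)
  have z: "\<delta> 0 x = 0" for x
    using addl[of 0 0 x] by simp
  show ?thesis
  proof (rule lie_algebraI[OF P(1)])
    fix p q :: "'l \<times> 'd"
    show "semidirect_bracket br \<delta> p q = - semidirect_bracket br \<delta> q p"
      using bracket_anti[of "fst p" "fst q"]
      by (simp add: semidirect_bracket_def prod_eq_iff split_beta)
  next
    fix p q r :: "'l \<times> 'd"
    obtain x d y e w f where [simp]: "p = (x, d)" "q = (y, e)" "r = (w, f)"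
      by (metis prod.exhaust)
    show "semidirect_bracket br \<delta> p (semidirect_bracket br \<delta> q r)
      + semidirect_bracket br \<delta> q (semidirect_bracket br \<delta> r p)
      + semidirect_bracket br \<delta> r (semidirect_bracket br \<delta> p q) = 0"
      using jacobi[of x y w] bracket_anti[of "\<delta> d y" w] bracket_anti[of "\<delta> e w" x]
        bracket_anti[of "\<delta> f x" y]
      by (simp add: semidirect_bracket_def z add diff der comm[of e d] comm[of f d] comm[of f e]
          bracket_add_left bracket_add_right bracket_diff prod_eq_iff)
  qed (simp_all add: P2 semidirect_bracket_def add addl scl scll bracket_add_left bracket_add_right
      bracket_scale_left bracket_scale_right scale_right_distrib scale_right_diff_distrib
      prod_eq_iff split_beta)
qed

lemma sum_K_scale_tK:
  "(\<Sum>i\<in>UNIV. K_scale (c i) (tK m i)) = K_class (Poly_Mapping.single m (\<chi> i. c i))"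
proof -
  have "(\<Sum>i\<in>A. K_scale (c i) (tK m i)) = K_class (Poly_Mapping.single m (\<Sum>i\<in>A. c i *s axis i 1))"
    for A
    by (induction A rule: infinite_finite_induct)
      (simp_all add: tK_def K_scale.abs_eq plus_centre.abs_eq pm_scale_single
        Poly_Mapping.single_add zero_centre_def)
  then show ?thesis
    using basis_expansion[of "\<chi> i. c i"] by simp
qed

lemma dt_eq: "dt r s = K_class (Poly_Mapping.single (r + s) (\<chi> i. of_int (r $ i)))"
  unfolding dt_def by (rule sum_K_scale_tK)

lemma tK_relation: "(\<Sum>i\<in>UNIV. K_scale (of_int (m $ i)) (tK m i)) = 0"
  unfolding sum_K_scale_tK zero_centre_def using K_relations_generator[of m]
  by (simp add: K_class_eq_iff)

lemma centre_induct [case_names single add]: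
  assumes "\<And>m v. P (K_class (Poly_Mapping.single m v))"
    and "\<And>y z. P y \<Longrightarrow> P z \<Longrightarrow> P (y + z)"
  shows "P z"
proof -
  have "P (K_class f)" for f
  proof (induction f rule: pm_induct)
    case (add f g)
    then show ?case using assms(2) by (metis plus_centre.abs_eq)
  qed (rule assms)
  then show ?thesis by (metis centre.abs_induct)
qed

lemma dt_add_deg: "r + s + u = N \<Longrightarrow> dt r (s + u) + dt s (u + r) + dt u (r + s) = 0"
proof -
  assume N: "r + s + u = N"
  have *: "r + (s + u) = N" "s + (u + r) = N" "u + (r + s) = N"
    using N by (simp_all add: ac_simps)
  have v: "(\<chi> i. of_int (r $ i)) + (\<chi> i. of_int (s $ i)) + (\<chi> i. of_int (u $ i))
    = ((\<chi> i. of_int (N $ i)) :: complex^'a)"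
    by (auto simp: vec_eq_iff N[symmetric])
  have "dt r (s + u) + dt s (u + r) + dt u (r + s)
    = K_class (Poly_Mapping.single N (\<chi> i. of_int (N $ i)))"
    unfolding dt_eq * by (simp only: plus_centre.abs_eq Poly_Mapping.single_add[symmetric] v)
  also have "\<dots> = 0"
    using K_relations_generator[of N] by (simp add: zero_centre_def K_class_eq_iff)
  finally show ?thesis .
qed

lemma dt_anti: "dt s r = - dt r s"
proof -
  have "dt 0 (r + s) = 0"
    by (simp add: dt_eq zero_vec_def[symmetric] zero_centre_def)
  then show ?thesis
    using dt_add_deg[of r s 0] by (simp add: add_eq_0_iff)
qed

lemma K_deriv_props:
  "K_deriv c (y + z) = K_deriv c y + K_deriv c z"
  "K_deriv (c + d) z = K_deriv c z + K_deriv d z"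
  "K_deriv c (K_scale a z) = K_scale a (K_deriv c z)"
  "K_deriv (a *s c) z = K_scale a (K_deriv c z)"
  "K_deriv c (K_deriv d z) = K_deriv d (K_deriv c z)"
  "K_deriv c (K_class (Poly_Mapping.single m v)) = K_scale (deg_val c m) (K_class (Poly_Mapping.single m v))"
proof -
  note A = degree_deriv_additive[OF vec.vector_space_axioms]
  note z = KF.subspace_0[OF K_relations_subspace]
  show add: "K_deriv c (y + z) = K_deriv c y + K_deriv c z" for y z c
    by transfer (simp add: A z)
  show sc: "K_deriv c (K_scale a z) = K_scale a (K_deriv c z)" for a z c
    by transfer (simp add: A z)
  show single: "K_deriv c (K_class (Poly_Mapping.single m v)) = K_scale (deg_val c m) (K_class (Poly_Mapping.single m v))"
    for m v c
    by (simp add: K_deriv.abs_eq K_scale.abs_eq A pm_scale_single)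
  show "K_deriv (c + d) z = K_deriv c z + K_deriv d z"
    by (induction z rule: centre_induct)
      (simp_all add: single add deg_val_simps K.scale_left_distrib)
  show "K_deriv (a *s c) z = K_scale a (K_deriv c z)"
    by (induction z rule: centre_induct)
      (simp_all add: single add deg_val_simps K.scale_right_distrib)
  show "K_deriv c (K_deriv d z) = K_deriv d (K_deriv c z)"
    by (induction z rule: centre_induct) (simp_all add: single add sc mult.commute)
qed

lemma K_deriv_dt: "K_deriv c (dt r s) = K_scale (deg_val c (r + s)) (dt r s)"
  by (simp add: dt_eq K_deriv_props)

lemma degree_deriv_props:
  assumes "lie_algebra sc br"
  shows "degree_deriv sc (c + d) f = degree_deriv sc c f + degree_deriv sc d f"
    and "degree_deriv sc (a *s c) f = pm_scale sc a (degree_deriv sc c f)"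
    and "degree_deriv sc c (degree_deriv sc d f) = degree_deriv sc d (degree_deriv sc c f)"
    and "degree_deriv sc c (current_bracket br f g) =
      current_bracket br (degree_deriv sc c f) g + current_bracket br f (degree_deriv sc c g)"
proof -
  interpret lie_algebra sc br by fact
  interpret P: vector_space "pm_scale sc" by (rule vector_space_pm_scale) (rule vector_space_axioms)
  note A = degree_deriv_additive[OF vector_space_axioms]
  note B = current_bracket_props[OF assms]
  show "degree_deriv sc (c + d) f = degree_deriv sc c f + degree_deriv sc d f"
    by (induction f rule: pm_induct)
      (simp_all add: A deg_val_simps scale_left_distrib Poly_Mapping.single_add)
  show "degree_deriv sc (a *s c) f = pm_scale sc a (degree_deriv sc c f)"
    by (induction f rule: pm_induct)
      (simp_all add: A deg_val_simps pm_scale_single P.scale_right_distrib)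
  show "degree_deriv sc c (degree_deriv sc d f) = degree_deriv sc d (degree_deriv sc c f)"
    by (induction f rule: pm_induct) (simp_all add: A mult.commute)
  show "degree_deriv sc c (current_bracket br f g) =
      current_bracket br (degree_deriv sc c f) g + current_bracket br f (degree_deriv sc c g)"
  proof (induction f rule: pm_induct)
    case (single k x)
    show ?case
      by (induction g rule: pm_induct)
        (simp_all add: A B deg_val_simps bracket_scale_left bracket_scale_right
          scale_left_distrib Poly_Mapping.single_add)
  qed (simp add: A B)
qed

locale form_lie_algebra = lie_algebra sg br
  for sg :: "complex \<Rightarrow> 'g::ab_group_add \<Rightarrow> 'g" and br +
  fixes form :: "'g \<Rightarrow> 'g \<Rightarrow> complex"
  assumes form: "invariant_form form"
begin

lemma form_props:
  "form (x + y) z = form x z + form y z" "form z (x + y) = form z x + form z y"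
  "form (sg c x) y = c * form x y" "form y (sg c x) = c * form y x"
  "form (br x y) z = form x (br y z)" "form x y = form y x"
  "form 0 x = 0" "form x 0 = 0"
proof -
  show l: "form (x + y) z = form x z + form y z" for x y z
    using form unfolding invariant_form_def by blast
  show sy: "form x y = form y x" for x y
    using form unfolding invariant_form_def by blast
  show "form z (x + y) = form z x + form z y"
    using l sy by metis
  show s: "form (sg c x) y = c * form x y" for c x y
    using form unfolding invariant_form_def by blast
  show "form y (sg c x) = c * form y x"
    using s sy by metis
  show "form (br x y) z = form x (br y z)"
    using form unfolding invariant_form_def by blast
  show z: "form 0 x = 0" for x
    using s[of 0 x x] by (metis mult_zero_left s scale_zero_left)
  show "form x 0 = 0"
    using z sy by metis
qed

lemma form_cyclic: "form y (br z x) = form x (br y z)" "form z (br x y) = form x (br y z)"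
  using form_props(5,6) by metis+

lemma toroidal_cocycle_props:
  "toroidal_cocycle form (f + g) h = toroidal_cocycle form f h + toroidal_cocycle form g h"
  "toroidal_cocycle form h (f + g) = toroidal_cocycle form h f + toroidal_cocycle form h g"
  "toroidal_cocycle form (Poly_Mapping.single r X) (Poly_Mapping.single s Y) =
    K_scale (form X Y) (dt r s)"
proof -
  show "toroidal_cocycle form (f + g) h = toroidal_cocycle form f h + toroidal_cocycle form g h"
    unfolding toroidal_cocycle_def
    by (rule lin_ext2_add_left) (simp add: form_props(1) K.scale_left_distrib)
  show "toroidal_cocycle form h (f + g) = toroidal_cocycle form h f + toroidal_cocycle form h g"
    unfolding toroidal_cocycle_def
    by (rule lin_ext2_add_right) (simp add: form_props(2) K.scale_left_distrib)
  show "toroidal_cocycle form (Poly_Mapping.single r X) (Poly_Mapping.single s Y) =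
    K_scale (form X Y) (dt r s)"
    unfolding toroidal_cocycle_def by (rule lin_ext2_single) (simp_all add: form_props(7,8))
qed

lemma affine_cocycle_props:
  "affine_cocycle form (f + g) h = affine_cocycle form f h + affine_cocycle form g h"
  "affine_cocycle form h (f + g) = affine_cocycle form h f + affine_cocycle form h g"
  "affine_cocycle form (Poly_Mapping.single a X) (Poly_Mapping.single b Y) =
    (if a + b = 0 then of_int a * form X Y else 0)"
proof -
  show "affine_cocycle form (f + g) h = affine_cocycle form f h + affine_cocycle form g h"
    unfolding affine_cocycle_def
    by (rule lin_ext2_add_left) (simp add: form_props(1) algebra_simps)
  show "affine_cocycle form h (f + g) = affine_cocycle form h f + affine_cocycle form h g"
    unfolding affine_cocycle_def
    by (rule lin_ext2_add_right) (simp add: form_props(2) algebra_simps)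
  show "affine_cocycle form (Poly_Mapping.single a X) (Poly_Mapping.single b Y) =
    (if a + b = 0 then of_int a * form X Y else 0)"
    unfolding affine_cocycle_def by (rule lin_ext2_single) (simp_all add: form_props(7,8))
qed

lemma cocycle_transfer:
  fixes \<omega> :: "('k::ab_group_add \<Rightarrow>\<^sub>0 'g) \<Rightarrow> ('k \<Rightarrow>\<^sub>0 'g) \<Rightarrow> 'z::ab_group_add"
  assumes "vector_space sz"
    and add: "\<And>f g h. \<omega> (f + g) h = \<omega> f h + \<omega> g h" "\<And>f g h. \<omega> h (f + g) = \<omega> h f + \<omega> h g"
    and single: "\<And>r s X Y. \<omega> (Poly_Mapping.single r X) (Poly_Mapping.single s Y) = sz (form X Y) (\<kappa> r s)"
    and anti: "\<And>r s. \<kappa> s r = - \<kappa> r s"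
    and cyc: "\<And>r s u. \<kappa> r (s + u) + \<kappa> s (u + r) + \<kappa> u (r + s) = 0"
  shows "lie_algebra (module_prod.scale (pm_scale sg) sz)
    (central_ext_bracket (current_bracket br) \<omega>)"
proof -
  interpret Z: vector_space sz by fact
  have L: "lie_algebra sg br" by unfold_locales
  note B = current_bracket_props[OF L]
  interpret C: lie_algebra "pm_scale sg" "current_bracket br :: ('k \<Rightarrow>\<^sub>0 'g) \<Rightarrow> _"
    by (rule lie_algebra_current) (rule L)
  show ?thesis
  proof (rule lie_algebra_central_ext)
    show "lie_algebra (pm_scale sg) (current_bracket br :: ('k \<Rightarrow>\<^sub>0 'g) \<Rightarrow> _)"
      by unfold_locales
    fix c and f g h :: "'k \<Rightarrow>\<^sub>0 'g"
    show "\<omega> (pm_scale sg c f) g = sz c (\<omega> f g)"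
    proof (induction f rule: pm_induct)
      case (single k x)
      then show ?case
        by (induction g rule: pm_induct)
          (simp_all add: assms(2-4) C.scale_right_distrib pm_scale_single form_props(3) Z.scale_right_distrib)
    qed (simp add: add C.scale_right_distrib Z.scale_right_distrib)
    show "\<omega> f (pm_scale sg c g) = sz c (\<omega> f g)"
    proof (induction f rule: pm_induct)
      case (single k x)
      then show ?case
        by (induction g rule: pm_induct)
          (simp_all add: assms(2-4) pm_scale_single form_props(4) Z.scale_right_distrib
            C.scale_right_distrib)
    qed (simp add: add Z.scale_right_distrib)
    show "\<omega> f g = - \<omega> g f"
    proof (induction f rule: pm_induct)
      case (single k x)
      then show ?case
      proof (induction g rule: pm_induct)
        case (single l y)
        show ?case
          using anti[of k l] form_props(6)[of x y] by (simp add: assms(4))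
      qed (simp add: add)
    qed (simp add: add)
    show "\<omega> f (current_bracket br g h) + \<omega> g (current_bracket br h f)
        + \<omega> h (current_bracket br f g) = 0" (is "?J f g h = 0")
    proof (induction f rule: pm_induct)
      case (single k x)
      show ?case
      proof (induction g rule: pm_induct)
        case (single l y)
        show ?case
        proof (induction h rule: pm_induct)
          case (single m z)
          have "?J (Poly_Mapping.single k x) (Poly_Mapping.single l y) (Poly_Mapping.single m z)
            = sz (form x (br y z)) (\<kappa> k (l + m) + \<kappa> l (m + k) + \<kappa> m (k + l))"
            by (simp add: B assms(4) form_cyclic[where x = x] Z.scale_right_distrib)
          then show ?case by (simp add: cyc)
        next
          case (add h h')
          have "?J (Poly_Mapping.single k x) (Poly_Mapping.single l y) (h + h')
            = ?J (Poly_Mapping.single k x) (Poly_Mapping.single l y) h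
            + ?J (Poly_Mapping.single k x) (Poly_Mapping.single l y) h'"
            by (simp add: B assms(2,3))
          with add show ?case by simp
        qed
      next
        case (add g g')
        have "?J (Poly_Mapping.single k x) (g + g') h
          = ?J (Poly_Mapping.single k x) g h + ?J (Poly_Mapping.single k x) g' h"
          by (simp add: B assms(2,3))
        with add show ?case by simp
      qed
    next
      case (add f f')
      have "?J (f + f') g h = ?J f g h + ?J f' g h"
        by (simp add: B assms(2,3))
      with add show ?case by simp
    qed
  qed (fact assms)+
qed

lemma lie_algebra_toroidal:
  "lie_algebra (toroidal_scale sg)
    (toroidal_bracket sg br form :: ('g, 'n::finite) toroidal \<Rightarrow> _)"
proof -
  have L: "lie_algebra sg br" by unfold_locales
  have P: "vector_space (pm_scale sg :: complex \<Rightarrow> (int^'n \<Rightarrow>\<^sub>0 'g) \<Rightarrow> _)"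
    by (rule vector_space_pm_scale) unfold_locales
  note A = degree_deriv_additive[OF vector_space_axioms] degree_deriv_props[OF L]
  note B = current_bracket_props[OF L]
  note S = vector_space_prod_scale(2)[OF P K.vector_space_axioms]
  have *: "K_deriv c (toroidal_cocycle form f g) =
    toroidal_cocycle form (degree_deriv sg c f) g + toroidal_cocycle form f (degree_deriv sg c g)"
    for c and f g :: "int^'n \<Rightarrow>\<^sub>0 'g"
  proof (induction f rule: pm_induct)
    case (single k x)
    show ?case
      by (induction g rule: pm_induct)
        (simp_all add: A toroidal_cocycle_props K_deriv_props(1,3) K_deriv_dt form_props(3,4)
          deg_val_simps K.scale_left_distrib algebra_simps)
  qed (simp add: A toroidal_cocycle_props K_deriv_props(1))
  show ?thesis
    unfolding toroidal_scale_def toroidal_bracket_def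
  proof (rule lie_algebra_semidirect)
    show "lie_algebra (module_prod.scale (pm_scale sg) K_scale)
      (central_ext_bracket (current_bracket br :: (int^'n \<Rightarrow>\<^sub>0 'g) \<Rightarrow> _) (toroidal_cocycle form))"
      by (rule cocycle_transfer[where \<kappa> = dt])
        (simp_all add: toroidal_cocycle_props dt_add_deg[OF refl] dt_anti[symmetric] K.vector_space_axioms)
    show "vector_space ((*s) :: complex \<Rightarrow> complex^'n \<Rightarrow> _)"
      by (rule vec.vector_space_axioms)
  qed (auto simp: toroidal_deriv_def central_ext_bracket_def A S K_deriv_props(1-4) *
      intro: K_deriv_props(5) A)
qed

end

lemma pm_map_additive:
  fixes F :: "'a::ab_group_add \<Rightarrow> 'b::ab_group_add"
  assumes "\<And>x y. F (x + y) = F x + F y"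
  shows "Poly_Mapping.map F (f + g) = Poly_Mapping.map F f + Poly_Mapping.map F g"
    and "Poly_Mapping.map F (Poly_Mapping.single k x) = Poly_Mapping.single k (F x)"
    and "Poly_Mapping.map F 0 = 0"
proof -
  have z: "F 0 = 0" by (rule additive_zeroI) (rule assms)
  have l: "Poly_Mapping.lookup (Poly_Mapping.map F f) k = F (Poly_Mapping.lookup f k)" for f k
    by (simp add: Poly_Mapping.map.rep_eq when_def z)
  show "Poly_Mapping.map F (f + g) = Poly_Mapping.map F f + Poly_Mapping.map F g"
    by (rule poly_mapping_eqI) (simp add: l Poly_Mapping.lookup_add assms)
  show "Poly_Mapping.map F (Poly_Mapping.single k x) = Poly_Mapping.single k (F x)"
    by (rule poly_mapping_eqI) (simp add: l Poly_Mapping.lookup_single when_def z)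
  show "Poly_Mapping.map F 0 = 0"
    by (rule poly_mapping_eqI) (simp add: l z)
qed

lemma map_Pair0:
  fixes f g :: "'k \<Rightarrow>\<^sub>0 'z::ab_group_add" and m :: 'k and x :: 'z
  shows
  "Poly_Mapping.map (\<lambda>k. (0::'y::ab_group_add, k)) (f + g) = Poly_Mapping.map (\<lambda>k. (0::'y::ab_group_add, k)) f + Poly_Mapping.map (\<lambda>k. (0::'y::ab_group_add, k)) g"
  "Poly_Mapping.map (\<lambda>k. (0::'y::ab_group_add, k)) (Poly_Mapping.single m x) = Poly_Mapping.single m (0, x)"
  "Poly_Mapping.map (\<lambda>k. (0::'y::ab_group_add, k)) (0 :: 'k \<Rightarrow>\<^sub>0 'z) = 0"
  by (simp_all add: pm_map_additive)

lemma join_deg_props: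
  "join_deg a m + join_deg b n = join_deg (a + b) (m + n)"
  "join_deg (r $ None) (init_deg r) = r"
  "init_deg (r + s) = init_deg r + init_deg s"
  "r $ None = 0 \<Longrightarrow> join_deg 0 (init_deg r) = r"
  by (auto simp: join_deg_def init_deg_def vec_eq_iff split: option.split)

lemma K_proj_props:
  "K_proj (y + z) = K_proj y + K_proj z"
  "K_proj (K_scale c z) = pm_scale (*) c (K_proj z)"
  "K_proj (K_class (Poly_Mapping.single m v)) =
    (if m $ None = 0 then Poly_Mapping.single (init_deg m) (v $ None) else 0)"
  "K_proj 0 = 0"
proof -
  show "K_proj (y + z) = K_proj y + K_proj z"
    by transfer (simp add: K_proj_rep_additive)
  show "K_proj (K_scale c z) = pm_scale (*) c (K_proj z)"
    by transfer (simp add: K_proj_rep_additive)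
  show "K_proj (K_class (Poly_Mapping.single m v)) =
    (if m $ None = 0 then Poly_Mapping.single (init_deg m) (v $ None) else 0)"
    by (simp add: K_proj.abs_eq K_proj_rep_additive)
  show "K_proj 0 = 0"
    unfolding zero_centre_def using K_proj_rep_additive(3)[of 0 0] by (simp add: K_proj.abs_eq)
qed

lemma K_proj_dt:
  "K_proj (K_scale c (dt r s)) = (if r $ None + s $ None = 0
    then Poly_Mapping.single (init_deg r + init_deg s) (c * of_int (r $ None)) else 0)"
  by (simp add: dt_eq K_scale.abs_eq pm_scale_single K_proj_props(3) join_deg_props(3)[symmetric])

context form_lie_algebra
begin

lemma lie_algebra_affine: "lie_algebra (affine_scale sg) (affine_bracket br form)"
  unfolding affine_scale_def affine_bracket_def
  by (rule cocycle_transfer[where \<kappa> = "\<lambda>a b. if a + b = 0 then of_int a else 0"])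
    (auto simp: affine_cocycle_props vector_space_over_itself.vector_space_axioms algebra_simps
      eq_neg_iff_add_eq_0 simp flip: of_int_add)

lemma affine_deriv_at_props:
  fixes c :: "complex^('m::finite option)"
  shows "affine_deriv_at sg c m (p + q) = affine_deriv_at sg c m p + affine_deriv_at sg c m q"
    and "affine_deriv_at sg c m (affine_scale sg a p) = affine_scale sg a (affine_deriv_at sg c m p)"
    and "affine_deriv_at sg (c + d) m p = affine_deriv_at sg c m p + affine_deriv_at sg d m p"
    and "affine_deriv_at sg (a *s c) m p = affine_scale sg a (affine_deriv_at sg c m p)"
    and "affine_deriv_at sg c m (affine_deriv_at sg d m p) =
      affine_deriv_at sg d m (affine_deriv_at sg c m p)"
    and "affine_deriv_at sg c (m + n) (affine_bracket br form p q) =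
      affine_bracket br form (affine_deriv_at sg c m p) q
      + affine_bracket br form p (affine_deriv_at sg c n q)"
    and "affine_deriv_at sg c m (Poly_Mapping.single b X, k) =
      (Poly_Mapping.single b (sg (deg_val c (join_deg b m)) X), deg_val c (join_deg 0 m) * k)"
proof -
  define T where "T c m = lin_ext (\<lambda>a X. Poly_Mapping.single a (sg (deg_val c (join_deg a m)) X))"
    for c and m :: "int^'m"
  interpret P: vector_space "pm_scale sg :: complex \<Rightarrow> (int \<Rightarrow>\<^sub>0 'g) \<Rightarrow> _"
    by (rule vector_space_pm_scale) unfold_locales
  have L: "lie_algebra sg br" by unfold_locales
  note B = current_bracket_props[OF L]
  have aff: "affine_scale sg c p = (pm_scale sg c (fst p), c * snd p)" for c p
    using vector_space_prod_scale(2)[OF P.vector_space_axioms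
        vector_space_over_itself.vector_space_axioms, of c "fst p" "snd p"]
    by (simp add: affine_scale_def)
  have at: "affine_deriv_at sg c m p = (T c m (fst p), deg_val c (join_deg 0 m) * snd p)" for c m p
    by (simp add: affine_deriv_at_def T_def split_beta)
  have T: "T c m (f + g) = T c m f + T c m g" for c m f g
    unfolding T_def by (rule lin_ext_add) (simp add: scale_right_distrib Poly_Mapping.single_add)
  have T1: "T c m (Poly_Mapping.single b X) =
      Poly_Mapping.single b (sg (deg_val c (join_deg b m)) X)" for c m b X
    unfolding T_def by (simp add: lin_ext_single)
  have Ts: "T c m (pm_scale sg a f) = pm_scale sg a (T c m f)" for c m a f
    unfolding T_def
    by (rule lin_ext_scale)
      (simp_all add: scale_right_distrib P.scale_right_distrib Poly_Mapping.single_add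
        pm_scale_single mult.commute)
  have Tc: "T (c + d) m f = T c m f + T d m f" for c d m f
    by (induction f rule: pm_induct)
      (simp_all add: T T1 deg_val_simps scale_left_distrib Poly_Mapping.single_add)
  have Tcs: "T (a *s c) m f = pm_scale sg a (T c m f)" for a c m f
    by (induction f rule: pm_induct)
      (simp_all add: T T1 deg_val_simps pm_scale_single P.scale_right_distrib)
  have TT: "T c m (T d m f) = T d m (T c m f)" for c d m f
    by (induction f rule: pm_induct) (simp_all add: T T1 mult.commute)
  have TB: "T c (m + n) (current_bracket br f g) =
      current_bracket br (T c m f) g + current_bracket br f (T c n g)" for c m n f g
  proof (induction f rule: pm_induct)
    case (single k x)
    show ?case
      by (induction g rule: pm_induct)
        (simp_all add: T T1 B deg_val_simps bracket_scale_left bracket_scale_right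
          scale_left_distrib Poly_Mapping.single_add join_deg_props(1)[symmetric])
  qed (simp add: T B)
  have TK: "deg_val c (join_deg 0 (m + n)) * affine_cocycle form f g =
      affine_cocycle form (T c m f) g + affine_cocycle form f (T c n g)" for c m n f g
  proof (induction f rule: pm_induct)
    case (single k x)
    show ?case
    proof (induction g rule: pm_induct)
      case (single l y)
      have "deg_val c (join_deg k m) + deg_val c (join_deg l n) = deg_val c (join_deg 0 (m + n))"
        if "k + l = 0"
        using that by (simp add: deg_val_simps(2)[symmetric] join_deg_props(1))
      then have "k + l = 0 \<Longrightarrow> deg_val c (join_deg 0 (m + n)) * (of_int k * form x y) =
        of_int k * (deg_val c (join_deg k m) * form x y) + of_int k * (deg_val c (join_deg l n) * form x y)"
        by (metis (no_types, lifting) distrib_left distrib_right mult.left_commute)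
      then show ?case
        by (simp add: T1 affine_cocycle_props form_props(3,4))
    qed (simp add: T affine_cocycle_props algebra_simps)
  qed (simp add: T affine_cocycle_props algebra_simps)
  show "affine_deriv_at sg c m (p + q) = affine_deriv_at sg c m p + affine_deriv_at sg c m q"
    by (simp add: at T algebra_simps)
  show "affine_deriv_at sg c m (affine_scale sg a p) = affine_scale sg a (affine_deriv_at sg c m p)"
    by (simp add: at aff Ts)
  show "affine_deriv_at sg (c + d) m p = affine_deriv_at sg c m p + affine_deriv_at sg d m p"
    by (simp add: at Tc deg_val_simps algebra_simps)
  show "affine_deriv_at sg (a *s c) m p = affine_scale sg a (affine_deriv_at sg c m p)"
    by (simp add: at aff Tcs deg_val_simps)
  show "affine_deriv_at sg c m (affine_deriv_at sg d m p) =
      affine_deriv_at sg d m (affine_deriv_at sg c m p)"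
    by (simp add: at TT)
  show "affine_deriv_at sg c (m + n) (affine_bracket br form p q) =
      affine_bracket br form (affine_deriv_at sg c m p) q
      + affine_bracket br form p (affine_deriv_at sg c n q)"
    by (simp add: at affine_bracket_def central_ext_bracket_def split_beta TB TK)
  show "affine_deriv_at sg c m (Poly_Mapping.single b X, k) =
      (Poly_Mapping.single b (sg (deg_val c (join_deg b m)) X), deg_val c (join_deg 0 m) * k)"
    by (simp add: at T1)
qed

lemma affine_deriv_props:
  fixes c :: "complex^('m::finite option)"
  shows "affine_deriv sg c (f + g) = affine_deriv sg c f + affine_deriv sg c g"
    and "affine_deriv sg c (Poly_Mapping.single m p) = Poly_Mapping.single m (affine_deriv_at sg c m p)"
proof -
  show "affine_deriv sg c (f + g) = affine_deriv sg c f + affine_deriv sg c g"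
    unfolding affine_deriv_def
    by (rule lin_ext_add) (simp add: affine_deriv_at_props(1) Poly_Mapping.single_add)
  have "affine_deriv_at sg c m 0 = 0" for m
    by (rule additive_zeroI(1)) (rule affine_deriv_at_props(1))
  then show "affine_deriv sg c (Poly_Mapping.single m p) = Poly_Mapping.single m (affine_deriv_at sg c m p)"
    unfolding affine_deriv_def by (simp add: lin_ext_single)
qed

lemma lie_algebra_multiloop_affine:
  "lie_algebra (multiloop_affine_scale sg)
    (multiloop_affine_bracket sg br form :: ('g, 'm::finite) multiloop_affine \<Rightarrow> _)"
proof -
  interpret A: lie_algebra "affine_scale sg" "affine_bracket br form" by (rule lie_algebra_affine)
  interpret C: lie_algebra "pm_scale (affine_scale sg)"
    "current_bracket (affine_bracket br form) :: (int^'m \<Rightarrow>\<^sub>0 'g affine) \<Rightarrow> _"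
    by (rule lie_algebra_current) (rule lie_algebra_affine)
  note B = current_bracket_props[OF lie_algebra_affine]
  note D = affine_deriv_props affine_deriv_at_props(1-5)
  show ?thesis
    unfolding multiloop_affine_scale_def multiloop_affine_bracket_def
  proof (rule lie_algebra_semidirect)
    show "lie_algebra (pm_scale (affine_scale sg))
      (current_bracket (affine_bracket br form) :: (int^'m \<Rightarrow>\<^sub>0 'g affine) \<Rightarrow> _)"
      by unfold_locales
    show "vector_space ((*s) :: complex \<Rightarrow> complex^('m option) \<Rightarrow> _)"
      by (rule vec.vector_space_axioms)
    fix c d :: "complex^('m option)" and a and f g :: "int^'m \<Rightarrow>\<^sub>0 'g affine"
    show "affine_deriv sg c (f + g) = affine_deriv sg c f + affine_deriv sg c g"
      by (rule affine_deriv_props)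
    show "affine_deriv sg (c + d) f = affine_deriv sg c f + affine_deriv sg d f"
      by (induction f rule: pm_induct) (simp_all add: D Poly_Mapping.single_add)
    show "affine_deriv sg c (pm_scale (affine_scale sg) a f)
      = pm_scale (affine_scale sg) a (affine_deriv sg c f)"
      by (induction f rule: pm_induct) (simp_all add: D pm_scale_single C.scale_right_distrib)
    show "affine_deriv sg (a *s c) f = pm_scale (affine_scale sg) a (affine_deriv sg c f)"
      by (induction f rule: pm_induct) (simp_all add: D pm_scale_single C.scale_right_distrib)
    show "affine_deriv sg c (affine_deriv sg d f) = affine_deriv sg d (affine_deriv sg c f)"
    proof (induction f rule: pm_induct)
      case (single m p)
      show ?case by (simp add: D(1,2) affine_deriv_at_props(5)[of c m d])
    qed (simp add: D(1))
    show "affine_deriv sg c (current_bracket (affine_bracket br form) f g) =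
      current_bracket (affine_bracket br form) (affine_deriv sg c f) g
      + current_bracket (affine_bracket br form) f (affine_deriv sg c g)"
    proof (induction f rule: pm_induct)
      case (single k x)
      show ?case
        by (induction g rule: pm_induct)
          (simp_all add: D(1,2) B affine_deriv_at_props(6) Poly_Mapping.single_add)
    qed (simp add: D(1) B)
  qed
qed

end

lemma toroidal_phi_generators:
  "toroidal_phi (tau_X X r) = (Poly_Mapping.single (init_deg r) (Poly_Mapping.single (r $ None) X, 0), 0)"
  "toroidal_phi (tau_K m (Some i)) = 0"
  "toroidal_phi (tau_K m None) =
    (if m $ None = 0 then (Poly_Mapping.single (init_deg m) (0, 1), 0) else 0)"
  "toroidal_phi (tau_d j) = (0, axis j 1)"
proof -
  let ?T = "\<lambda>r X. Poly_Mapping.single (init_deg r) (Poly_Mapping.single (r $ None) X, 0 :: complex)"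
  have "lin_ext ?T (Poly_Mapping.single r X) = ?T r X"
    by (rule lin_ext_single) (simp flip: zero_prod_def)
  then show "toroidal_phi (tau_X X r) =
    (Poly_Mapping.single (init_deg r) (Poly_Mapping.single (r $ None) X, 0), 0)"
    by (simp add: toroidal_phi_def tau_X_def K_proj_props map_Pair0)
  show "toroidal_phi (tau_K m (Some i)) = 0"
    "toroidal_phi (tau_K m None) =
      (if m $ None = 0 then (Poly_Mapping.single (init_deg m) (0, 1), 0) else 0)"
    by (simp_all add: toroidal_phi_def tau_K_def lin_ext_def K_proj_props map_Pair0 tK_def axis_def
        prod_eq_iff)
  show "toroidal_phi (tau_d j) = (0, axis j 1)"
    by (simp add: toroidal_phi_def tau_d_def lin_ext_def K_proj_props map_Pair0)
qed

lemma K_aut_props: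
  "K_aut B (y + z) = K_aut B y + K_aut B z"
  "K_aut B (K_scale c z) = K_scale c (K_aut B z)"
  "K_aut B (K_class (Poly_Mapping.single m v)) = K_class
    (Poly_Mapping.single (B *v m) (\<chi> i. \<Sum>j\<in>UNIV. of_int (B $ i $ j) * v $ j))"
proof -
  note z = KF.subspace_0[OF K_relations_subspace]
  show "K_aut B (y + z) = K_aut B y + K_aut B z"
    by transfer (simp add: K_aut_rep_additive z)
  show "K_aut B (K_scale c z) = K_scale c (K_aut B z)"
    by transfer (simp add: K_aut_rep_additive z)
  show "K_aut B (K_class (Poly_Mapping.single m v)) = K_class
    (Poly_Mapping.single (B *v m) (\<chi> i. \<Sum>j\<in>UNIV. of_int (B $ i $ j) * v $ j))"
    by (simp add: K_aut.abs_eq K_aut_rep_additive)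
qed

lemma K_aut_dt: "K_aut B (dt r s) = dt (B *v r) (B *v s)"
proof -
  have "(\<chi> i. \<Sum>j\<in>UNIV. of_int (B $ i $ j) * ((\<chi> i. of_int (r $ i)) :: complex^'a) $ j)
      = (\<chi> i. of_int ((B *v r) $ i))"
    by (simp add: matrix_vector_mult_def)
  then show ?thesis
    by (simp add: dt_eq K_aut_props matrix_vector_right_distrib)
qed

lemma K_aut_compose: "K_aut B (K_aut C z) = K_aut (B ** C) z"
proof (induction z rule: centre_induct)
  case (single m v)
  have "(\<Sum>j\<in>UNIV. of_int (B $ i $ j) * (\<Sum>k\<in>UNIV. of_int (C $ j $ k) * v $ k))
    = (\<Sum>k\<in>UNIV. of_int ((B ** C) $ i $ k) * v $ k)" for i
    unfolding sum_distrib_left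
    by (subst sum.swap) (simp add: matrix_matrix_mult_def sum_distrib_right sum_distrib_left mult.assoc)
  then show ?case by (simp add: K_aut_props matrix_vector_mul_assoc)
qed (simp add: K_aut_props)

lemma K_aut_mat_1: "K_aut (mat 1) z = z"
proof (induction z rule: centre_induct)
  case (single m v)
  have "(\<Sum>j\<in>UNIV. of_int ((mat 1 :: int^'a^'a) $ i $ j) * v $ j) = v $ i" for i
    by (simp add: mat_def if_distrib[of of_int] if_distrib[of "\<lambda>x. x * _"] cong: if_cong)
  then show ?case by (simp add: K_aut_props)
qed (simp add: K_aut_props)

lemma unimodular_inverse:
  fixes B :: "int^'n::finite^'n"
  assumes "det B = 1 \<or> det B = - 1"
  shows "B ** matrix_inv B = mat 1" "matrix_inv B ** B = mat 1"
proof -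
  define R :: "int^'n^'n \<Rightarrow> real^'n^'n" where "R M = (\<chi> i j. of_int (M $ i $ j))" for M
  have det_R: "det (R M) = of_int (det M)" for M
    by (simp add: det_def R_def)
  have R_mult: "R (M ** N) = R M ** R N" for M N
    by (simp add: R_def matrix_matrix_mult_def vec_eq_iff)
  have R_1: "R (mat 1) = mat 1"
    by (simp add: R_def mat_def vec_eq_iff)
  have R_inj: "R M = R N \<Longrightarrow> M = N" for M N
    by (simp add: R_def vec_eq_iff)
  define C :: "int^'n^'n" where
    "C = (\<chi> k j. det (\<chi> i l. if l = k then axis j 1 $ i else B $ i $ l) * det B)"
  have dB: "det (R B) \<noteq> 0" using assms by (auto simp: det_R)
  have col: "R B *v (\<chi> k. of_int (C $ k $ j)) = axis j 1" for j
  proof (subst cramer[OF dB], rule vec_eq_iff[THEN iffD2], rule allI)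
    fix k
    have "(\<chi> i l. if l = k then axis j (1::real) $ i else R B $ i $ l)
      = R (\<chi> i l. if l = k then axis j 1 $ i else B $ i $ l)"
      by (simp add: R_def vec_eq_iff axis_def)
    then have "det (\<chi> i l. if l = k then axis j (1::real) $ i else R B $ i $ l)
      = of_int (det (\<chi> i l. if l = k then axis j 1 $ i else B $ i $ l))"
      by (simp only: det_R)
    then show "(\<chi> k. of_int (C $ k $ j)) $ k =
      (\<chi> k. det (\<chi> i l. if l = k then axis j 1 $ i else R B $ i $ l) / det (R B)) $ k"
      using assms by (auto simp: C_def det_R)
  qed
  have 1: "R B ** R C = mat 1"
  proof (rule vec_eq_iff[THEN iffD2], rule allI, rule vec_eq_iff[THEN iffD2], rule allI)
    fix i j
    have "(R B ** R C) $ i $ j = (R B *v (\<chi> k. of_int (C $ k $ j))) $ i"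
      by (simp add: matrix_matrix_mult_def matrix_vector_mult_def R_def)
    also have "\<dots> = (mat 1 :: real^'n^'n) $ i $ j"
      by (simp add: col axis_def mat_def)
    finally show "(R B ** R C) $ i $ j = (mat 1 :: real^'n^'n) $ i $ j" .
  qed
  then have 2: "R C ** R B = mat 1" by (simp add: matrix_left_right_inverse)
  have "B ** C = mat 1" "C ** B = mat 1"
    by (rule R_inj, simp add: R_mult R_1 1 2)+
  then have "B ** matrix_inv B = mat 1 \<and> matrix_inv B ** B = mat 1"
    unfolding matrix_inv_def by (rule_tac someI[of _ C]) simp
  then show "B ** matrix_inv B = mat 1" "matrix_inv B ** B = mat 1" by simp_all
qed

lemma matrix_inv_matrix_inv:
  fixes B :: "int^'n::finite^'n"
  assumes "det B = 1 \<or> det B = - 1"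
  shows "det (matrix_inv B) = 1 \<or> det (matrix_inv B) = - 1" "matrix_inv (matrix_inv B) = B"
proof -
  note I = unimodular_inverse[OF assms]
  have "det B * det (matrix_inv B) = 1" using I(1) by (metis det_I det_mul)
  then show d: "det (matrix_inv B) = 1 \<or> det (matrix_inv B) = - 1" using assms by auto
  have "matrix_inv (matrix_inv B) = B ** matrix_inv B ** matrix_inv (matrix_inv B)"
    by (simp add: I)
  also have "\<dots> = B"
    by (simp add: matrix_mul_assoc[symmetric] unimodular_inverse[OF d])
  finally show "matrix_inv (matrix_inv B) = B" .
qed

lemma toroidal_aut_eq: "toroidal_aut B ((f, z), c) = ((deg_aut B f, K_aut B z), D_aut B c)"
  by (simp add: toroidal_aut_def)

lemma deg_aut_props:
  "deg_aut B (f + g) = deg_aut B f + deg_aut B g"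
  "deg_aut B (Poly_Mapping.single r X) = Poly_Mapping.single (B *v r) X"
  unfolding deg_aut_def
  by (rule lin_ext_add, simp add: Poly_Mapping.single_add) (simp add: lin_ext_single)

lemma deg_val_D_aut:
  assumes "det B = 1 \<or> det B = - 1"
  shows "deg_val (D_aut B c) (B *v m) = deg_val c m"
proof -
  have "deg_val (D_aut B c) v = deg_val c (matrix_inv B *v v)" for v
    unfolding deg_val_def D_aut_def vec_lambda_beta sum_distrib_right
    by (subst sum.swap) (simp add: matrix_vector_mult_def sum_distrib_left mult.assoc)
  then show ?thesis
    by (simp add: matrix_vector_mul_assoc unimodular_inverse[OF assms])
qed

lemma D_aut_props:
  "D_aut B (c + d) = D_aut B c + D_aut B d" "D_aut B (a *s c) = a *s D_aut B c"
  by (simp_all add: D_aut_def vec_eq_iff sum.distrib sum_distrib_left algebra_simps)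

lemma D_aut_inverse:
  assumes "det B = 1 \<or> det B = - 1"
  shows "D_aut (matrix_inv B) (D_aut B c) = c"
proof -
  have 1: "(\<Sum>i\<in>UNIV. matrix_inv B $ k $ i * B $ i $ j) = (if k = j then 1 else 0)" for k j
    using unimodular_inverse(2)[OF assms] by (simp add: vec_eq_iff matrix_matrix_mult_def mat_def)
  have "D_aut (matrix_inv B) (D_aut B c) $ j = c $ j" for j
  proof -
    have "D_aut (matrix_inv B) (D_aut B c) $ j
      = (\<Sum>k\<in>UNIV. c $ k * of_int (\<Sum>i\<in>UNIV. matrix_inv B $ k $ i * B $ i $ j))"
      unfolding D_aut_def matrix_inv_matrix_inv[OF assms] vec_lambda_beta sum_distrib_right
      by (subst sum.swap) (simp add: sum_distrib_left mult.assoc)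
    also have "\<dots> = c $ j"
      by (simp add: 1 if_distrib[of of_int] if_distrib[of "\<lambda>x. _ * x"] cong: if_cong)
    finally show ?thesis .
  qed
  then show ?thesis by (simp add: vec_eq_iff)
qed

lemma toroidal_aut_inverse:
  assumes "det B = 1 \<or> det B = - 1"
  shows "toroidal_aut (matrix_inv B) (toroidal_aut B x) = x"
proof -
  have "deg_aut (matrix_inv B) (deg_aut B f) = f" for f :: "int^'a \<Rightarrow>\<^sub>0 'b"
    by (induction f rule: pm_induct)
      (simp_all add: deg_aut_props matrix_vector_mul_assoc unimodular_inverse[OF assms])
  then show ?thesis
    by (cases x rule: prod.exhaust[case_product prod.exhaust])
      (auto simp: toroidal_aut_eq K_aut_compose K_aut_mat_1 unimodular_inverse[OF assms]
        D_aut_inverse[OF assms] split: prod.splits)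
qed

lemma bij_toroidal_aut:
  assumes "det B = 1 \<or> det B = - 1"
  shows "bij (toroidal_aut B)"
proof (rule o_bij)
  show "toroidal_aut (matrix_inv B) \<circ> toroidal_aut B = id"
    using toroidal_aut_inverse[OF assms] by (intro ext) (simp only: o_apply id_apply)
  show "toroidal_aut B \<circ> toroidal_aut (matrix_inv B) = id"
    using toroidal_aut_inverse[OF matrix_inv_matrix_inv(1)[OF assms]]
    by (intro ext) (simp only: o_apply id_apply matrix_inv_matrix_inv(2)[OF assms])
qed

lemma toroidal_aut_generators:
  "toroidal_aut B (tau_X X r) = tau_X X (B *v r)"
  "toroidal_aut B ((0, dt r s), 0) = ((0, dt (B *v r) (B *v s)), 0)"
  "toroidal_aut B (tau_d i) = ((0, 0), \<Sum>j\<in>UNIV. of_int (matrix_inv B $ i $ j) *s axis j 1)"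
proof -
  have z: "deg_aut B 0 = (0 :: _ \<Rightarrow>\<^sub>0 'z::ab_group_add)" "K_aut B 0 = 0" "D_aut B 0 = 0"
    by (rule additive_zeroI(1), rule deg_aut_props K_aut_props D_aut_props)+
  show "toroidal_aut B (tau_X X r) = tau_X X (B *v r)"
    "toroidal_aut B ((0, dt r s), 0) = ((0, dt (B *v r) (B *v s)), 0)"
    by (simp_all add: tau_X_def toroidal_aut_eq z deg_aut_props K_aut_dt)
  have "D_aut B (axis i 1) = (\<Sum>j\<in>UNIV. of_int (matrix_inv B $ i $ j) *s axis j 1)"
    using basis_expansion[of "\<chi> j. (of_int (matrix_inv B $ i $ j) :: complex)"]
    by (simp add: D_aut_def axis_def if_distrib[of "\<lambda>x. x * _"] cong: if_cong)
  then show "toroidal_aut B (tau_d i) = ((0, 0), \<Sum>j\<in>UNIV. of_int (matrix_inv B $ i $ j) *s axis j 1)"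
    by (simp add: tau_d_def toroidal_aut_eq z)
qed

context form_lie_algebra
begin

lemma toroidal_bracket_eq:
  "toroidal_bracket sg br form ((f, z), c) ((g, y), d) =
    ((current_bracket br f g + degree_deriv sg c g - degree_deriv sg d f,
      toroidal_cocycle form f g + K_deriv c y - K_deriv d z), 0)"
  by (simp add: toroidal_bracket_def semidirect_bracket_def central_ext_bracket_def
      toroidal_deriv_def)

lemma toroidal_scale_eq:
  "toroidal_scale sg a ((f, z), c) = ((pm_scale sg a f, K_scale a z), a *s c)"
proof -
  have P: "vector_space (pm_scale sg :: complex \<Rightarrow> (int^'n::finite \<Rightarrow>\<^sub>0 'g) \<Rightarrow> _)"
    by (rule vector_space_pm_scale) unfold_locales
  note P2 = vector_space_prod_scale[OF P K.vector_space_axioms]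
  show ?thesis
    unfolding toroidal_scale_def
    by (simp add: vector_space_prod_scale(2)[OF P2(1) vec.vector_space_axioms] P2(2))
qed

lemma multiloop_affine_scale_eq:
  "multiloop_affine_scale sg a (f, c) = (pm_scale (affine_scale sg) a f, a *s c)"
proof -
  interpret A: lie_algebra "affine_scale sg" "affine_bracket br form" by (rule lie_algebra_affine)
  show ?thesis
    unfolding multiloop_affine_scale_def
    by (intro vector_space_prod_scale(2) vector_space_pm_scale A.vector_space_axioms
        vec.vector_space_axioms)
qed

lemma toroidal_bracket_generators:
  "toroidal_bracket sg br form (tau_X X r) (tau_X Y s) =
    tau_X (br X Y) (r + s) + ((0, K_scale (form X Y) (dt r s)), 0)"
  "toroidal_bracket sg br form (tau_d i) (tau_X X r) = toroidal_scale sg (of_int (r $ i)) (tau_X X r)"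
  "toroidal_bracket sg br form (tau_d i) (tau_K m j) = toroidal_scale sg (of_int (m $ i)) (tau_K m j)"
  "toroidal_bracket sg br form (tau_d i) (tau_d j) = 0"
  "toroidal_bracket sg br form (tau_K m i) (tau_X X r) = 0"
  "toroidal_bracket sg br form (tau_K m i) (tau_K r j) = 0"
proof -
  have L: "lie_algebra sg br" by unfold_locales
  note B = current_bracket_props[OF L]
  note A = degree_deriv_additive[OF vector_space_axioms]
  have dv: "deg_val (axis i 1) m = of_int (m $ i)" for i and m :: "int^'n::finite"
    by (simp add: deg_val_def axis_def if_distrib[of "\<lambda>x. x * _"] cong: if_cong)
  have z: "current_bracket br 0 f = 0" "current_bracket br f 0 = 0" "toroidal_cocycle form 0 f = 0"
    "toroidal_cocycle form f 0 = 0"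
    "degree_deriv sg c 0 = 0" "K_deriv c 0 = 0" "K_deriv 0 y = 0" "degree_deriv sg 0 f = 0"
    for f :: "int^'n::finite \<Rightarrow>\<^sub>0 'g" and c and y
    using B(1)[of 0 0 f] B(2)[of f 0 0] toroidal_cocycle_props(1)[of 0 0 f]
      toroidal_cocycle_props(2)[of f 0 0] A(1)[of c 0 0] K_deriv_props(1)[of c 0 0]
      K_deriv_props(2)[of 0 0 y] degree_deriv_props(1)[OF L, of 0 0 f] by simp_all
  have s: "pm_scale sg a (0 :: int^'n::finite \<Rightarrow>\<^sub>0 'g) = 0" for a
    by (rule poly_mapping_eqI) (simp add: pm_lookup_scale)
  show "toroidal_bracket sg br form (tau_X X r) (tau_X Y s) =
    tau_X (br X Y) (r + s) + ((0, K_scale (form X Y) (dt r s)), 0)"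
    by (simp add: tau_X_def toroidal_bracket_eq z B toroidal_cocycle_props)
  show "toroidal_bracket sg br form (tau_d i) (tau_X X r) = toroidal_scale sg (of_int (r $ i)) (tau_X X r)"
    by (simp add: tau_X_def tau_d_def toroidal_bracket_eq toroidal_scale_eq z A dv pm_scale_single)
  show "toroidal_bracket sg br form (tau_d i) (tau_K m j) = toroidal_scale sg (of_int (m $ i)) (tau_K m j)"
    by (simp add: tau_K_def tau_d_def toroidal_bracket_eq toroidal_scale_eq z s K_deriv_props dv tK_def)
  show "toroidal_bracket sg br form (tau_d i) (tau_d j) = 0"
    "toroidal_bracket sg br form (tau_K m i) (tau_X X r) = 0"
    "toroidal_bracket sg br form (tau_K m i) (tau_K r j) = 0"
    by (simp_all add: tau_X_def tau_K_def tau_d_def toroidal_bracket_eq z zero_prod_def)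
qed

lemma toroidal_aut_hom:
  fixes x y :: "('g, 'n::finite) toroidal"
  assumes "det B = 1 \<or> det B = - 1"
  shows "toroidal_aut B (x + y) = toroidal_aut B x + toroidal_aut B y"
    and "toroidal_aut B (toroidal_scale sg a x) = toroidal_scale sg a (toroidal_aut B x)"
    and "toroidal_aut B (toroidal_bracket sg br form x y) =
      toroidal_bracket sg br form (toroidal_aut B x) (toroidal_aut B y)"
proof -
  have L: "lie_algebra sg br" by unfold_locales
  interpret P: vector_space "pm_scale sg :: complex \<Rightarrow> (int^'n \<Rightarrow>\<^sub>0 'g) \<Rightarrow> _"
    by (rule vector_space_pm_scale) unfold_locales
  note B = current_bracket_props[OF L]
  note A = degree_deriv_additive[OF vector_space_axioms]
  obtain f z c g w d where xy: "x = ((f, z), c)" "y = ((g, w), d)"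
    by (metis prod.exhaust)
  have 1: "deg_aut B (current_bracket br f g) = current_bracket br (deg_aut B f) (deg_aut B g)"
  proof (induction f rule: pm_induct)
    case (single k x)
    show ?case
      by (induction g rule: pm_induct)
        (simp_all add: B deg_aut_props matrix_vector_right_distrib)
  qed (simp add: B deg_aut_props)
  have 2: "K_aut B (toroidal_cocycle form f g) = toroidal_cocycle form (deg_aut B f) (deg_aut B g)"
  proof (induction f rule: pm_induct)
    case (single k x)
    show ?case
      by (induction g rule: pm_induct)
        (simp_all add: toroidal_cocycle_props deg_aut_props K_aut_props K_aut_dt)
  qed (simp add: toroidal_cocycle_props deg_aut_props K_aut_props)
  have 3: "deg_aut B (degree_deriv sg c f) = degree_deriv sg (D_aut B c) (deg_aut B f)" for c f
    by (induction f rule: pm_induct) (simp_all add: A deg_aut_props deg_val_D_aut[OF assms])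
  have 4: "K_aut B (K_deriv c z) = K_deriv (D_aut B c) (K_aut B z)" for c z
    by (induction z rule: centre_induct)
      (simp_all add: K_deriv_props K_aut_props deg_val_D_aut[OF assms])
  have 5: "deg_aut B (pm_scale sg a f) = pm_scale sg a (deg_aut B f)"
    by (induction f rule: pm_induct)
      (simp_all add: deg_aut_props pm_scale_single P.scale_right_distrib)
  have 6: "deg_aut B (f - g) = deg_aut B f - deg_aut B g" for f g :: "int^'n \<Rightarrow>\<^sub>0 'g"
    by (rule additive_zeroI(3)) (rule deg_aut_props)
  have 7: "K_aut B (f - g) = K_aut B f - K_aut B g" for f g
    by (rule additive_zeroI(3)) (rule K_aut_props)
  have 8: "D_aut B 0 = 0"
    by (rule additive_zeroI(1)) (rule D_aut_props)
  show "toroidal_aut B (x + y) = toroidal_aut B x + toroidal_aut B y"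
    by (simp add: xy toroidal_aut_eq deg_aut_props K_aut_props D_aut_props)
  show "toroidal_aut B (toroidal_scale sg a x) = toroidal_scale sg a (toroidal_aut B x)"
    by (simp add: xy toroidal_aut_eq toroidal_scale_eq 5 K_aut_props D_aut_props)
  show "toroidal_aut B (toroidal_bracket sg br form x y) =
      toroidal_bracket sg br form (toroidal_aut B x) (toroidal_aut B y)"
    by (simp add: xy toroidal_aut_eq toroidal_bracket_eq deg_aut_props(1) K_aut_props(1) 1 2 3 4 6 7 8)
qed

lemma toroidal_phi_hom:
  fixes x y :: "('g, 'm::finite option) toroidal"
  shows "toroidal_phi (x + y) = toroidal_phi x + toroidal_phi y"
    and "toroidal_phi (toroidal_scale sg a x) = multiloop_affine_scale sg a (toroidal_phi x)"
    and "toroidal_phi (toroidal_bracket sg br form x y) =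
      multiloop_affine_bracket sg br form (toroidal_phi x) (toroidal_phi y)"
proof -
  have L: "lie_algebra sg br" by unfold_locales
  interpret P: vector_space "pm_scale sg :: complex \<Rightarrow> (int \<Rightarrow>\<^sub>0 'g) \<Rightarrow> _"
    by (rule vector_space_pm_scale) unfold_locales
  interpret C: vector_space "pm_scale (*) :: complex \<Rightarrow> (int^'m \<Rightarrow>\<^sub>0 complex) \<Rightarrow> _"
    by (rule vector_space_pm_scale) (rule vector_space_over_itself.vector_space_axioms)
  interpret A: lie_algebra "affine_scale sg" "affine_bracket br form" by (rule lie_algebra_affine)
  interpret T: lie_algebra "pm_scale (affine_scale sg)"
    "current_bracket (affine_bracket br form) :: (int^'m \<Rightarrow>\<^sub>0 'g affine) \<Rightarrow> _"
    by (rule lie_algebra_current) (rule lie_algebra_affine)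
  note B = current_bracket_props[OF L]
  note B' = current_bracket_props[OF lie_algebra_affine]
  note A = degree_deriv_additive[OF vector_space_axioms]
  define F :: "(int^('m option) \<Rightarrow>\<^sub>0 'g) \<Rightarrow> (int^'m \<Rightarrow>\<^sub>0 'g affine)" where
    "F = lin_ext (\<lambda>r X. Poly_Mapping.single (init_deg r) (Poly_Mapping.single (r $ None) X, 0))"
  define E :: "(int^'m \<Rightarrow>\<^sub>0 complex) \<Rightarrow> (int^'m \<Rightarrow>\<^sub>0 'g affine)" where
    "E = Poly_Mapping.map (\<lambda>k. (0, k))"
  have phi: "toroidal_phi ((f, z), c) = (F f + E (K_proj z), c)" for f z and c :: "complex^('m option)"
    by (simp add: toroidal_phi_def F_def E_def)
  have aff: "affine_scale sg c (f, k) = (pm_scale sg c f, c * k)" for c f k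
    using vector_space_prod_scale(2)[OF P.vector_space_axioms
        vector_space_over_itself.vector_space_axioms]
    by (simp add: affine_scale_def)
  have F: "F (f + g) = F f + F g" for f g
    unfolding F_def by (rule lin_ext_add) (simp add: Poly_Mapping.single_add[symmetric])
  have F1: "F (Poly_Mapping.single r X) =
    Poly_Mapping.single (init_deg r) (Poly_Mapping.single (r $ None) X, 0)" for r X
    unfolding F_def by (rule lin_ext_single) (simp add: zero_prod_def[symmetric])
  have Fm: "F (f - g) = F f - F g" for f g
    by (rule additive_zeroI(3)) (rule F)
  have E: "E (f + g) = E f + E g" "E 0 = 0" "E (Poly_Mapping.single m k) = Poly_Mapping.single m (0, k)"
    for f g m k
    unfolding E_def by (rule map_Pair0)+
  have Km: "E (K_proj (f - g)) = E (K_proj f) - E (K_proj g)" for f g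
    by (rule additive_zeroI(3)) (simp add: K_proj_props E)
  have Fs: "F (pm_scale sg a f) = pm_scale (affine_scale sg) a (F f)" for a f
  proof (induction f rule: pm_induct)
    case (single k x)
    show ?case by (simp add: F1 pm_scale_single aff)
  next
    case (add f g)
    interpret Q: vector_space "pm_scale sg :: complex \<Rightarrow> (int^('m option) \<Rightarrow>\<^sub>0 'g) \<Rightarrow> _"
      by (rule vector_space_pm_scale) unfold_locales
    show ?case by (simp add: add F Q.scale_right_distrib T.scale_right_distrib)
  qed
  have Es: "E (pm_scale (*) a f) = pm_scale (affine_scale sg) a (E f)" for a f
    by (induction f rule: pm_induct)
      (simp_all add: E pm_scale_single aff C.scale_right_distrib T.scale_right_distrib)
  have z0: "current_bracket br 0 f = 0" "current_bracket br f 0 = 0" "affine_cocycle form 0 f = 0"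
    "affine_cocycle form f 0 = 0" for f :: "int \<Rightarrow>\<^sub>0 'g"
    using B(1)[of 0 0 f] B(2)[of f 0 0] affine_cocycle_props(1)[of 0 0 f]
      affine_cocycle_props(2)[of f 0 0] by simp_all
  have aB: "affine_bracket br form (f, k) (g, l) = (current_bracket br f g, affine_cocycle form f g)"
    for f g k l
    by (simp add: affine_bracket_def central_ext_bracket_def)
  have ab0: "affine_bracket br form (0, k) p = 0" "affine_bracket br form p (0, k) = 0" for k p
    by (simp_all add: affine_bracket_def central_ext_bracket_def split_beta z0 zero_prod_def)
  have E0: "current_bracket (affine_bracket br form) (E f) g = 0"
    "current_bracket (affine_bracket br form) g (E f) = 0" for f g
  proof -
    show "current_bracket (affine_bracket br form) (E f) g = 0"
    proof (induction f rule: pm_induct)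
      case (single k x)
      show ?case by (induction g rule: pm_induct) (simp_all add: E B' ab0)
    qed (simp add: E B')
    show "current_bracket (affine_bracket br form) g (E f) = 0"
    proof (induction f rule: pm_induct)
      case (single k x)
      show ?case by (induction g rule: pm_induct) (simp_all add: E B' ab0)
    qed (simp add: E B')
  qed
  have FB: "current_bracket (affine_bracket br form) (F f) (F g)
    = F (current_bracket br f g) + E (K_proj (toroidal_cocycle form f g))" for f g
  proof (induction f rule: pm_induct)
    case (single k x)
    show ?case
    proof (induction g rule: pm_induct)
      case (single l y)
      show ?case
        by (auto simp: F1 B B' toroidal_cocycle_props K_proj_dt E join_deg_props(3) aB
            affine_cocycle_props Poly_Mapping.single_add[symmetric] mult.commute)
    qed (simp add: F B B' toroidal_cocycle_props K_proj_props E)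
  qed (simp add: F B B' toroidal_cocycle_props K_proj_props E)
  have FD: "affine_deriv sg c (F f) = F (degree_deriv sg c f)" for c f
    by (induction f rule: pm_induct)
      (simp_all add: F F1 A affine_deriv_props affine_deriv_at_props(7) join_deg_props(2))
  have ED: "affine_deriv sg c (E (K_proj z)) = E (K_proj (K_deriv c z))" for c z
  proof (induction z rule: centre_induct)
    case (single m v)
    have "affine_deriv_at sg c n (0, k) = (0, deg_val c (join_deg 0 n) * k)" for n k
      using affine_deriv_at_props(7)[of c n 0 0 k] by simp
    moreover have "affine_deriv sg c 0 = 0"
      by (rule additive_zeroI(1)) (rule affine_deriv_props)
    ultimately show ?case
      by (simp add: K_proj_props K_deriv_props E affine_deriv_props pm_scale_single join_deg_props(4)
          C.scale_zero_right)
  qed (simp add: K_proj_props K_deriv_props E affine_deriv_props)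
  obtain f z c g w d where xy: "x = ((f, z), c)" "y = ((g, w), d)"
    by (metis prod.exhaust)
  show "toroidal_phi (x + y) = toroidal_phi x + toroidal_phi y"
    by (simp add: xy phi F E K_proj_props)
  show "toroidal_phi (toroidal_scale sg a x) = multiloop_affine_scale sg a (toroidal_phi x)"
    by (simp add: xy phi toroidal_scale_eq multiloop_affine_scale_eq Fs Es K_proj_props
        T.scale_right_distrib)
  show "toroidal_phi (toroidal_bracket sg br form x y) =
      multiloop_affine_bracket sg br form (toroidal_phi x) (toroidal_phi y)"
    by (simp add: xy phi toroidal_bracket_eq multiloop_affine_bracket_def semidirect_bracket_def
        B' E0 FB F Fm Km E K_proj_props(1) affine_deriv_props(1) FD ED)
qed

end

lemma lie_module_twist:
  fixes sg :: "complex \<Rightarrow> 'g::ab_group_add \<Rightarrow> 'g"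
    and act :: "('g, 'n::finite) toroidal \<Rightarrow> 'v::ab_group_add \<Rightarrow> 'v"
  assumes "det B = 1 \<or> det B = - 1"
    and "lie_algebra sg br" "lie_algebra.invariant_form sg br form"
    and "lie_module (toroidal_scale sg) (toroidal_bracket sg br form) sv act"
  shows "lie_module (toroidal_scale sg) (toroidal_bracket sg br form) sv (twist B act)"
proof -
  note H = form_lie_algebra.toroidal_aut_hom[OF form_lie_algebra.intro[OF assms(2)
      form_lie_algebra_axioms.intro[OF assms(3)]] assms(1)]
  interpret lie_module "toroidal_scale sg" "toroidal_bracket sg br form" sv act by fact
  show ?thesis
    by unfold_locales
      (simp_all add: twist_def H act_add_left act_scale_left
        act_add_right act_scale_right act_bracket)
qed

end

theory Submission
  imports Defs "HOL-Computational_Algebra.Fundamental_Theorem_Algebra"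
    "HOL-Analysis.Continuum_Not_Denumerable"
begin

text \<open>
  By irreducibility an operator \<open>t\<^sup>m K(c) = \<Sum>\<^sub>i c\<^sub>i t\<^sup>m K\<^sub>i\<close> is zero or bijective, and by Schur's lemma
  those of a fixed degree \<open>m\<close> are proportional: \<open>t\<^sup>m K(c) = \<phi>\<^sub>m(c) z\<^sub>m\<close>.  Let \<open>x\<close> be an element
  of the Cartan subalgebra with \<open>(x, x) \<noteq> 0\<close>; it exists because \<open>\<g>\<close> acts faithfully on the weight
  module \<open>V\<close>, which forces the Cartan subalgebra to be abelian and to act semisimply on \<open>\<g>\<close>.
  If \<open>\<gamma>\<close> is the degree of a bijective operator \<open>T\<close> commuting with \<open>\<g> \<otimes> A \<oplus> Z\<close>, then
  \<open>x(\<gamma>) T\<^sup>-\<^sup>1\<close> and \<open>x(m - \<gamma>) T z\<^sub>m\<^sup>-\<^sup>1\<close> preserve a finite-dimensional weight space and have scalar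
  commutator \<open>(x, x) \<phi>\<^sub>m(\<gamma>)\<close>, so \<open>\<phi>\<^sub>m(\<gamma>) = 0\<close>.  Suppose a combination
  \<open>\<psi> = c\<^sub>1 \<phi>\<^sub>m + c\<^sub>2 \<phi>\<^sub>k\<close> is injective on a subgroup \<open>R \<cong> \<int>\<^sup>2\<close> of \<open>\<int>\<^sup>n\<close>.  The operators
  \<open>c\<^sub>1 x(m + r) z\<^sub>m\<^sup>-\<^sup>1 + c\<^sub>2 x(k + r) z\<^sub>k\<^sup>-\<^sup>1\<close> and \<open>x(-r)\<close>, \<open>r\<close> in a positive half of \<open>R\<close>, then satisfy
  Heisenberg relations graded by \<open>R\<close>.  On a joint eigenvector of the number operators one
  of the two operators of degrees \<open>\<plusminus>r\<close> is not locally nilpotent; since the weight spaces are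
  finite-dimensional, these degrees form the positive cone of a total order on \<open>R\<close> in which every
  positive element is a sum of two positive ones in only finitely many ways, which makes \<open>R\<close>
  cyclic.  Hence every such \<open>\<psi>\<close> has values in a line \<open>\<rat> \<cdot> c\<close>, which forces all \<open>\<phi>\<^sub>m\<close> to be
  proportional to a single integral functional; \<open>B\<close> is a unimodular matrix whose columns
  other than the last lie in its kernel.
\<close>

section \<open>Operators on complex vector spaces\<close>

locale complex_space = vector_space scale
  for scale :: "complex \<Rightarrow> 'b::ab_group_add \<Rightarrow> 'b" (infixr \<open>*c\<close> 75)
begin

section \<open>Joint eigenvectors and dimension bounds\<close>

lemma joint_eigenvectors_independent:
  assumes "finite I"
    and "\<And>j x y. j \<in> J \<Longrightarrow> F j (x + y) = F j x + F j y"
    and "\<And>j c x. j \<in> J \<Longrightarrow> F j (c *c x) = c *c F j x"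
    and "\<And>i. i \<in> I \<Longrightarrow> w i \<noteq> 0"
    and "\<And>i j. i \<in> I \<Longrightarrow> j \<in> J \<Longrightarrow> F j (w i) = e i j *c w i"
    and "\<And>i i'. i \<in> I \<Longrightarrow> i' \<in> I \<Longrightarrow> i \<noteq> i' \<Longrightarrow> \<exists>j\<in>J. e i j \<noteq> e i' j"
    and "(\<Sum>i\<in>I. c i *c w i) = 0"
  shows "\<forall>i\<in>I. c i = 0"
  using assms(1,4-)
proof (induction I arbitrary: c rule: finite_induct)
  case (insert a I)
  have c: "c i = 0" if "i \<in> I" for i
  proof -
    obtain j where j: "j \<in> J" "e i j \<noteq> e a j"
      using insert.prems(3)[of i a] \<open>i \<in> I\<close> insert.hyps by (metis insertCI)
    have F0: "F j 0 = 0" using assms(3)[OF j(1), of 0 0] by simp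
    have Fsum: "F j (\<Sum>i\<in>I. g i) = (\<Sum>i\<in>I. F j (g i))" for g
      using \<open>finite I\<close> by (induction I) (simp_all add: F0 assms(2)[OF j(1)])
    have eq: "(\<Sum>i\<in>I. c i *c w i) = - (c a *c w a)"
      using insert.prems(4) insert.hyps by (simp add: add_eq_0_iff2)
    \<comment> \<open>\<open>F j - e a j\<close> kills the vector with index \<open>a\<close>, which
      leaves a relation over \<open>I\<close> for the induction hypothesis.\<close>
    have "(\<Sum>i\<in>I. (c i * (e i j - e a j)) *c w i)
        = F j (\<Sum>i\<in>I. c i *c w i) - e a j *c (\<Sum>i\<in>I. c i *c w i)"
      unfolding Fsum scale_sum_right sum_subtractf[symmetric]
      by (rule sum.cong) (simp_all add: assms(3) j insert.prems(2) algebra_simps)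
    also have "\<dots> = 0"
      unfolding eq using assms(3)[OF j(1), of "- c a" "w a"]
      by (simp add: insert.prems(2) j mult.commute)
    finally have "\<forall>i\<in>I. c i * (e i j - e a j) = 0"
      by (intro insert.IH) (use insert.prems(1-3) in auto)
    then show ?thesis using that j by auto
  qed
  then have "(\<Sum>i\<in>I. c i *c w i) = 0" by (intro sum.neutral) auto
  then have "c a *c w a = 0" using insert.prems(4) insert.hyps by simp
  then show ?case using c insert.prems(1)[of a] by auto
qed simp

text \<open>Infinitely many systems of eigenvalues would give more independent vectors than a finite
  spanning set has elements. The ladder and monomial arguments below rest on this count.\<close>

lemma finite_joint_eigenvectors:
  assumes W: "finite_dim W"
    and "\<And>j x y. j \<in> J \<Longrightarrow> F j (x + y) = F j x + F j y"
    and "\<And>j c x. j \<in> J \<Longrightarrow> F j (c *c x) = c *c F j x"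
    and "\<And>i. i \<in> I \<Longrightarrow> w i \<in> W \<and> w i \<noteq> 0"
    and "\<And>i j. i \<in> I \<Longrightarrow> j \<in> J \<Longrightarrow> F j (w i) = e i j *c w i"
    and "\<And>i i'. i \<in> I \<Longrightarrow> i' \<in> I \<Longrightarrow> i \<noteq> i' \<Longrightarrow> \<exists>j\<in>J. e i j \<noteq> e i' j"
  shows "finite I"
proof (rule ccontr)
  assume "infinite I"
  obtain B where B: "finite B" "W \<subseteq> span B" using W unfolding finite_dim_def by blast
  obtain K where K: "K \<subseteq> I" "finite K" "card K = Suc (card B)"
    using infinite_arbitrarily_large[OF \<open>infinite I\<close>] by metis
  have inj: "inj_on w K"
  proof (rule inj_onI, rule ccontr)
    fix i i' assume i: "i \<in> K" "i' \<in> K" "w i = w i'" "i \<noteq> i'"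
    then obtain j where j: "j \<in> J" "e i j \<noteq> e i' j" using assms(6) K by blast
    have "e i j *c w i = e i' j *c w i"
      using assms(5)[of i j] assms(5)[of i' j] i j K by (metis subsetD)
    then show False using j i(1) K assms(4)[of i] by (metis scale_right_imp_eq subsetD)
  qed
  have "independent (w ` K)"
  proof (rule independent_if_scalars_zero)
    fix f x assume f: "(\<Sum>x\<in>w ` K. f x *c x) = 0" "x \<in> w ` K"
    have "(\<Sum>i\<in>K. f (w i) *c w i) = 0" using f(1) by (simp add: sum.reindex[OF inj])
    then have "\<forall>i\<in>K. f (w i) = 0"
    proof (rule joint_eigenvectors_independent[where J = J and F = F and e = e and w = w and c = "\<lambda>i. f (w i)", rotated -1])
      show "w i \<noteq> 0" if "i \<in> K" for i using that K(1) assms(4) by auto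
      show "F j (w i) = e i j *c w i" if "i \<in> K" "j \<in> J" for i j using that K(1) assms(5) by auto
      show "\<exists>j\<in>J. e i j \<noteq> e i' j" if "i \<in> K" "i' \<in> K" "i \<noteq> i'" for i i'
        using that K(1) assms(6) by (meson subsetD)
    qed (use K assms(2,3) in simp_all)
    then show "f x = 0" using f(2) by auto
  qed (use K in simp)
  moreover have "w ` K \<subseteq> span B" using assms(4) B K by blast
  ultimately have "card (w ` K) \<le> card B" using independent_span_bound B by blast
  then show False using K card_image[OF inj] by simp
qed

lemma finite_dim_subset: "finite_dim W \<Longrightarrow> U \<subseteq> W \<Longrightarrow> finite_dim U"
  unfolding finite_dim_def by blast

lemma dim_psubset:
  assumes "finite_dim U" "subspace U'" "U' \<subset> U"
  shows "dim U' < dim U"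
proof -
  obtain B' where B': "B' \<subseteq> U'" "independent B'" "U' \<subseteq> span B'" "card B' = dim U'"
    by (rule basis_exists)
  obtain B where B: "B' \<subseteq> B" "B \<subseteq> U" "independent B" "U \<subseteq> span B"
    using maximal_independent_subset_extend[of B' U] B' assms(3) by (metis order.trans psubset_imp_subset)
  obtain C where C: "finite C" "U \<subseteq> span C" using assms(1) unfolding finite_dim_def by blast
  have "finite B" using independent_span_bound[of C B] B C by blast
  moreover have "B' \<noteq> B"
  proof
    assume "B' = B"
    then have "U \<subseteq> U'" using B B' span_minimal[OF _ assms(2)] by blast
    then show False using assms(3) by blast
  qed
  ultimately have "card B' < card B" using B(1) by (metis psubset_card_mono psubsetI)
  then show ?thesis using basis_card_eq_dim[OF B(2,4,3)] B'(4) by simp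
qed

section \<open>Eigenvectors in finite-dimensional subspaces\<close>

definition linop :: "('b \<Rightarrow> 'b) \<Rightarrow> bool"
  where "linop F \<longleftrightarrow> (\<forall>x y. F (x + y) = F x + F y) \<and> (\<forall>c x. F (c *c x) = c *c F x)"

lemma linopI: "(\<And>x y. F (x + y) = F x + F y) \<Longrightarrow> (\<And>c x. F (c *c x) = c *c F x) \<Longrightarrow> linop F"
  by (simp add: linop_def)

lemma linopD:
  assumes "linop F"
  shows "F (x + y) = F x + F y" "F (c *c x) = c *c F x" "F 0 = 0" "F (x - y) = F x - F y"
    "F (- x) = - F x"
proof -
  have add: "F (x + y) = F x + F y" for x y using assms by (simp add: linop_def)
  show "F (x + y) = F x + F y" "F (c *c x) = c *c F x" using assms by (simp_all add: linop_def)
  show "F 0 = 0" "F (x - y) = F x - F y" "F (- x) = - F x"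
    by (rule additive_zeroI, rule add)+
qed

lemma linop_sum: "linop F \<Longrightarrow> F (\<Sum>i\<in>I. g i) = (\<Sum>i\<in>I. F (g i))"
  by (induction I rule: infinite_finite_induct) (simp_all add: linopD)

lemma linop_compose: "linop F \<Longrightarrow> linop G \<Longrightarrow> linop (\<lambda>x. F (G x))"
  by (simp add: linop_def)

text \<open>The fundamental theorem of algebra, applied to \<open>p(F)\<close>: each root
  \<open>c\<close> of \<open>p\<close> splits off a factor \<open>F - c\<close>.\<close>

lemma poly_op_split:
  fixes p :: "complex poly"
  assumes F: "linop F" and "p \<noteq> 0" "degree p < N"
  shows "\<exists>a cs. a \<noteq> 0 \<and> (\<forall>x. (\<Sum>k<N. coeff p k *c (F ^^ k) x) = a *c fold (\<lambda>c y. F y - c *c y) cs x)"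
  using assms(2,3)
proof (induction "degree p" arbitrary: p N)
  case 0
  then obtain a where p: "p = [:a:]" by (metis degree_eq_zeroE)
  have "(\<Sum>k<N. coeff p k *c (F ^^ k) x) = a *c x" for x
  proof -
    have "(\<Sum>k<N. coeff p k *c (F ^^ k) x) = (\<Sum>k\<in>{0}. coeff p k *c (F ^^ k) x)"
      using 0 by (intro sum.mono_neutral_right) (auto simp: p coeff_pCons split: nat.splits)
    then show ?thesis by (simp add: p)
  qed
  then have "\<forall>x. (\<Sum>k<N. coeff p k *c (F ^^ k) x) = a *c fold (\<lambda>c y. F y - c *c y) [] x" by simp
  moreover have "a \<noteq> 0" using 0 p by simp
  ultimately show ?case by blast
next
  case (Suc d)
  have "\<not> constant (poly p)" using Suc.hyps(2) by (simp add: constant_degree)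
  then obtain c where "poly p c = 0" using fundamental_theorem_of_algebra by blast
  then obtain q where p: "p = [:- c, 1:] * q" by (metis dvdE poly_eq_0_iff_dvd)
  have q: "q \<noteq> 0" using Suc.prems p by auto
  have "degree p = degree [:- c, 1:] + degree q"
    unfolding p by (rule degree_mult_eq) (use q in auto)
  then have dq: "d = degree q" using Suc.hyps(2) by simp
  obtain M where M: "N = Suc M" using Suc.prems by (cases N) auto
  have dM: "degree q < M" using Suc.hyps(2) Suc.prems dq M by simp
  obtain a cs where a: "a \<noteq> 0"
    and IH: "(\<Sum>k<M. coeff q k *c (F ^^ k) x) = a *c fold (\<lambda>c y. F y - c *c y) cs x" for x
    using Suc.hyps(1)[OF dq q dM] by blast
  have "(\<Sum>k<N. coeff p k *c (F ^^ k) x) = a *c fold (\<lambda>c y. F y - c *c y) (cs @ [c]) x" for x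
  proof -
    let ?S = "\<Sum>k<M. coeff q k *c (F ^^ k) x"
    have pe: "p = smult (- c) q + pCons 0 q" unfolding p by simp
    have "(\<Sum>k<N. coeff p k *c (F ^^ k) x)
        = (\<Sum>k<N. (- c * coeff q k) *c (F ^^ k) x) + (\<Sum>k<N. coeff (pCons 0 q) k *c (F ^^ k) x)"
      unfolding pe by (simp add: scale_left_distrib sum.distrib sum_subtractf sum_negf algebra_simps)
    also have "(\<Sum>k<N. (- c * coeff q k) *c (F ^^ k) x) = (- c) *c ?S"
      using dM by (simp add: M scale_sum_right coeff_eq_0 sum_negf)
    also have "(\<Sum>k<N. coeff (pCons 0 q) k *c (F ^^ k) x) = F ?S"
      unfolding M sum.lessThan_Suc_shift by (simp add: linop_sum[OF F] linopD(2)[OF F])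
    finally show ?thesis unfolding IH by (simp add: linopD[OF F] algebra_simps)
  qed
  then show ?case using a by blast
qed

text \<open>The iterates of \<open>v\<close> stay in a finite-dimensional space, so a nonzero
  polynomial in \<open>F\<close> kills \<open>v\<close>; it is then split into linear
  factors.\<close>

lemma annihilating_product:
  assumes F: "linop F" and U: "finite_dim U" "\<And>x. x \<in> U \<Longrightarrow> F x \<in> U" and v: "v \<in> U"
  shows "\<exists>cs. fold (\<lambda>c y. F y - c *c y) cs v = 0"
proof -
  have FU: "(F ^^ k) v \<in> U" for k using U(2) v by (induction k) auto
  obtain B where B: "finite B" "U \<subseteq> span B" using U(1) unfolding finite_dim_def by blast
  obtain N f where f: "(\<Sum>k<N. f k *c (F ^^ k) v) = 0" "\<exists>k<N. f k \<noteq> 0"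
  proof (cases "inj (\<lambda>k. (F ^^ k) v)")
    case True
    let ?N = "Suc (card B)"
    let ?S = "(\<lambda>k. (F ^^ k) v) ` {..<?N}"
    have "card ?S = ?N" using True by (simp add: card_image inj_on_subset)
    then have "\<not> independent ?S"
      using independent_span_bound[OF B(1), of ?S] FU B by (auto simp: image_subset_iff)
    then obtain g where "(\<Sum>x\<in>?S. g x *c x) = 0" "\<exists>x\<in>?S. g x \<noteq> 0"
      using independent_if_scalars_zero[of ?S] by blast
    moreover have "inj_on (\<lambda>k. (F ^^ k) v) {..<?N}" using True by (rule inj_on_subset) simp
    ultimately have "(\<Sum>k<?N. g ((F ^^ k) v) *c (F ^^ k) v) = 0" "\<exists>k<?N. g ((F ^^ k) v) \<noteq> 0"
      by (simp_all only: sum.reindex o_def) auto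
    then show ?thesis by (rule that)
  next
    case False
    then obtain i j where ij: "i < j" "(F ^^ i) v = (F ^^ j) v"
      unfolding inj_def by (metis linorder_neqE_nat)
    \<comment> \<open>A repetition among the iterates is itself a relation,
      \<open>F^j v - F^i v = 0\<close>.\<close>
    have "(\<Sum>k<Suc j. ((if k = j then 1 else 0) - (if k = i then 1 else 0)) *c (F ^^ k) v)
        = (\<Sum>k<Suc j. (if k = j then (F ^^ k) v else 0) - (if k = i then (F ^^ k) v else 0))"
      by (rule sum.cong) (auto simp: scale_left_diff_distrib)
    also have "\<dots> = 0" using ij by (simp add: sum_subtractf)
    finally show ?thesis by (rule that) (use ij(1) in \<open>auto intro!: exI[of _ j]\<close>)
  qed
  define p where "p = Poly (map f [0..<N])"
  have cp: "coeff p k = (if k < N then f k else 0)" for k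
    by (auto simp: p_def nth_default_def)
  have "p \<noteq> 0" using f(2) cp by (metis coeff_0)
  moreover have "degree p < N"
    using f(2) by (intro degree_lessI) (auto simp: cp)
  ultimately obtain a cs where "a \<noteq> 0"
    "(\<Sum>k<N. coeff p k *c (F ^^ k) v) = a *c fold (\<lambda>c y. F y - c *c y) cs v"
    using poly_op_split[OF F] by blast
  moreover have "(\<Sum>k<N. coeff p k *c (F ^^ k) v) = 0" using f(1) by (simp add: cp)
  ultimately show ?thesis by auto
qed

text \<open>The factors of the annihilating product are applied one by one; the last nonzero vector
  is an eigenvector for the next factor.\<close>

lemma eigenvector_exists:
  assumes F: "linop F" and U: "finite_dim U" "subspace U" "\<And>x. x \<in> U \<Longrightarrow> F x \<in> U"
    and v: "v \<in> U" "v \<noteq> 0"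
  obtains c w where "w \<in> U" "w \<noteq> 0" "F w = c *c w"
proof -
  obtain cs where "fold (\<lambda>c y. F y - c *c y) cs v = 0"
    using annihilating_product[OF F U(1,3) v(1)] by blast
  then have "\<exists>c w. w \<in> U \<and> w \<noteq> 0 \<and> F w = c *c w"
    using v
  proof (induction cs arbitrary: v)
    case (Cons c cs)
    show ?case
    proof (cases "F v = c *c v")
      case False
      then have "F v - c *c v \<in> U" "F v - c *c v \<noteq> 0"
        using Cons.prems U by (auto intro: subspace_diff subspace_scale)
      then show ?thesis using Cons by simp
    qed (use Cons in blast)
  qed simp
  then show ?thesis using that by blast
qed

text \<open>Hypothesis \<open>ss\<close> says that \<open>(F - c)^2 x = 0\<close> implies
  \<open>(F - c) x = 0\<close>. Induction on the annihilating factors: once \<open>(F - c) u\<close>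
  lies in the span of the eigenvectors, subtracting a suitable \<open>u'\<close> of that span from
  \<open>u\<close> yields a vector killed by \<open>(F - c)^2\<close>.\<close>

lemma diagonalizable_span:
  assumes F: "linop F" and U: "finite_dim U" "subspace U" "\<And>x. x \<in> U \<Longrightarrow> F x \<in> U"
    and ss: "\<And>c x. x \<in> U \<Longrightarrow> F (F x - c *c x) = c *c (F x - c *c x) \<Longrightarrow> F x = c *c x"
    and u: "u \<in> U"
  shows "u \<in> span {x \<in> U. \<exists>c. F x = c *c x}" (is "u \<in> span ?E")
proof -
  have E: "span ?E \<subseteq> U" by (rule span_minimal) (use U in auto)
  obtain cs where "fold (\<lambda>c y. F y - c *c y) cs u = 0"
    using annihilating_product[OF F U(1,3) u] by blast
  then show ?thesis
    using u
  proof (induction cs arbitrary: u)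
    case Nil
    then show ?case by (simp add: span_zero)
  next
    case (Cons c cs)
    have "\<exists>u'\<in>span ?E. F (y - (F u' - c *c u')) = c *c (y - (F u' - c *c u'))"
      if "y \<in> span ?E" for y
      using that
    proof (induction rule: span_induct_alt)
      case base
      show ?case by (rule bexI[of _ 0]) (simp_all add: linopD[OF F] span_zero)
    next
      case (step a e y)
      then obtain u' d where u': "u' \<in> span ?E" "F (y - (F u' - c *c u')) = c *c (y - (F u' - c *c u'))"
        and d: "F e = d *c e" by blast
      show ?case
      proof (cases "d = c")
        case True
        then show ?thesis
          using u' d by (intro bexI[of _ u']) (simp_all add: linopD[OF F] algebra_simps)
      next
        case False
        \<comment> \<open>\<open>F - c\<close> multiplies a \<open>d\<close>-eigenvector by
          \<open>d - c\<close>, so \<open>b *c e\<close> is a preimage of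
          \<open>a *c e\<close>.\<close>
        then obtain b where b: "a = b * (d - c)"
          by (metis eq_iff_diff_eq_0 nonzero_eq_divide_eq)
        let ?u = "u' + b *c e"
        have "F ?u - c *c ?u = (F u' - c *c u') + a *c e"
          by (simp add: linopD[OF F] d b algebra_simps)
        moreover have "?u \<in> span ?E" using step(1) by (intro span_add[OF u'(1)] span_scale span_base)
        ultimately show ?thesis using u' by (intro bexI[of _ ?u]) (simp_all add: algebra_simps)
      qed
    qed
    moreover have "F u - c *c u \<in> span ?E"
      using Cons U by (auto intro!: Cons.IH subspace_diff subspace_scale)
    ultimately obtain u' where u': "u' \<in> span ?E"
      and eq: "F ((F u - c *c u) - (F u' - c *c u')) = c *c ((F u - c *c u) - (F u' - c *c u'))"
      by blast
    have *: "(F u - c *c u) - (F u' - c *c u') = F (u - u') - c *c (u - u')"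
      by (simp add: linopD[OF F] algebra_simps)
    have U': "u - u' \<in> U" using Cons.prems u' E U by (auto intro: subspace_diff)
    have "F (u - u') = c *c (u - u')"
      by (rule ss[OF U']) (use eq * in simp)
    then have "u - u' \<in> span ?E" using U' by (auto intro!: span_base)
    then have "(u - u') + u' \<in> span ?E" using u' by (rule span_add)
    then show ?case by simp
  qed
qed

text \<open>If some operator is not scalar on \<open>U\<close>, its eigenspace is a proper nonzero
  subspace stable under all the others, and the dimension drops. This allows \<open>J\<close> to be
  infinite.\<close>

lemma joint_eigenvector_exists:
  assumes F: "\<And>j. j \<in> J \<Longrightarrow> linop (F j)"
    and comm: "\<And>i j x. i \<in> J \<Longrightarrow> j \<in> J \<Longrightarrow> F i (F j x) = F j (F i x)"
    and U: "finite_dim U" "subspace U" "\<And>j x. j \<in> J \<Longrightarrow> x \<in> U \<Longrightarrow> F j x \<in> U"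
    and v: "v \<in> U" "v \<noteq> 0"
  shows "\<exists>w\<in>U. w \<noteq> 0 \<and> (\<forall>j\<in>J. \<exists>c. F j w = c *c w)"
  using U v
proof (induction "dim U" arbitrary: U v rule: less_induct)
  case less
  show ?case
  proof (cases "\<forall>j\<in>J. \<exists>c. \<forall>x\<in>U. F j x = c *c x")
    case True
    then show ?thesis using less.prems(4,5) by blast
  next
    case False
    then obtain j where j: "j \<in> J" "\<And>c. \<exists>x\<in>U. F j x \<noteq> c *c x" by blast
    obtain c w where w: "w \<in> U" "w \<noteq> 0" "F j w = c *c w"
      by (rule eigenvector_exists[OF F[OF j(1)] less.prems(1,2) less.prems(3)[OF j(1)] less.prems(4,5)])
    let ?U = "{x \<in> U. F j x = c *c x}"
    have sub: "subspace ?U"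
      using less.prems(2) unfolding subspace_def
      by (auto simp: linopD[OF F[OF j(1)]] algebra_simps)
    have psub: "?U \<subset> U" using j(2)[of c] by blast
    have "\<exists>w\<in>?U. w \<noteq> 0 \<and> (\<forall>j\<in>J. \<exists>c. F j w = c *c w)"
    proof (intro less.hyps[where v = w])
      show "F i x \<in> ?U" if "i \<in> J" "x \<in> ?U" for i x
        using that less.prems(3)[OF that(1)] comm[OF j(1) that(1), of x] by (simp add: linopD(2)[OF F])
      show "dim ?U < dim U" by (rule dim_psubset[OF less.prems(1) sub psub])
      show "finite_dim ?U" using less.prems(1) psub by (rule finite_dim_subset[OF _ psubset_imp_subset])
    qed (use w sub in auto)
    then show ?thesis by blast
  qed
qed

text \<open>Each application of \<open>P\<close> lowers the eigenvalue of \<open>Q P\<close> by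
  \<open>c\<close>. As \<nu> is no natural multiple of \<open>c\<close>, the ladder never reaches
  zero and produces infinitely many eigenvalues.\<close>

lemma no_descending_eigenvalues:
  assumes PQ: "linop P" "linop Q" and U: "finite_dim U" "\<And>x. x \<in> U \<Longrightarrow> P x \<in> U"
    and comm: "\<And>x. x \<in> U \<Longrightarrow> P (Q x) - Q (P x) = c *c x" "c \<noteq> 0"
    and v: "v \<in> U" "v \<noteq> 0" "Q (P v) = \<nu> *c v" "\<And>k::nat. \<nu> \<noteq> of_nat k * c"
  shows False
proof -
  have eig: "(P ^^ k) v \<in> U \<and> (P ^^ k) v \<noteq> 0 \<and> Q (P ((P ^^ k) v)) = (\<nu> - of_nat k * c) *c (P ^^ k) v"
    for k
  proof (induction k)
    case (Suc k)
    let ?w = "(P ^^ k) v"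
    have "\<nu> - of_nat k * c \<noteq> 0" using v(4)[of k] by simp
    then have 1: "P ?w \<noteq> 0" using Suc linopD(3)[OF PQ(2)] by (metis scale_eq_0_iff)
    have e: "Q (P ?w) = (\<nu> - of_nat k * c) *c ?w" using Suc by simp
    have "Q (P (P ?w)) = P (Q (P ?w)) - c *c P ?w"
      using comm(1)[OF U(2)] Suc by (metis diff_diff_eq2 add_diff_cancel_left')
    also have "\<dots> = (\<nu> - of_nat (Suc k) * c) *c P ?w"
      unfolding e by (simp add: linopD(2,4)[OF PQ(1)] scale_left_diff_distrib scale_left_distrib distrib_right)
    finally show ?case using 1 Suc U(2) by simp
  qed (use v in simp)
  have "finite (UNIV :: nat set)"
  proof (rule finite_joint_eigenvectors[where J = "{()}" and F = "\<lambda>_ x. Q (P x)"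
          and w = "\<lambda>k. (P ^^ k) v" and e = "\<lambda>k _. \<nu> - of_nat k * c", OF U(1)])
    show "Q (P (x + y)) = Q (P x) + Q (P y)" "Q (P (a *c x)) = a *c Q (P x)" for x y a
      by (simp_all add: linopD[OF PQ(1)] linopD[OF PQ(2)])
    show "(P ^^ k) v \<in> U \<and> (P ^^ k) v \<noteq> 0" for k using eig[of k] by blast
    show "Q (P ((P ^^ k) v)) = (\<nu> - of_nat k * c) *c (P ^^ k) v" for k using eig[of k] by blast
    show "\<exists>j\<in>{()}. \<nu> - of_nat k * c \<noteq> \<nu> - of_nat k' * c" if "k \<noteq> k'" for k k' :: nat
      using that comm(2) by simp
  qed
  then show False by simp
qed

text \<open>This stands in for the vanishing trace of a commutator: an eigenvector of
  \<open>Q P\<close> starts an endless ladder either under \<open>P\<close> or under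
  \<open>Q\<close>.\<close>

lemma scalar_commutator_zero:
  assumes PQ: "linop P" "linop Q"
    and U: "finite_dim U" "subspace U" "\<And>x. x \<in> U \<Longrightarrow> P x \<in> U" "\<And>x. x \<in> U \<Longrightarrow> Q x \<in> U"
    and comm: "\<And>x. x \<in> U \<Longrightarrow> P (Q x) - Q (P x) = c *c x"
    and v: "v \<in> U" "v \<noteq> 0"
  shows "c = 0"
proof (rule ccontr)
  assume c: "c \<noteq> 0"
  obtain \<nu> w where w: "w \<in> U" "w \<noteq> 0" "Q (P w) = \<nu> *c w"
    by (rule eigenvector_exists[OF linop_compose[OF PQ(2,1)] U(1,2) _ v]) (rule U(4)[OF U(3)])
  show False
  proof (cases "\<exists>k::nat. \<nu> = of_nat k * c")
    case False
    show False by (rule no_descending_eigenvalues[OF PQ U(1,3) comm c w]) (use False in blast)+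
  next
    case True
    then obtain k :: nat where k: "\<nu> = of_nat k * c" by blast
    show False
    \<comment> \<open>Here \<open>P Q\<close> has the eigenvalue \<open>(k + 1) * c\<close> at
      \<open>w\<close>, which is no natural multiple of \<open>- c\<close>.\<close>
    proof (rule no_descending_eigenvalues[OF PQ(2,1) U(1,4), where c = "- c" and \<nu> = "\<nu> + c"])
      show "Q (P x) - P (Q x) = - c *c x" if "x \<in> U" for x
        using comm[OF that] by (simp add: algebra_simps)
      show "P (Q w) = (\<nu> + c) *c w" using comm[OF w(1)] w(3) by (simp add: algebra_simps)
      show "\<nu> + c \<noteq> of_nat l * (- c)" for l :: nat
      proof
        assume "\<nu> + c = of_nat l * (- c)"
        then have "of_nat k * c + c + of_nat l * c = 0" by (simp add: k)
        then have "of_nat (Suc (k + l)) * c = 0" by (simp add: algebra_simps)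
        then show False using c of_nat_neq_0 by (metis mult_eq_0_iff)
      qed
    qed (use c w in auto)
  qed
qed

section \<open>Diagonalizability and semisimplicity\<close>

lemma span_eigenvectors_sum:
  assumes F: "linop F" and "w \<in> span {x. \<exists>c. F x = c *c x}"
  shows "\<exists>S g. finite S \<and> (\<forall>d\<in>S. F (g d) = d *c g d) \<and> w = (\<Sum>d\<in>S. g d)"
  using assms(2)
proof (induction rule: span_induct_alt)
  case base
  show ?case by (rule exI[of _ "{}"]) simp
next
  case (step a e y)
  then obtain S g c where S: "finite S" "\<forall>d\<in>S. F (g d) = d *c g d" "y = (\<Sum>d\<in>S. g d)"
    and e: "F e = c *c e" by blast
  let ?g = "\<lambda>d. (if d = c then a *c e else 0) + (if d \<in> S then g d else 0)"
  have "(\<Sum>d\<in>insert c S. ?g d) = a *c e + (\<Sum>d\<in>insert c S. if d \<in> S then g d else 0)"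
    using S(1) by (simp add: sum.distrib)
  also have "(\<Sum>d\<in>insert c S. if d \<in> S then g d else 0) = (\<Sum>d\<in>S. g d)"
    using S(1) by (intro sum.mono_neutral_cong_right) auto
  finally have "a *c e + y = (\<Sum>d\<in>insert c S. ?g d)" using S(3) by simp
  moreover have "\<forall>d\<in>insert c S. F (?g d) = d *c ?g d"
    using S(2) e by (auto simp: linopD[OF F] algebra_simps)
  moreover have "finite (insert c S)" using S(1) by simp
  ultimately show ?case by (intro exI[of _ "insert c S"] exI[of _ ?g] conjI)
qed

text \<open>A converse of \<open>diagonalizable_span\<close> in arbitrary dimension: the component
  of \<open>w\<close> with eigenvalue \<open>d\<close> is killed by \<open>(d - b)^2\<close>, so it
  vanishes unless \<open>d = b\<close>.\<close>

lemma diagonalizable_imp_semisimple: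
  assumes F: "linop F" and w: "w \<in> span {x. \<exists>c. F x = c *c x}"
    and "F (F w - b *c w) = b *c (F w - b *c w)"
  shows "F w = b *c w"
proof -
  obtain S g where S: "finite S" "\<And>d. d \<in> S \<Longrightarrow> F (g d) = d *c g d" "w = (\<Sum>d\<in>S. g d)"
    using span_eigenvectors_sum[OF F w] by blast
  have 1: "F w - b *c w = (\<Sum>d\<in>S. (d - b) *c g d)"
    unfolding S(3) linop_sum[OF F] scale_sum_right sum_subtractf[symmetric]
    by (rule sum.cong) (simp_all add: S(2) algebra_simps)
  have "((d - b) * (d - b)) *c g d = F ((d - b) *c g d) - b *c ((d - b) *c g d)" if "d \<in> S" for d
  proof -
    have "F ((d - b) *c g d) = ((d - b) * d) *c g d"
      by (simp only: linopD(2)[OF F] S(2)[OF that] scale_scale)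
    moreover have "(d - b) * (d - b) = (d - b) * d - b * (d - b)" by (simp add: algebra_simps)
    ultimately show ?thesis by (simp only: scale_scale scale_left_diff_distrib[symmetric])
  qed
  then have "(\<Sum>d\<in>S. ((d - b) * (d - b)) *c g d) = F (F w - b *c w) - b *c (F w - b *c w)"
    unfolding 1 linop_sum[OF F] scale_sum_right sum_subtractf[symmetric]
    by (intro sum.cong) simp_all
  then have "(\<Sum>d\<in>S. ((d - b) * (d - b)) *c g d) = 0" using assms(3) by simp
  then have 2: "(\<Sum>d\<in>{d\<in>S. g d \<noteq> 0}. ((d - b) * (d - b)) *c g d) = 0"
    using S(1) by (subst sum.mono_neutral_left[where T = S]) auto
  have "\<forall>d\<in>{d\<in>S. g d \<noteq> 0}. (d - b) * (d - b) = 0"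
  proof (rule joint_eigenvectors_independent[where J = "{()}" and F = "\<lambda>_. F" and w = g
        and e = "\<lambda>d _. d", OF _ _ _ _ _ _ 2])
  qed (use S in \<open>auto simp: linopD[OF F]\<close>)
  then have "(\<Sum>d\<in>S. (d - b) *c g d) = 0" by (intro sum.neutral) auto
  then show ?thesis using 1 by simp
qed

text \<open>One operator at a time: \<open>F i\<close> preserves each joint eigenspace of the
  operators in \<open>J\<close> and is diagonalizable there.\<close>

lemma span_joint_eigenvectors:
  assumes "finite J" and fd: "finite_dim UNIV"
    and F: "\<And>j. j \<in> J \<Longrightarrow> linop (F j)"
    and comm: "\<And>i j x. i \<in> J \<Longrightarrow> j \<in> J \<Longrightarrow> F i (F j x) = F j (F i x)"
    and ss: "\<And>j c x. j \<in> J \<Longrightarrow> F j (F j x - c *c x) = c *c (F j x - c *c x) \<Longrightarrow> F j x = c *c x"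
  shows "x \<in> span {x. \<forall>j\<in>J. \<exists>c. F j x = c *c x}"
  using assms(1) F comm ss
proof (induction J arbitrary: x rule: finite_induct)
  case empty
  show ?case by (simp add: span_base)
next
  case (insert i J)
  let ?E = "\<lambda>J. {x. \<forall>j\<in>J. \<exists>c. F j x = c *c x}"
  have "?E J \<subseteq> span (?E (insert i J))"
  proof
    fix y assume "y \<in> ?E J"
    then obtain c where c: "\<And>j. j \<in> J \<Longrightarrow> F j y = c j *c y" by (auto simp: bchoice_iff)
    let ?U = "{x. \<forall>j\<in>J. F j x = c j *c x}"
    have lin: "linop (F j)" if "j \<in> insert i J" for j using insert.prems(1) that by blast
    have "y \<in> span {x \<in> ?U. \<exists>c. F i x = c *c x}"
    proof (rule diagonalizable_span)
      show "linop (F i)" by (simp add: lin)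
      show "finite_dim ?U" using fd by (rule finite_dim_subset) simp
      show "subspace ?U" using lin by (auto simp: subspace_def linopD algebra_simps)
      show "F i x \<in> ?U" if x: "x \<in> ?U" for x
      proof safe
        fix j assume j: "j \<in> J"
        then have "F j (F i x) = F i (F j x)" using insert.prems(2)[of j i] by simp
        then show "F j (F i x) = c j *c F i x" using x j lin[of i] by (simp add: linopD(2))
      qed
      show "F i x = a *c x" if "F i (F i x - a *c x) = a *c (F i x - a *c x)" for a x
        by (rule insert.prems(3)[OF insertI1 that])
      show "y \<in> ?U" using c by simp
    qed
    moreover have "{x \<in> ?U. \<exists>c. F i x = c *c x} \<subseteq> ?E (insert i J)" by auto
    ultimately show "y \<in> span (?E (insert i J))" using span_mono by blast
  qed
  then have "span (?E J) \<subseteq> span (?E (insert i J))" by (rule span_minimal) simp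
  moreover have "x \<in> span (?E J)"
    by (rule insert.IH) (rule insert.prems; (rule insertI2)?; assumption)+
  ultimately show ?case by blast
qed

end

section \<open>Heisenberg algebras graded by \<open>\<int>\<^sup>2\<close>\<close>

lemma count_list_replicate: "count_list (replicate k x) y = (if x = y then k else 0)"
  by (induction k) auto

lemma int_pair_neq_uminus: "(r :: int \<times> int) \<noteq> 0 \<Longrightarrow> r \<noteq> - r"
  by (cases r) (auto simp: zero_prod_def)

text \<open>Generators of a Heisenberg algebra with central charges \<kappa>, graded by a lattice of
  rank two; \<open>E 0\<close> is unconstrained. The aim is to show that such a family forces
  \<open>W 0\<close> to be trivial.\<close>

locale heisenberg_rank_two = complex_space scale
  for scale :: "complex \<Rightarrow> 'b::ab_group_add \<Rightarrow> 'b" (infixr \<open>*c\<close> 75) +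
  fixes E :: "int \<times> int \<Rightarrow> 'b \<Rightarrow> 'b" and \<kappa> :: "int \<times> int \<Rightarrow> complex" and W :: "int \<times> int \<Rightarrow> 'b set"
  assumes linop_E: "r \<noteq> 0 \<Longrightarrow> linop (E r)"
    and finite_dim_W: "finite_dim (W s)" and subspace_W: "subspace (W s)"
    and E_W: "r \<noteq> 0 \<Longrightarrow> x \<in> W s \<Longrightarrow> E r x \<in> W (s + r)"
    and E_comm: "r \<noteq> 0 \<Longrightarrow> s \<noteq> 0 \<Longrightarrow> E r (E s x) - E s (E r x) = (if r + s = 0 then \<kappa> r *c x else 0)"
    and \<kappa>_nonzero: "r \<noteq> 0 \<Longrightarrow> \<kappa> r \<noteq> 0"
begin

section \<open>Number operators and their joint eigenvectors\<close>

lemmas E_lin = linopD[OF linop_E]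

definition eig :: "'b \<Rightarrow> (int \<times> int \<Rightarrow> complex) \<Rightarrow> bool"
  where "eig w n \<longleftrightarrow> w \<noteq> 0 \<and> (\<forall>s. s \<noteq> 0 \<longrightarrow> E (- s) (E s w) = n s *c w)"

lemma eigD:
  assumes "eig w n"
  shows "w \<noteq> 0" and "s \<noteq> 0 \<Longrightarrow> E (- s) (E s w) = n s *c w"
  using assms unfolding eig_def by blast+

lemma E_swap: "r \<noteq> 0 \<Longrightarrow> s \<noteq> 0 \<Longrightarrow> r + s \<noteq> 0 \<Longrightarrow> E r (E s x) = E s (E r x)"
  using E_comm[of r s x] by simp

lemma eig_uminus:
  assumes "eig w n" "r \<noteq> 0"
  shows "n (- r) = n r + \<kappa> r"
proof -
  have "E r (E (- r) w) = n (- r) *c w"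
    using eigD(2)[OF assms(1), of "- r"] assms(2) by simp
  moreover have "E (- r) (E r w) = n r *c w" using assms by (simp add: eigD)
  ultimately have "(n (- r) - n r - \<kappa> r) *c w = 0"
    using E_comm[of r "- r" w] assms(2) by (simp add: scale_left_diff_distrib)
  then have "n (- r) - n r - \<kappa> r = 0" using eigD(1)[OF assms(1)] by simp
  then show ?thesis by (simp add: algebra_simps)
qed

text \<open>\<open>E (- r)\<close> sends \<open>E r w\<close> back to a nonzero multiple of
  \<open>w\<close>, so the new vector is nonzero. The eigenvalues of the number operators change
  only at \<open>r\<close> and \<open>- r\<close>, by the usual ladder relations.\<close>

lemma eig_step:
  assumes w: "eig w n" and r: "r \<noteq> 0" "n r \<noteq> 0"
  shows "eig (E r w) (\<lambda>s. n s - (if s = r then \<kappa> s else 0) + (if s = - r then \<kappa> s else 0))"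
  unfolding eig_def
proof (intro conjI allI impI)
  have Nr: "E (- r) (E r w) = n r *c w" using w r by (simp add: eigD)
  show "E r w \<noteq> 0"
  proof
    assume "E r w = 0"
    then have "n r *c w = 0" using Nr r E_lin(3)[of "- r"] by simp
    then show False using eigD(1)[OF w] r by simp
  qed
  fix s :: "int \<times> int" assume s: "s \<noteq> 0"
  have Ns: "E (- s) (E s w) = n s *c w" using w s by (simp add: eigD)
  consider "s = r" | "s = - r" | "s \<noteq> r" "s \<noteq> - r" by blast
  then show "E (- s) (E s (E r w)) =
    (n s - (if s = r then \<kappa> s else 0) + (if s = - r then \<kappa> s else 0)) *c E r w"
  proof cases
    case 1
    have "E (- r) (E r (E r w)) = E r (E (- r) (E r w)) - \<kappa> r *c E r w"
      using E_comm[of r "- r" "E r w"] r by (simp add: algebra_simps)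
    then show ?thesis
      using 1 r int_pair_neq_uminus[OF r(1)] by (simp add: Nr E_lin(2) scale_left_diff_distrib)
  next
    case 2
    have "n s + \<kappa> s = n r"
      using eig_uminus[OF w s] 2 by simp
    then show ?thesis
      using 2 r int_pair_neq_uminus[OF r(1)] by (auto simp: Nr E_lin(2))
  next
    case 3
    have "s + r \<noteq> 0" using 3(2) by (simp add: eq_neg_iff_add_eq_0)
    moreover have "- s + r \<noteq> 0" using 3(1) by (metis add.commute eq_iff_diff_eq_0 diff_conv_add_uminus)
    ultimately have "E (- s) (E s (E r w)) = E r (E (- s) (E s w))"
      using E_swap[of s r] E_swap[of "- s" r] s r by simp
    then show ?thesis using 3 r by (simp add: Ns E_lin(2))
  qed
qed

text \<open>Since \<open>n r\<close> is no natural multiple of \<open>\<kappa> r\<close>, lowering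
  it never reaches zero; since \<open>- r\<close> does not occur in the list, it is never raised
  again.\<close>

lemma eig_foldr:
  assumes "eig w n"
    and "\<And>r. r \<in> set rs \<Longrightarrow> r \<noteq> 0 \<and> - r \<notin> set rs \<and> (\<forall>k::nat. n r \<noteq> of_nat k * \<kappa> r)"
  shows "eig (foldr E rs w)
    (\<lambda>s. n s - (of_nat (count_list rs s) - of_nat (count_list rs (- s))) * \<kappa> s)"
  using assms(2)
proof (induction rs)
  case Nil
  then show ?case using assms(1) by simp
next
  case (Cons r rs)
  let ?n = "\<lambda>s. n s - (of_nat (count_list rs s) - of_nat (count_list rs (- s))) * \<kappa> s"
  have IH: "eig (foldr E rs w) ?n" by (rule Cons.IH) (use Cons.prems in auto)
  have r: "r \<noteq> 0" "- r \<notin> set rs" "\<And>k::nat. n r \<noteq> of_nat k * \<kappa> r"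
    using Cons.prems[of r] by auto
  have "?n r \<noteq> 0" using r(3)[of "count_list rs r"] r(2) by (simp add: count_list_0_iff)
  from eig_step[OF IH r(1) this]
  have "eig (E r (foldr E rs w)) (\<lambda>s. ?n s - (if s = r then \<kappa> s else 0) + (if s = - r then \<kappa> s else 0))" .
  moreover have "(\<lambda>s. ?n s - (if s = r then \<kappa> s else 0) + (if s = - r then \<kappa> s else 0)) =
    (\<lambda>s. n s - (of_nat (count_list (r # rs) s) - of_nat (count_list (r # rs) (- s))) * \<kappa> s)"
  proof
    fix s
    consider "s = r" | "s = - r" | "s \<noteq> r" "s \<noteq> - r" by blast
    then show "?n s - (if s = r then \<kappa> s else 0) + (if s = - r then \<kappa> s else 0) =
      n s - (of_nat (count_list (r # rs) s) - of_nat (count_list (r # rs) (- s))) * \<kappa> s"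
      using int_pair_neq_uminus[OF r(1)] by cases (auto simp: algebra_simps equation_minus_iff)
  qed
  ultimately show ?case by simp
qed

lemma foldr_W: "w \<in> W s \<Longrightarrow> 0 \<notin> set rs \<Longrightarrow> foldr E rs w \<in> W (s + sum_list rs)"
proof (induction rs)
  case (Cons r rs)
  then have "E r (foldr E rs w) \<in> W ((s + sum_list rs) + r)" by (intro E_W) auto
  then show ?case by (simp add: ac_simps)
qed simp

text \<open>Only \<open>s = - r\<close> needs an argument: there \<open>?N r\<close> is
  \<open>?N s\<close> plus a scalar. For \<open>s\<close> different from both \<open>r\<close> and
  \<open>- r\<close>, the factors of one operator commute with those of the other.\<close>

lemma N_comm:
  assumes s: "s \<noteq> 0" and r: "r \<noteq> 0"
  shows "E (- s) (E s (E (- r) (E r x))) = E (- r) (E r (E (- s) (E s x)))"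
    (is "?N s (?N r x) = ?N r (?N s x)")
proof -
  consider "s = r" | "s = - r" | "s + r \<noteq> 0" "- s + r \<noteq> 0"
    by (metis add.commute add.inverse_inverse eq_neg_iff_add_eq_0)
  then show ?thesis
  proof cases
    case 2
    have "?N r (?N s x) = E s (E (- s) (E (- s) (E s x)))" by (simp add: 2)
    also have "E s (E (- s) (E (- s) (E s x))) = E (- s) (E s (E (- s) (E s x))) + \<kappa> s *c E (- s) (E s x)"
      using E_comm[of s "- s" "E (- s) (E s x)"] s by (simp add: algebra_simps)
    also have "\<dots> = E (- s) (E s (E (- s) (E s x) + \<kappa> s *c x))"
      using s by (simp add: E_lin)
    also have "E (- s) (E s x) + \<kappa> s *c x = E s (E (- s) x)"
      using E_comm[of s "- s" x] s by (simp add: algebra_simps)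
    also have "E (- s) (E s (E s (E (- s) x))) = ?N s (?N r x)" by (simp add: 2)
    finally show ?thesis by (rule sym)
  next
    case 3
    have "s \<noteq> r" using 3(2) by auto
    then have d: "s + - r \<noteq> 0" by simp
    have "- (s + r) \<noteq> 0" using 3(1) by (simp only: neg_equal_0_iff_equal not_False_eq_True)
    then have d': "- s + - r \<noteq> 0" by simp
    have c: "E s (E r y) = E r (E s y)" "E s (E (- r) y) = E (- r) (E s y)"
      "E (- s) (E r y) = E r (E (- s) y)" "E (- s) (E (- r) y) = E (- r) (E (- s) y)" for y
      using E_swap[of s r] E_swap[of s "- r"] E_swap[of "- s" r] E_swap[of "- s" "- r"] 3 d d' r s by simp_all
    have "?N s (?N r x) = E (- s) (E (- r) (E s (E r x)))" by (simp only: c(2))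
    also have "\<dots> = E (- r) (E (- s) (E r (E s x)))" by (simp only: c(4) c(1))
    also have "\<dots> = ?N r (?N s x)" by (simp only: c(3))
    finally show ?thesis .
  qed simp
qed

lemma eig_exists:
  assumes "w \<in> W 0" "w \<noteq> 0"
  obtains v n where "v \<in> W 0" "eig v n"
proof -
  let ?N = "\<lambda>s x. E (- s) (E s x)"
  have "\<exists>v\<in>W 0. v \<noteq> 0 \<and> (\<forall>s\<in>{s. s \<noteq> 0}. \<exists>c. ?N s v = c *c v)"
  proof (rule joint_eigenvector_exists[OF _ _ finite_dim_W subspace_W _ assms])
    fix s assume "s \<in> {s. s \<noteq> (0 :: int \<times> int)}"
    then have s: "s \<noteq> 0" "- s \<noteq> 0" by auto
    show "linop (?N s)" by (rule linop_compose[OF linop_E[OF s(2)] linop_E[OF s(1)]])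
    show "?N s x \<in> W 0" if "x \<in> W 0" for x
      using E_W[OF s(2) E_W[OF s(1) that]] by simp
    show "?N s (?N r x) = ?N r (?N s x)" if "r \<in> {s. s \<noteq> 0}" for r x
      using s(1) that by (intro N_comm) auto
  qed
  then obtain v where v: "v \<in> W 0" "v \<noteq> 0" "\<forall>s. s \<noteq> 0 \<longrightarrow> (\<exists>c. ?N s v = c *c v)" by blast
  then obtain n where "\<forall>s. s \<noteq> 0 \<longrightarrow> ?N s v = n s *c v" by metis
  then have "eig v n" using v(2) unfolding eig_def by blast
  then show ?thesis using v(1) that by blast
qed

end

section \<open>The order on the lattice defined by an eigenvector\<close>

locale heisenberg_eigenvector = heisenberg_rank_two +
  fixes v :: 'a and n :: "int \<times> int \<Rightarrow> complex"
  assumes v_W: "v \<in> W 0" and v_eig: "eig v n"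
begin

text \<open>If \<open>pos r\<close>, then no power of \<open>E r\<close> kills \<open>v\<close>.\<close>

definition pos :: "int \<times> int \<Rightarrow> bool"
  where "pos r \<longleftrightarrow> r \<noteq> 0 \<and> (\<forall>k::nat. n r \<noteq> of_nat k * \<kappa> r)"

text \<open>If both failed, \<open>n (- r) = n r + \<kappa> r\<close> and
  \<open>\<kappa> (- r) = - \<kappa> r\<close> would give
  \<open>(k + l + 1) * \<kappa> r = 0\<close>.\<close>

lemma pos_or_pos_uminus:
  assumes r: "r \<noteq> 0"
  shows "pos r \<or> pos (- r)"
proof (rule ccontr)
  assume "\<not> ?thesis"
  then obtain k l :: nat where kl: "n r = of_nat k * \<kappa> r" "n (- r) = of_nat l * \<kappa> (- r)"
    using r by (auto simp: pos_def)
  have "n (- r) = n r + \<kappa> r" "n r = n (- r) + \<kappa> (- r)"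
    using eig_uminus[OF v_eig r] eig_uminus[OF v_eig, of "- r"] r by auto
  then have "\<kappa> (- r) = - \<kappa> r" by (simp add: eq_neg_iff_add_eq_0)
  then have "of_nat k * \<kappa> r + \<kappa> r = - (of_nat l * \<kappa> r)"
    using \<open>n (- r) = n r + \<kappa> r\<close> kl by simp
  then have "of_nat k * \<kappa> r + \<kappa> r + of_nat l * \<kappa> r = 0" by simp
  then have "of_nat (Suc (k + l)) * \<kappa> r = 0" by (simp add: algebra_simps)
  then show False using \<kappa>_nonzero[OF r] of_nat_neq_0 by (metis mult_eq_0_iff)
qed

lemma pos_monomial:
  assumes "\<And>r. r \<in> set rs \<Longrightarrow> pos r \<and> - r \<notin> set rs"
  shows "foldr E rs v \<in> W (sum_list rs)" "foldr E rs v \<noteq> 0"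
    "s \<noteq> 0 \<Longrightarrow> E (- s) (E s (foldr E rs v)) =
      (n s - (of_nat (count_list rs s) - of_nat (count_list rs (- s))) * \<kappa> s) *c foldr E rs v"
proof -
  have "eig (foldr E rs v) (\<lambda>s. n s - (of_nat (count_list rs s) - of_nat (count_list rs (- s))) * \<kappa> s)"
    by (rule eig_foldr[OF v_eig]) (use assms in \<open>auto simp: pos_def\<close>)
  then show "foldr E rs v \<noteq> 0"
    "s \<noteq> 0 \<Longrightarrow> E (- s) (E s (foldr E rs v)) =
      (n s - (of_nat (count_list rs s) - of_nat (count_list rs (- s))) * \<kappa> s) *c foldr E rs v"
    by (simp_all add: eigD)
  show "foldr E rs v \<in> W (sum_list rs)"
    using foldr_W[OF v_W, of rs] assms[of 0] by (auto simp: pos_def)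
qed

text \<open>If \<open>t = - (r + s)\<close> were positive as well, applying each of
  \<open>E r\<close>, \<open>E s\<close>, \<open>E t\<close> exactly \<open>k\<close> times to
  \<open>v\<close> would give vectors in \<open>W 0\<close> whose eigenvalues under one number
  operator differ for different \<open>k\<close>.\<close>

lemma not_pos_uminus_add:
  assumes r: "pos r" and s: "pos s" and rs: "r + s \<noteq> 0"
  shows "\<not> pos (- (r + s))"
proof
  define t where "t = - (r + s)"
  assume "pos (- (r + s))"
  then have t: "pos t" by (simp add: t_def)
  define l where "l k = replicate k r @ replicate k s @ replicate k t" for k
  have nz: "r \<noteq> 0" "s \<noteq> 0" "t \<noteq> 0" using r s t by (simp_all add: pos_def)
  have neg: "- r \<noteq> s" "- r \<noteq> t" "- s \<noteq> t" "- s \<noteq> r" "- t \<noteq> r" "- t \<noteq> s" "- r \<noteq> r" "- s \<noteq> s" "- t \<noteq> t"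
    using nz rs unfolding t_def by (auto simp: prod_eq_iff)
  have l: "x \<in> set (l k) \<Longrightarrow> pos x \<and> - x \<notin> set (l k)" for x k
    using r s t neg by (auto simp: l_def split: if_splits)
  have sum: "sum_list (l k) = 0" for k
  proof (induction k)
    case (Suc k)
    have "sum_list (l (Suc k)) = sum_list (l k) + (r + s + t)" by (simp add: l_def)
    then show ?case using Suc by (simp add: t_def)
  qed (simp add: l_def)
  \<comment> \<open>The number of members of the list \<open>r, s, t\<close> equal to
    \<open>r\<close>, since these degrees may coincide.\<close>
  define c where "c = 1 + (if s = r then 1 else 0) + (if t = r then 1 else 0 :: nat)"
  have cnt: "count_list (l k) r = c * k" "count_list (l k) (- r) = 0" for k
    using neg by (auto simp: l_def c_def count_list_replicate)
  have "finite (UNIV :: nat set)"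
  proof (rule finite_joint_eigenvectors[where J = "{()}" and F = "\<lambda>_ x. E (- r) (E r x)"
        and w = "\<lambda>k. foldr E (l k) v" and e = "\<lambda>k _. n r - of_nat (c * k) * \<kappa> r",
        OF finite_dim_W[of 0]])
    show "E (- r) (E r (x + y)) = E (- r) (E r x) + E (- r) (E r y)"
      "E (- r) (E r (a *c x)) = a *c E (- r) (E r x)" for x y a
      using nz by (simp_all add: E_lin)
    show "foldr E (l k) v \<in> W 0 \<and> foldr E (l k) v \<noteq> 0" for k
      using pos_monomial(1,2)[OF l, of k] sum[of k] by simp
    show "E (- r) (E r (foldr E (l k) v)) = (n r - of_nat (c * k) * \<kappa> r) *c foldr E (l k) v" for k
      using pos_monomial(3)[OF l nz(1), of k] by (simp add: cnt)
    show "\<exists>j\<in>{()}. n r - of_nat (c * k) * \<kappa> r \<noteq> n r - of_nat (c * k') * \<kappa> r"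
      if "k \<noteq> k'" for k k'
    proof -
      have "c * k \<noteq> c * k'" using that by (simp add: c_def)
      then have "(of_nat (c * k) :: complex) \<noteq> of_nat (c * k')" by (simp only: of_nat_eq_iff not_False_eq_True)
      then show ?thesis using \<kappa>_nonzero[OF nz(1)] by (simp del: of_nat_mult)
    qed
  qed
  then show False by simp
qed

lemma pos_add: "pos r \<Longrightarrow> pos s \<Longrightarrow> r + s \<noteq> 0 \<Longrightarrow> pos (r + s)"
  using not_pos_uminus_add pos_or_pos_uminus by blast

text \<open>The vectors \<open>E s (E (r - s) v)\<close> lie in the finite-dimensional
  \<open>W r\<close>, and number operators tell them apart.\<close>

lemma finite_pos_decompositions:
  assumes r: "r \<noteq> 0"
  shows "finite {s. pos s \<and> pos (r - s)}" (is "finite ?T")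
proof -
  \<comment> \<open>Unordered pairs, because the two generators commute: \<open>s\<close> and
    \<open>r - s\<close> give the same vector.\<close>
  define I where "I = (\<lambda>s. {s, r - s}) ` ?T"
  have "\<forall>i\<in>I. \<exists>s. pos s \<and> pos (r - s) \<and> i = {s, r - s}" by (auto simp: I_def)
  then obtain f where f: "\<And>i. i \<in> I \<Longrightarrow> pos (f i) \<and> pos (r - f i) \<and> i = {f i, r - f i}" by metis
  define l where "l i = [f i, r - f i]" for i
  have l: "pos x \<and> - x \<notin> set (l i)" if "i \<in> I" "x \<in> set (l i)" for i x
  proof -
    have p: "pos (f i)" "pos (r - f i)" using f[OF that(1)] by blast+
    then have nz: "f i \<noteq> 0" "r - f i \<noteq> 0" by (simp_all add: pos_def)
    have "- f i \<noteq> r - f i" "- (r - f i) \<noteq> f i" using r by auto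
    then show ?thesis
      using that(2) p int_pair_neq_uminus[OF nz(1)] int_pair_neq_uminus[OF nz(2)]
      by (auto simp: l_def)
  qed
  have "finite I"
  proof (rule finite_joint_eigenvectors[where J = "{s. s \<noteq> 0}" and F = "\<lambda>s x. E (- s) (E s x)"
        and w = "\<lambda>i. foldr E (l i) v" and
        e = "\<lambda>i s. n s - (of_nat (count_list (l i) s) - of_nat (count_list (l i) (- s))) * \<kappa> s",
        OF finite_dim_W[of r]])
    show "E (- s) (E s (x + y)) = E (- s) (E s x) + E (- s) (E s y)"
      "E (- s) (E s (a *c x)) = a *c E (- s) (E s x)" if "s \<in> {s. s \<noteq> 0}" for s x y a
      using that by (simp_all add: E_lin)
    show "foldr E (l i) v \<in> W r \<and> foldr E (l i) v \<noteq> 0" if "i \<in> I" for i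
      using pos_monomial(1,2)[OF l[OF that]] by (simp add: l_def)
    show "E (- s) (E s (foldr E (l i) v)) =
      (n s - (of_nat (count_list (l i) s) - of_nat (count_list (l i) (- s))) * \<kappa> s) *c foldr E (l i) v"
      if "i \<in> I" "s \<in> {s. s \<noteq> 0}" for i s
      using pos_monomial(3)[OF l[OF that(1)]] that(2) by simp
    fix i i' assume i: "i \<in> I" "i' \<in> I" "i \<noteq> i'"
    let ?s = "f i"
    have nz: "?s \<noteq> 0" using f[OF i(1)] by (simp add: pos_def)
    have "?s \<notin> set (l i')"
    proof
      assume "?s \<in> set (l i')"
      then have "?s = f i' \<or> ?s = r - f i'" by (simp add: l_def)
      then have "{f i, r - f i} = {f i', r - f i'}" by auto
      then show False using f[OF i(1)] f[OF i(2)] i(3) by metis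
    qed
    then have c': "count_list (l i') ?s = 0" by (simp add: count_list_0_iff)
    have "- ?s \<notin> set (l i)" using l[OF i(1), of ?s] by (simp add: l_def)
    then have c: "count_list (l i) (- ?s) = 0" by (simp add: count_list_0_iff)
    \<comment> \<open>The signed count of \<open>?s\<close> is positive in \<open>l i\<close> but at
      most zero in \<open>l i'\<close>, so its number operator separates \<open>i\<close> from
      \<open>i'\<close>.\<close>
    have "count_list (l i) ?s + count_list (l i') (- ?s) \<noteq> 0" by (simp add: l_def)
    then have "(of_nat (count_list (l i) ?s + count_list (l i') (- ?s)) :: complex) \<noteq> 0"
      by (simp only: of_nat_eq_0_iff not_False_eq_True)
    then have "(of_nat (count_list (l i) ?s) :: complex) \<noteq> - of_nat (count_list (l i') (- ?s))"
      by (simp add: eq_neg_iff_add_eq_0)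
    then have "(of_nat (count_list (l i) ?s) - of_nat (count_list (l i) (- ?s))) * \<kappa> ?s \<noteq>
      (of_nat (count_list (l i') ?s) - of_nat (count_list (l i') (- ?s))) * \<kappa> ?s"
      unfolding c c' mult_cancel_right using \<kappa>_nonzero[OF nz] by simp
    then show "\<exists>s\<in>{s. s \<noteq> 0}.
      n s - (of_nat (count_list (l i) s) - of_nat (count_list (l i) (- s))) * \<kappa> s \<noteq>
      n s - (of_nat (count_list (l i') s) - of_nat (count_list (l i') (- s))) * \<kappa> s"
      using nz by (intro bexI[of _ ?s]) simp_all
  qed
  moreover have "?T \<subseteq> \<Union>I" by (auto simp: I_def)
  moreover have "finite i" if "i \<in> I" for i using that by (auto simp: I_def)
  ultimately show ?thesis by (meson finite_Union finite_subset)
qed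

text \<open>Were \<open>r\<close> and \<open>- r\<close> both positive, a positive \<open>s\<close>
  off the line of \<open>r\<close> would yield infinitely many decompositions of
  \<open>s + s\<close> into \<open>s + m k\<close> and \<open>s - m k\<close>.\<close>

lemma not_pos_uminus:
  assumes r: "pos r"
  shows "\<not> pos (- r)"
proof
  assume r': "pos (- r)"
  define m where "m k = (int k * fst r, int k * snd r)" for k
  have m: "m 0 = 0" "m (Suc k) = m k + r" for k
    by (simp_all add: m_def zero_prod_def prod_eq_iff algebra_simps)
  have r0: "fst r \<noteq> 0 \<or> snd r \<noteq> 0" using r by (auto simp: pos_def prod_eq_iff)
  \<comment> \<open>A unit vector not proportional to \<open>r\<close>.\<close>
  define s0 :: "int \<times> int" where "s0 = (if fst r = 0 then (1, 0) else (0, 1))"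
  have "s0 \<noteq> 0" by (simp add: s0_def zero_prod_def)
  then obtain s where s: "s = s0 \<or> s = - s0" "pos s" using pos_or_pos_uminus by blast
  have ind: "s + m k \<noteq> 0" "s - m k \<noteq> 0" for k
    using s(1) r0 by (auto simp: s0_def m_def prod_eq_iff split: if_splits)
  have pos_s: "pos (s + m k) \<and> pos (s - m k)" for k
  proof (induction k)
    case (Suc k)
    have "s + m (Suc k) = (s + m k) + r" "s - m (Suc k) = (s - m k) + - r" by (simp_all add: m)
    then show ?case using Suc pos_add r r' ind[of "Suc k"] by metis
  qed (use s in \<open>simp add: m\<close>)
  have "s + s \<noteq> 0" using s(2) int_pair_neq_uminus[of s] by (auto simp: pos_def eq_neg_iff_add_eq_0)
  then have "finite {u. pos u \<and> pos (s + s - u)}" by (rule finite_pos_decompositions)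
  moreover have "range (\<lambda>k. s + m k) \<subseteq> {u. pos u \<and> pos (s + s - u)}"
    using pos_s by auto
  ultimately have "finite (range (\<lambda>k. s + m k))" by (rule rev_finite_subset)
  moreover have "inj (\<lambda>k. s + m k)" using r0 by (auto simp: inj_def m_def)
  ultimately show False using finite_imageD by blast
qed

text \<open>The positive elements are the positive cone of a total order. A positive
  \<open>e\<close> with the fewest decompositions has none at all, so for any other positive
  \<open>r\<close> the difference \<open>r - e\<close> is positive and has fewer decompositions than
  \<open>r\<close>. By descent every lattice element is a multiple of \<open>e\<close>, which is
  impossible in rank two.\<close>

lemma contradiction: False
proof -
  let ?T = "\<lambda>r. {s. pos s \<and> pos (r - s)}"
  have card_less: "card (?T s) < card (?T r)" if r: "pos r" and s: "s \<in> ?T r" for r s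
  proof (rule psubset_card_mono)
    show "finite (?T r)" using r by (intro finite_pos_decompositions) (simp add: pos_def)
    have "u \<in> ?T r" if u: "u \<in> ?T s" for u
    proof -
      have "(r - s) + (s - u) \<noteq> 0"
      proof
        assume "(r - s) + (s - u) = 0"
        then have "s - u = - (r - s)" by (simp add: eq_neg_iff_add_eq_0 add.commute)
        then show False using u s not_pos_uminus[of "r - s"] by simp
      qed
      then have "pos ((r - s) + (s - u))" using u s by (intro pos_add) auto
      then show ?thesis using u by simp
    qed
    moreover have "s \<notin> ?T s" by (simp add: pos_def)
    ultimately show "?T s \<subset> ?T r" using s by blast
  qed
  have "\<exists>r. pos r" using pos_or_pos_uminus[of "(1, 0)"] by (auto simp: zero_prod_def)
  then obtain e where e: "pos e" "\<And>r. pos r \<Longrightarrow> card (?T e) \<le> card (?T r)"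
    using ex_has_least_nat[of pos _ "\<lambda>r. card (?T r)"] by metis
  have Te: "s \<notin> ?T e" for s
  proof
    assume s: "s \<in> ?T e"
    then have "card (?T s) < card (?T e)" "pos s" using card_less[OF e(1)] by auto
    then show False using e(2)[of s] by simp
  qed
  have mult: "\<exists>k. r = (k * fst e, k * snd e)" if "pos r" for r
    using that
  proof (induction "card (?T r)" arbitrary: r rule: less_induct)
    case less
    show ?case
    proof (cases "r = e")
      case True
      then show ?thesis by (intro exI[of _ 1]) simp
    next
      case False
      have "\<not> pos (e - r)" using Te[of r] less.prems by simp
      then have p: "pos (r - e)" using pos_or_pos_uminus[of "r - e"] False by simp
      then have "r - e \<in> ?T r" using e(1) by simp
      then obtain k where "r - e = (k * fst e, k * snd e)"
        using less.hyps[OF card_less[OF less.prems] p] by blast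
      then have "r = ((k + 1) * fst e, (k + 1) * snd e)" by (auto simp: prod_eq_iff algebra_simps)
      then show ?thesis by blast
    qed
  qed
  have mult': "\<exists>k. r = (k * fst e, k * snd e)" if r: "r \<noteq> 0" for r
  proof (cases "pos r")
    case False
    then obtain k where "- r = (k * fst e, k * snd e)" using mult pos_or_pos_uminus[OF r] by blast
    then have "r = (- k * fst e, - k * snd e)" by (auto simp: prod_eq_iff)
    then show ?thesis by blast
  qed (rule mult)
  obtain k where k: "(1, 0) = (k * fst e, k * snd e)" using mult'[of "(1, 0)"] by (auto simp: zero_prod_def)
  obtain l where l: "(0, 1) = (l * fst e, l * snd e)" using mult'[of "(0, 1)"] by (auto simp: zero_prod_def)
  show False using k l by auto
qed

end

context heisenberg_rank_two
begin

theorem zero_degree_space_trivial: "W 0 \<subseteq> {0}"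
proof (rule ccontr)
  assume "\<not> ?thesis"
  then obtain w where "w \<in> W 0" "w \<noteq> 0" by blast
  then obtain v n where "v \<in> W 0" "eig v n" by (rule eig_exists)
  then interpret heisenberg_eigenvector scale E \<kappa> W v n by unfold_locales
  show False by (rule contradiction)
qed

end

section \<open>The Cartan subalgebra acting on a weight module\<close>

lemma (in form_lie_algebra) pm_scale_zero: "pm_scale sg a 0 = 0"
  by (rule poly_mapping_eqI) (simp add: pm_lookup_scale)

text \<open>The hypotheses on the module, for an arbitrary finite set of variables; one variable is
  singled out only when the matrix \<open>B\<close> is chosen.\<close>

locale toroidal_module = form_lie_algebra sg br form +
  M: lie_module "toroidal_scale sg" "toroidal_bracket sg br form" sv act
  for sg :: "complex \<Rightarrow> 'g::ab_group_add \<Rightarrow> 'g" and br form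
    and sv :: "complex \<Rightarrow> 'v::ab_group_add \<Rightarrow> 'v" (infixr \<open>*V\<close> 75)
    and act :: "('g, 'n::finite) toroidal \<Rightarrow> 'v \<Rightarrow> 'v" +
  fixes H :: "'g set"
  assumes finite_dim_g: "finite_dim UNIV" and simple: simple
    and nondegenerate: "nondegenerate_form form" and cartan: "cartan_subalgebra H"
    and irreducible: "M.irreducible" and weight_module: "M.weight_module (tau_cartan sg H)"
    and finite_weights: "M.V.finite_dim (M.weight_space (tau_cartan sg H) \<mu>)"
begin

sublocale G: complex_space sg ..
sublocale V: complex_space sv ..

section \<open>Action of the generators\<close>

definition Xop :: "'g \<Rightarrow> int^'n \<Rightarrow> 'v \<Rightarrow> 'v"
  where "Xop X r = act (tau_X X r)"

definition Kop :: "int^'n \<Rightarrow> complex^'n \<Rightarrow> 'v \<Rightarrow> 'v"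
  where "Kop m c = act ((0, K_class (Poly_Mapping.single m c)), 0)"

text \<open>With this inclusion \<open>Kop (r + s) (ivec r)\<close> is the action of
  \<open>d(t^r) t^s\<close>.\<close>

definition ivec :: "int^'n \<Rightarrow> complex^'n"
  where "ivec r = (\<chi> i. of_int (r $ i))"

lemma ivec_simps: "ivec (r + s) = ivec r + ivec s" "ivec (- r) = - ivec r" "ivec 0 = 0"
  "ivec (axis i 1) = axis i 1"
  by (simp_all add: ivec_def vec_eq_iff axis_def)

lemma linop_act: "V.linop (act y)"
  by (rule V.linopI) (rule M.act_add_right M.act_scale_right)+

lemma act_zero: "act 0 v = 0"
  using M.act_add_left[of 0 0 v] by simp

lemmas act_lin = V.linopD[OF linop_act]

lemma linop_Xop: "V.linop (Xop X r)" and linop_Kop: "V.linop (Kop m c)"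
  by (simp_all add: Xop_def Kop_def linop_act)

lemma tau_X_lin: "(tau_X (X + Y) r :: ('g, 'n) toroidal) = tau_X X r + tau_X Y r"
  "(tau_X (sg c X) r :: ('g, 'n) toroidal) = toroidal_scale sg c (tau_X X r)"
proof -
  show "(tau_X (X + Y) r :: ('g, 'n) toroidal) = tau_X X r + tau_X Y r"
    by (simp add: tau_X_def Poly_Mapping.single_add)
  have "K_scale c 0 = (0 :: 'n centre)" by simp
  then show "tau_X (sg c X) r = toroidal_scale sg c (tau_X X r :: ('g, 'n) toroidal)"
    by (simp add: tau_X_def toroidal_scale_eq pm_scale_single)
qed

lemma Xop_add: "Xop (X + Y) r v = Xop X r v + Xop Y r v"
  and Xop_scale: "Xop (sg c X) r v = c *V Xop X r v"
  by (simp_all add: Xop_def tau_X_lin M.act_add_left M.act_scale_left)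

lemma Xop_zero: "Xop 0 r v = 0"
  using Xop_add[of 0 0 r v] by simp

lemma Kop_add: "Kop m (c + d) v = Kop m c v + Kop m d v"
proof -
  have "((0, K_class (Poly_Mapping.single m (c + d))), 0) =
    (((0, K_class (Poly_Mapping.single m c)), 0) :: ('g, 'n) toroidal)
      + ((0, K_class (Poly_Mapping.single m d)), 0)"
    by (simp add: plus_centre.abs_eq Poly_Mapping.single_add)
  then show ?thesis by (simp only: Kop_def M.act_add_left)
qed

lemma Kop_scale: "Kop m (a *s c) v = a *V Kop m c v"
proof -
  have "((0, K_class (Poly_Mapping.single m (a *s c))), 0) =
    toroidal_scale sg a ((0, K_class (Poly_Mapping.single m c)), 0)"
    by (simp add: toroidal_scale_eq K_scale.abs_eq pm_scale_single pm_scale_zero)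
  then show ?thesis by (simp only: Kop_def M.act_scale_left)
qed

lemma Kop_self: "Kop m (ivec m) v = 0"
proof -
  have "K_class (Poly_Mapping.single m (ivec m)) = 0"
    unfolding zero_centre_def K_class_eq_iff ivec_def using K_relations_generator[of m] by simp
  then show ?thesis by (simp add: Kop_def act_zero flip: zero_prod_def)
qed

lemma Kop_zero: "Kop m 0 v = 0"
  using Kop_add[of m 0 0 v] by simp

lemma X_commutator:
  "Xop X r (Xop Y s v) - Xop Y s (Xop X r v) = Xop (br X Y) (r + s) v + form X Y *V Kop (r + s) (ivec r) v"
proof -
  have "((0, K_scale (form X Y) (dt r s)), 0) =
    (toroidal_scale sg (form X Y) ((0, K_class (Poly_Mapping.single (r + s) (ivec r))), 0) :: ('g, 'n) toroidal)"
    by (simp add: toroidal_scale_eq dt_eq ivec_def pm_scale_zero)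
  then show ?thesis
    unfolding Xop_def Kop_def M.act_bracket[symmetric] toroidal_bracket_generators M.act_add_left
    by (simp only: M.act_scale_left)
qed

text \<open>For equal Lie algebra elements only the central term survives; all Heisenberg relations
  below come from here.\<close>

lemma Xop_self_commutator:
  "Xop X r (Xop X s v) - Xop X s (Xop X r v) = form X X *V Kop (r + s) (ivec r) v"
  using X_commutator[of X r X s v] by (simp add: bracket_self Xop_zero)

abbreviation "tc \<equiv> (tau_cartan sg H :: ('g, 'n) toroidal set)"

lemma tau_X_cartan: "h \<in> H \<Longrightarrow> tau_X h 0 \<in> tc"
  unfolding tau_cartan_def by (intro M.span_base) auto

lemma weight_vectors_span: "M.V.span (\<Union> (range (M.weight_space tc))) = UNIV"
  using weight_module unfolding M.weight_module_def M.V.is_direct_sum_def by blast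

lemma g_nontrivial: "\<exists>x y. br x y \<noteq> 0"
  using simple unfolding simple_def by blast

lemma ideal_trivial: "lie_ideal I \<Longrightarrow> I = {0} \<or> I = UNIV"
  using simple unfolding simple_def by blast

lemma form_nonzero: "x \<noteq> 0 \<Longrightarrow> \<exists>y. form x y \<noteq> 0"
  using nondegenerate unfolding nondegenerate_form_def by blast

text \<open>The elements acting by zero in every degree then form an ideal containing all brackets.
  By simplicity all of the loop algebra acts by zero, and so do the central terms of its
  commutators; \<open>t^m K_i\<close> is the term \<open>d(t^r) t^s\<close> with
  \<open>r = axis i 1\<close> and \<open>s = m - r\<close>.\<close>

lemma Kop_zero_if_g_trivial:
  assumes triv: "\<And>X v. Xop X 0 v = 0"
  shows "Kop m (axis i 1) v = 0"
proof -
  let ?I = "{X. \<forall>r v. Xop X r v = 0}"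
  have br: "br X Y \<in> ?I" for X Y
  proof safe
    fix r v
    have "Xop X 0 (Xop Y r v) - Xop Y r (Xop X 0 v) = Xop (br X Y) r v"
      by (simp add: X_commutator ivec_simps Kop_zero)
    then show "Xop (br X Y) r v = 0"
      by (simp add: triv V.linopD(3)[OF linop_Xop])
  qed
  have "subspace ?I"
    by (simp add: subspace_def Xop_zero Xop_add Xop_scale)
  then have "lie_ideal ?I" unfolding lie_ideal_def using br by blast
  moreover have "?I \<noteq> {0}" using g_nontrivial br by blast
  ultimately have X0: "Xop X r v = 0" for X r v using ideal_trivial by blast
  obtain x y where "form x y \<noteq> 0"
    using g_nontrivial form_nonzero by blast
  then have K0: "Kop (r + s) (ivec r) v = 0" for r s
    using X_commutator[of x r y s v] by (simp add: X0)
  show ?thesis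
    using K0[of "axis i 1" "m - axis i 1"] by (simp add: ivec_simps)
qed

end

section \<open>Structure of the Cartan subalgebra forced by the weight decomposition\<close>

locale faithful_toroidal_module = toroidal_module sg br form sv act H
  for sg :: "complex \<Rightarrow> 'g::ab_group_add \<Rightarrow> 'g" and br form
    and sv :: "complex \<Rightarrow> 'v::ab_group_add \<Rightarrow> 'v" (infixr \<open>*V\<close> 75)
    and act :: "('g, 'n::finite) toroidal \<Rightarrow> 'v \<Rightarrow> 'v" and H +
  assumes nontrivial: "\<exists>X v. Xop X 0 v \<noteq> 0"
begin

lemma g_faithful:
  assumes "\<And>v. Xop X 0 v = 0"
  shows "X = 0"
proof -
  let ?I = "{X. \<forall>v. Xop X 0 v = 0}"
  have "br X Y \<in> ?I" if Y: "Y \<in> ?I" for X Y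
  proof safe
    fix v
    have "Xop X 0 (Xop Y 0 v) - Xop Y 0 (Xop X 0 v) = Xop (br X Y) 0 v"
      by (simp add: X_commutator ivec_simps Kop_zero)
    then show "Xop (br X Y) 0 v = 0"
      using Y by (simp add: V.linopD(3)[OF linop_Xop])
  qed
  moreover have "subspace ?I"
    by (simp add: subspace_def Xop_zero Xop_add Xop_scale)
  ultimately have "lie_ideal ?I" unfolding lie_ideal_def by blast
  moreover have "?I \<noteq> UNIV" using nontrivial by blast
  ultimately have "?I = {0}" using ideal_trivial by blast
  then show ?thesis using assms by blast
qed

lemma g_faithful_weight_vectors:
  assumes "\<And>\<mu> v. v \<in> M.weight_space tc \<mu> \<Longrightarrow> Xop X 0 v = 0"
  shows "X = 0"
proof (rule g_faithful)
  fix v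
  have "v \<in> M.V.span (\<Union> (range (M.weight_space tc)))" by (simp add: weight_vectors_span)
  then show "Xop X 0 v = 0"
    by (induction rule: M.V.span_induct_alt) (use assms in \<open>auto simp: V.linopD[OF linop_Xop]\<close>)
qed

lemma weight_vector_X:
  "h \<in> H \<Longrightarrow> v \<in> M.weight_space tc \<mu> \<Longrightarrow> Xop h 0 v = \<mu> (tau_X h 0) *V v"
  using tau_X_cartan[of h] unfolding M.weight_space_def Xop_def by blast

lemma bracket_action: "Xop X 0 (Xop Y 0 v) - Xop Y 0 (Xop X 0 v) = Xop (br X Y) 0 v"
  by (simp add: X_commutator ivec_simps Kop_zero)

text \<open>The definition of a Cartan subalgebra gives nilpotency only. Both elements act by
  scalars on every weight vector, so their bracket acts by zero, and the action is faithful.\<close>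

lemma cartan_abelian:
  assumes "h \<in> H" "h' \<in> H"
  shows "br h h' = 0"
proof (rule g_faithful_weight_vectors)
  fix \<mu> v assume "v \<in> M.weight_space tc \<mu>"
  then show "Xop (br h h') 0 v = 0"
    unfolding bracket_action[symmetric]
    by (simp add: weight_vector_X assms V.linopD[OF linop_Xop] mult.commute)
qed

text \<open>On a weight vector \<open>v\<close>, the operator \<open>?A - (?a + c)\<close> maps
  \<open>Xop X 0 v\<close> to \<open>Xop Y 0 v\<close> and the latter to zero. As \<open>?A\<close>
  is diagonalizable on the module, already the first image vanishes.\<close>

lemma cartan_semisimple:
  assumes h: "h \<in> H" and X: "br h (br h X - sg c X) = sg c (br h X - sg c X)"
  shows "br h X = sg c X"
proof -
  define Y where "Y = br h X - sg c X"
  have "Y = 0"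
  proof (rule g_faithful_weight_vectors)
    fix \<mu> v assume v: "v \<in> M.weight_space tc \<mu>"
    let ?A = "Xop h 0" and ?a = "\<mu> (tau_X h 0)"
    have Av: "?A v = ?a *V v" by (rule weight_vector_X[OF h v])
    have "br h X = sg c X + Y" by (simp add: Y_def)
    then have 1: "?A (Xop X 0 v) - (?a + c) *V Xop X 0 v = Xop Y 0 v"
      using bracket_action[of h X v]
      by (simp add: Av V.linopD[OF linop_Xop] Xop_add Xop_scale algebra_simps)
    have "br h Y = sg c Y" using X by (simp add: Y_def)
    then have 2: "?A (Xop Y 0 v) = (?a + c) *V Xop Y 0 v"
      using bracket_action[of h Y v]
      by (simp add: Av V.linopD[OF linop_Xop] Xop_scale algebra_simps)
    have "\<Union> (range (M.weight_space tc)) \<subseteq> {x. \<exists>c. ?A x = c *V x}"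
      using weight_vector_X[OF h] by blast
    from M.V.span_mono[OF this] have "Xop X 0 v \<in> M.V.span {x. \<exists>c. ?A x = c *V x}"
      unfolding weight_vectors_span by (rule subsetD) simp
    then have "?A (Xop X 0 v) = (?a + c) *V Xop X 0 v"
      by (rule V.diagonalizable_imp_semisimple[OF linop_Xop]) (simp only: 1 2)
    then show "Xop Y 0 v = 0" using 1 by simp
  qed
  then show ?thesis by (simp add: Y_def)
qed

lemma cartan_props: "subspace H" "(\<And>h. h \<in> H \<Longrightarrow> br h x = 0) \<Longrightarrow> x \<in> H" "normalizer H = H"
proof -
  show sub: "subspace H" and n: "normalizer H = H"
    using cartan unfolding cartan_subalgebra_def lie_subalgebra_def by blast+
  assume "\<And>h. h \<in> H \<Longrightarrow> br h x = 0"
  then have "br x h = 0" if "h \<in> H" for h using that bracket_anti[of x h] by simp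
  then have "x \<in> normalizer H" unfolding normalizer_def using subspace_0[OF sub] by simp
  then show "x \<in> H" using n by simp
qed

text \<open>The root space decomposition: the maps \<open>br h\<close>, for \<open>h\<close> in a
  finite basis of \<open>H\<close>, commute by the Jacobi identity and are semisimple by
  \<open>cartan_semisimple\<close>.\<close>

lemma span_root_vectors: "x \<in> span {x. \<forall>h\<in>H. \<exists>c. br h x = sg c x}"
proof -
  obtain B where B: "B \<subseteq> H" "independent B" "H \<subseteq> span B" by (rule basis_exists)
  obtain C where C: "finite C" "UNIV \<subseteq> span C" using finite_dim_g unfolding finite_dim_def by blast
  have "finite B" using independent_span_bound[OF C(1) B(2)] C(2) by blast
  have lin: "G.linop (br h)" for h
    by (rule G.linopI) (simp_all add: bracket_add_right bracket_scale_right)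
  have comm: "br h (br h' x) = br h' (br h x)" if "h \<in> H" "h' \<in> H" for h h' x
  proof -
    have "br x (br h h') = 0" by (simp add: cartan_abelian that bracket_zero)
    then have 1: "br h (br h' x) + br h' (br x h) = 0" using jacobi[of h h' x] by simp
    have 2: "br h' (br x h) = - br h' (br h x)"
      unfolding bracket_anti[of x h] by (rule G.linopD(5)[OF lin])
    show ?thesis using 1 unfolding 2 by simp
  qed
  have "x \<in> span {x. \<forall>h\<in>B. \<exists>c. br h x = sg c x}"
  proof (rule G.span_joint_eigenvectors[OF \<open>finite B\<close> finite_dim_g])
    show "br h (br h' x) = br h' (br h x)" if "h \<in> B" "h' \<in> B" for h h' x
      using that B(1) by (intro comm) auto
    show "br h x = sg c x" if "h \<in> B" "br h (br h x - sg c x) = sg c (br h x - sg c x)" for h c x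
      by (rule cartan_semisimple[OF subsetD[OF B(1) that(1)] that(2)])
  qed (rule lin)
  moreover have "{x. \<forall>h\<in>B. \<exists>c. br h x = sg c x} \<subseteq> {x. \<forall>h\<in>H. \<exists>c. br h x = sg c x}"
  proof safe
    fix x h assume x: "\<forall>h\<in>B. \<exists>c. br h x = sg c x" and "h \<in> H"
    then have "h \<in> span B" using B(3) by blast
    then show "\<exists>c. br h x = sg c x"
    proof (induction rule: span_induct_alt)
      case base
      show ?case by (rule exI[of _ 0]) (simp add: bracket_zero)
    next
      case (step a b y)
      then obtain c d where "br b x = sg c x" "br y x = sg d x" using x by blast
      then have "br (sg a b + y) x = sg (a * c + d) x"
        by (simp add: bracket_add_left bracket_scale_left scale_left_distrib)
      then show ?case by blast
    qed
  qed
  ultimately show ?thesis using span_mono by blast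
qed

text \<open>An element orthogonal to \<open>H\<close> is orthogonal to root vectors of nonzero root
  by invariance, and the remaining root vectors lie in \<open>H\<close>; nondegeneracy on the whole
  algebra then applies.\<close>

lemma form_nondegenerate_on_cartan:
  assumes y: "y \<in> H" "y \<noteq> 0"
  shows "\<exists>h\<in>H. form y h \<noteq> 0"
proof (rule ccontr)
  assume "\<not> ?thesis"
  then have yH: "form y h = 0" if "h \<in> H" for h using that by blast
  have root: "form y e = 0" if e: "\<forall>h\<in>H. \<exists>c. br h e = sg c e" for e
  proof (cases "\<forall>h\<in>H. br h e = 0")
    case True
    then show ?thesis using yH cartan_props(2) by blast
  next
    case False
    then obtain h c where h: "h \<in> H" "br h e = sg c e" "br h e \<noteq> 0" using e by blast
    have "c * form y e = form (br y h) e" by (simp add: form_props(5) h(2) form_props(4))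
    also have "\<dots> = 0" by (simp add: cartan_abelian y h form_props)
    finally show ?thesis using h by auto
  qed
  have "form y x = 0" for x
    using span_root_vectors[of x]
    by (induction rule: span_induct_alt) (use root in \<open>auto simp: form_props(2,4,8)\<close>)
  then show False using form_nonzero[OF y(2)] by blast
qed

text \<open>Polarization: if \<open>form y h\<close> is nonzero, then one of \<open>y\<close>,
  \<open>h\<close>, \<open>y + h\<close> is not isotropic.\<close>

lemma anisotropic_cartan_element: "\<exists>x. (\<forall>h\<in>H. br h x = 0) \<and> form x x \<noteq> 0"
proof -
  have "H \<noteq> {0}"
  proof
    assume "H = {0}"
    then have "normalizer H = UNIV" by (simp add: normalizer_def bracket_zero)
    then have "(UNIV :: 'g set) = {0}" using cartan_props(3) \<open>H = {0}\<close> by simp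
    then show False using g_nontrivial by (metis UNIV_I singletonD)
  qed
  then obtain y where y: "y \<in> H" "y \<noteq> 0" using subspace_0[OF cartan_props(1)] by blast
  then obtain h where h: "h \<in> H" "form y h \<noteq> 0" using form_nondegenerate_on_cartan by blast
  have "form (y + h) (y + h) = form y y + form h h + 2 * form y h"
    using form_props(6)[of h y] by (simp add: form_props(1,2))
  then have "form (y + h) (y + h) \<noteq> 0 \<or> form y y \<noteq> 0 \<or> form h h \<noteq> 0" using h(2) by auto
  moreover have "y + h \<in> H" using y h cartan_props(1) by (simp add: subspace_add)
  ultimately show ?thesis using y(1) h(1) cartan_abelian by blast
qed

end

section \<open>The central operators\<close>

context toroidal_module
begin

text \<open>\<open>cop m\<close>: operators of degree \<open>m\<close> that commute with \<open>\<g> \<otimes> A \<oplus> Z\<close>.  \<open>hop m\<close>: operators of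
  degree \<open>m\<close> that commute with the Cartan subalgebra and \<open>K\<^sub>1, \<dots>, K\<^sub>n\<close>.\<close>

definition cop :: "int^'n \<Rightarrow> ('v \<Rightarrow> 'v) \<Rightarrow> bool"
  where "cop m T \<longleftrightarrow> V.linop T \<and> (\<forall>y v. act y (T v) = T (act y v) + deg_val (snd y) m *V T v)"

definition hop :: "int^'n \<Rightarrow> ('v \<Rightarrow> 'v) \<Rightarrow> bool"
  where "hop m T \<longleftrightarrow> V.linop T \<and> (\<forall>h\<in>tc. \<forall>v. act h (T v) = T (act h v) + deg_val (snd h) m *V T v)"

lemma copI:
  "V.linop T \<Longrightarrow> (\<And>y v. act y (T v) = T (act y v) + deg_val (snd y) m *V T v) \<Longrightarrow> cop m T"
  by (simp add: cop_def)

lemma hopI: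
  "V.linop T \<Longrightarrow> (\<And>h v. h \<in> tc \<Longrightarrow> act h (T v) = T (act h v) + deg_val (snd h) m *V T v) \<Longrightarrow> hop m T"
  by (simp add: hop_def)

lemma copD: "cop m T \<Longrightarrow> V.linop T" "cop m T \<Longrightarrow> act y (T v) = T (act y v) + deg_val (snd y) m *V T v"
  unfolding cop_def by blast+

lemma hopD: "hop m T \<Longrightarrow> V.linop T"
  "hop m T \<Longrightarrow> h \<in> tc \<Longrightarrow> act h (T v) = T (act h v) + deg_val (snd h) m *V T v"
  unfolding hop_def by blast+

lemma cop_imp_hop: "cop m T \<Longrightarrow> hop m T"
  unfolding cop_def hop_def by blast

lemma cop_Kop: "cop m (Kop m c)"
proof (rule copI[OF linop_Kop])
  fix y :: "('g, 'n) toroidal" and v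
  let ?k = "K_class (Poly_Mapping.single m c)"
  obtain f z d where y: "y = ((f, z), d)" by (metis prod.exhaust)
  have L: "lie_algebra sg br" by unfold_locales
  have zero: "current_bracket br f 0 = 0" "toroidal_cocycle form f 0 = 0"
    "degree_deriv sg d 0 = 0" "degree_deriv sg 0 f = 0" "K_deriv 0 z = 0"
    using current_bracket_props(2)[OF L, of f 0 0] toroidal_cocycle_props(2)[of f 0 0]
      degree_deriv_additive(1)[OF vector_space_axioms, of d 0 0] K_deriv_props(2)[of 0 0 z]
      degree_deriv_props(1)[OF L, of 0 0 f] by simp_all
  have "toroidal_bracket sg br form y ((0, ?k), 0) = toroidal_scale sg (deg_val d m) ((0, ?k), 0)"
    by (simp add: y toroidal_bracket_eq toroidal_scale_eq zero K_deriv_props pm_scale_zero)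
  then have "act y (Kop m c v) - Kop m c (act y v) = deg_val d m *V Kop m c v"
    unfolding Kop_def M.act_bracket[symmetric] by (simp only: M.act_scale_left)
  then show "act y (Kop m c v) = Kop m c (act y v) + deg_val (snd y) m *V Kop m c v"
    by (simp add: y algebra_simps)
qed

lemma cop_Xop: "cop m T \<Longrightarrow> T (Xop X r v) = Xop X r (T v)"
  using copD(2)[of m T "tau_X X r" v] by (simp add: Xop_def tau_X_def deg_val_simps)

lemma cop_Kop_commute: "cop m T \<Longrightarrow> T (Kop k c v) = Kop k c (T v)"
  using copD(2)[of m T "((0, K_class (Poly_Mapping.single k c)), 0)" v]
  by (simp add: Kop_def deg_val_simps)

text \<open>\<open>T\<close> commutes with each \<open>act y\<close> up to a multiple of
  \<open>T\<close>, which is enough to make its kernel and range submodules.\<close>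

lemma cop_zero_or_bij:
  assumes T: "cop m T"
  shows "(\<forall>v. T v = 0) \<or> bij T"
proof (cases "\<forall>v. T v = 0")
  case False
  note lin = V.linopD[OF copD(1)[OF T]]
  have irr: "W = {0} \<or> W = UNIV" if "M.V.subspace W" "\<And>x w. w \<in> W \<Longrightarrow> act x w \<in> W" for W
    using irreducible that unfolding M.irreducible_def by blast
  have "{v. T v = 0} = {0} \<or> {v. T v = 0} = UNIV"
  proof (rule irr)
    show "M.V.subspace {v. T v = 0}" by (simp add: M.V.subspace_def lin)
    show "act y v \<in> {v. T v = 0}" if "v \<in> {v. T v = 0}" for y v
      using copD(2)[OF T, of y v] that by (simp add: act_lin)
  qed
  then have "{v. T v = 0} = {0}" using False by blast
  then have ker: "T v = 0 \<Longrightarrow> v = 0" for v by blast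
  have "range T = {0} \<or> range T = UNIV"
  proof (rule irr)
    show "M.V.subspace (range T)"
      unfolding M.V.subspace_def
    proof (intro conjI ballI allI)
      show "0 \<in> range T" using lin(3) by (metis rangeI)
      show "x + y \<in> range T" if "x \<in> range T" "y \<in> range T" for x y
        using that lin(1) by (metis (no_types, lifting) imageE rangeI)
      show "c *V x \<in> range T" if "x \<in> range T" for c x
        using that lin(2) by (metis (no_types, lifting) imageE rangeI)
    qed
    show "act y w \<in> range T" if w: "w \<in> range T" for y w
    proof -
      obtain v where "w = T v" using w by blast
      then have "act y w = T (act y v + deg_val (snd y) m *V v)" by (simp add: copD(2)[OF T] lin)
      then show ?thesis by blast
    qed
  qed
  then have "range T = UNIV" using False by (metis rangeI singletonD)
  moreover have "inj T"
  proof (rule injI)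
    fix v w assume "T v = T w"
    then have "T (v - w) = 0" by (simp add: lin)
    then show "v = w" using ker[of "v - w"] by simp
  qed
  ultimately show ?thesis by (simp add: bij_def)
qed simp

lemma cop_compose:
  assumes "cop m S" "cop k T"
  shows "cop (m + k) (\<lambda>v. S (T v))"
proof (rule copI)
  note S = copD[OF assms(1)] and T = copD[OF assms(2)]
  show "V.linop (\<lambda>v. S (T v))" by (rule V.linop_compose[OF S(1) T(1)])
  show "act y (S (T v)) = S (T (act y v)) + deg_val (snd y) (m + k) *V S (T v)" for y v
    by (simp add: S(2) T(2) V.linopD[OF S(1)] deg_val_simps M.V.scale_left_distrib)
qed

lemma hop_compose:
  assumes "hop m S" "hop k T"
  shows "hop (m + k) (\<lambda>v. S (T v))"
proof (rule hopI)
  note S = hopD[OF assms(1)] and T = hopD[OF assms(2)]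
  show "V.linop (\<lambda>v. S (T v))" by (rule V.linop_compose[OF S(1) T(1)])
  show "act h (S (T v)) = S (T (act h v)) + deg_val (snd h) (m + k) *V S (T v)" if "h \<in> tc" for h v
    by (simp add: S(2)[OF that] T(2)[OF that] V.linopD[OF S(1)] deg_val_simps M.V.scale_left_distrib)
qed

lemma hop_combine:
  assumes "hop m S" "hop m T"
  shows "hop m (\<lambda>v. a *V S v + b *V T v)"
proof (rule hopI)
  note S = hopD[OF assms(1)] and T = hopD[OF assms(2)]
  show "V.linop (\<lambda>v. a *V S v + b *V T v)"
    by (rule V.linopI) (simp_all add: V.linopD[OF S(1)] V.linopD[OF T(1)] algebra_simps)
  show "act h (a *V S v + b *V T v) =
    (a *V S (act h v) + b *V T (act h v)) + deg_val (snd h) m *V (a *V S v + b *V T v)" if "h \<in> tc" for h v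
    by (simp add: S(2)[OF that] T(2)[OF that] act_lin algebra_simps)
qed

lemma linop_inv:
  assumes "V.linop T" "bij T"
  shows "V.linop (inv T)"
proof (rule V.linopI)
  have T: "T (inv T v) = v" "inv T (T v) = v" for v
    using assms(2) by (simp_all add: bij_def surj_f_inv_f)
  show "inv T (x + y) = inv T x + inv T y" for x y
    using T(2)[of "inv T x + inv T y"] by (simp add: V.linopD[OF assms(1)] T(1))
  show "inv T (c *V x) = c *V inv T x" for c x
    using T(2)[of "c *V inv T x"] by (simp add: V.linopD[OF assms(1)] T(1))
qed

lemma cop_inv:
  assumes T: "cop m T" "bij T"
  shows "cop (- m) (inv T)"
proof (rule copI)
  show lin: "V.linop (inv T)" by (rule linop_inv[OF copD(1)[OF T(1)] T(2)])
  have inv: "T (inv T v) = v" "inv T (T v) = v" for v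
    using T(2) by (simp_all add: bij_def surj_f_inv_f)
  have dv: "deg_val c (- m) = - deg_val c m" for c
    by (simp add: deg_val_def sum_negf)
  fix y v
  have "act y v = T (act y (inv T v)) + deg_val (snd y) m *V v"
    using copD(2)[OF T(1), of y "inv T v"] by (simp add: inv)
  then have "inv T (act y v) = act y (inv T v) + deg_val (snd y) m *V inv T v"
    by (simp add: V.linopD[OF lin] inv)
  then show "act y (inv T v) = inv T (act y v) + deg_val (snd y) (- m) *V inv T v"
    by (simp add: dv)
qed

lemma hop_Xop:
  assumes X: "\<And>h. h \<in> H \<Longrightarrow> br h X = 0"
  shows "hop r (Xop X r)"
proof (rule hopI[OF linop_Xop])
  fix h v assume "h \<in> tc"
  then have "act h (act (tau_X X r) v) - act (tau_X X r) (act h v) = deg_val (snd h) r *V act (tau_X X r) v"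
    unfolding tau_cartan_def
  proof (induction rule: M.span_induct_alt)
    case base
    show ?case by (simp add: act_zero act_lin deg_val_simps)
  next
    case (step c y h)
    have "act y (act (tau_X X r) v) - act (tau_X X r) (act y v) = deg_val (snd y) r *V act (tau_X X r) v"
      using step(1)
    proof (elim UnE imageE)
      fix g assume y: "y = tau_X g 0" and "g \<in> H"
      then have "Xop g 0 (Xop X r v) - Xop X r (Xop g 0 v) = 0"
        by (simp add: X_commutator X Xop_zero ivec_simps Kop_zero)
      moreover have "deg_val (snd y) r = 0" by (simp add: y tau_X_def deg_val_simps)
      ultimately show ?thesis by (simp add: y Xop_def)
    next
      fix i assume "y = tau_K 0 i"
      then show ?thesis
        unfolding M.act_bracket[symmetric]
        by (simp add: toroidal_bracket_generators act_zero) (simp add: tau_K_def deg_val_simps)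
    next
      fix i assume y: "y = tau_d i"
      have "deg_val (axis i 1) r = of_int (r $ i)"
        by (simp add: deg_val_def axis_def if_distrib[of "\<lambda>x. x * _"] cong: if_cong)
      then show ?thesis
        unfolding M.act_bracket[symmetric] y toroidal_bracket_generators M.act_scale_left
        by (simp add: tau_d_def)
    qed
    moreover have "snd (toroidal_scale sg c y + h) = c *s snd y + snd h"
      by (cases y rule: prod.exhaust[case_product prod.exhaust])
        (auto simp: toroidal_scale_eq split: prod.splits)
    ultimately show ?case
      using step(2)
      by (simp add: M.act_add_left M.act_scale_left act_lin deg_val_simps M.V.scale_left_distrib algebra_simps
          flip: M.V.scale_scale)
  qed
  then show "act h (Xop X r v) = Xop X r (act h v) + deg_val (snd h) r *V Xop X r v"
    by (simp add: Xop_def algebra_simps)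
qed

definition wshift :: "(('g, 'n) toroidal \<Rightarrow> complex) \<Rightarrow> int^'n \<Rightarrow> 'v set"
  where "wshift \<mu> r = M.weight_space tc (\<lambda>h. \<mu> h + deg_val (snd h) r)"

lemma wshift_zero: "wshift \<mu> 0 = M.weight_space tc \<mu>"
  by (simp add: wshift_def deg_val_simps)

lemma subspace_wshift: "M.V.subspace (wshift \<mu> r)"
  unfolding wshift_def M.weight_space_def M.V.subspace_def
  by (simp add: act_lin algebra_simps)

lemma finite_dim_wshift: "M.V.finite_dim (wshift \<mu> r)"
  unfolding wshift_def by (rule finite_weights)

lemma hop_wshift:
  assumes "hop r T" "v \<in> wshift \<mu> s"
  shows "T v \<in> wshift \<mu> (s + r)"
  using assms(2) hopD(2)[OF assms(1)]
  by (simp add: wshift_def M.weight_space_def V.linopD[OF hopD(1)[OF assms(1)]] deg_val_simps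
      M.V.scale_left_distrib add.assoc)

lemma weight_vector_exists: obtains \<mu> v where "v \<in> wshift \<mu> 0" "v \<noteq> 0"
proof -
  obtain v :: 'v where "v \<noteq> 0" using irreducible unfolding M.irreducible_def by blast
  then have "\<not> \<Union> (range (M.weight_space tc)) \<subseteq> {0}"
    using weight_vectors_span M.V.span_mono[of _ "{0}"] by (metis M.V.span_insert_0 M.V.span_empty UNIV_I singletonD subsetD)
  then show ?thesis using that unfolding wshift_zero by blast
qed

text \<open>\<open>T\<close> preserves a finite-dimensional weight space and so has an eigenvector
  there; then \<open>T - c\<close> again satisfies \<open>cop 0\<close> but is not injective, hence
  is zero.\<close>

lemma schur:
  assumes T: "cop 0 T"
  shows "\<exists>c. \<forall>v. T v = c *V v"
proof -
  note lin = V.linopD[OF copD(1)[OF T]]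
  obtain \<mu> v where v: "v \<in> wshift \<mu> 0" "v \<noteq> 0" by (rule weight_vector_exists)
  have "T x \<in> wshift \<mu> 0" if "x \<in> wshift \<mu> 0" for x
    using hop_wshift[OF cop_imp_hop[OF T] that] by simp
  from V.eigenvector_exists[OF copD(1)[OF T] finite_dim_wshift subspace_wshift this v]
  obtain c w where w: "w \<noteq> 0" "T w = c *V w" by blast
  let ?S = "\<lambda>v. T v - c *V v"
  have S: "cop 0 ?S"
  proof (rule copI)
    show "V.linop ?S" by (rule V.linopI) (simp_all add: lin algebra_simps)
    show "act y (T v - c *V v) = (T (act y v) - c *V act y v) + deg_val (snd y) 0 *V (T v - c *V v)" for y v
      by (simp add: copD(2)[OF T] act_lin deg_val_simps)
  qed
  have "\<not> bij ?S"
  proof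
    assume "bij ?S"
    then have "inj ?S" by (rule bij_is_inj)
    moreover have "?S w = ?S 0" using w(2) by (simp add: lin)
    ultimately show False using w(1) by (metis injD)
  qed
  then have "\<forall>v. T v - c *V v = 0" using cop_zero_or_bij[OF S] by blast
  then show ?thesis by (intro exI[of _ c]) simp
qed

lemma cop_proportional:
  assumes z: "cop m z" "bij z" and T: "cop m T"
  shows "\<exists>c. \<forall>v. T v = c *V z v"
proof -
  have "cop (- m + m) (\<lambda>v. inv z (T v))" by (rule cop_compose[OF cop_inv[OF z] T])
  then have "cop 0 (\<lambda>v. inv z (T v))" by simp
  then obtain c where "\<forall>v. inv z (T v) = c *V v" using schur by blast
  then have "T v = z (c *V v)" for v using z(2) by (metis bij_inv_eq_iff)
  then show ?thesis by (simp add: V.linopD[OF copD(1)[OF z(1)]])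
qed

text \<open>Closed under addition and negation; outside these degrees every central operator is
  zero, by \<open>Kop_nonzero_period\<close>.\<close>

definition periods :: "(int^'n) set"
  where "periods = {m. \<exists>T. cop m T \<and> bij T}"

lemma periods_add: "m \<in> periods \<Longrightarrow> k \<in> periods \<Longrightarrow> m + k \<in> periods"
proof -
  assume "m \<in> periods" "k \<in> periods"
  then obtain S T where ST: "cop m S" "bij S" "cop k T" "bij T" unfolding periods_def by blast
  have "bij (\<lambda>v. S (T v))" using bij_comp[OF ST(4) ST(2)] by (simp add: o_def)
  then show ?thesis unfolding periods_def using cop_compose[OF ST(1,3)] by blast
qed

lemma periods_uminus: "m \<in> periods \<Longrightarrow> - m \<in> periods"
  unfolding periods_def using cop_inv bij_imp_bij_inv by blast

lemma Kop_nonzero_bij: "Kop m c v \<noteq> 0 \<Longrightarrow> bij (Kop m c)"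
  using cop_zero_or_bij[OF cop_Kop] by blast

lemma Kop_nonzero_period: "Kop m c v \<noteq> 0 \<Longrightarrow> m \<in> periods"
  unfolding periods_def using cop_Kop Kop_nonzero_bij by blast

lemma bij_inv_simps: "bij T \<Longrightarrow> T (inv T v) = v" "bij T \<Longrightarrow> inv T (T v) = v"
  by (simp_all add: bij_def surj_f_inv_f)

lemma Kop_axes_zero:
  assumes "\<And>i. Kop m (axis i 1) v = 0"
  shows "Kop m c v = 0"
proof -
  have "Kop m (\<Sum>i\<in>S. c $ i *s axis i 1) v = 0" for S
    by (induction S rule: infinite_finite_induct) (simp_all add: Kop_zero Kop_add Kop_scale assms)
  then show ?thesis using basis_expansion[of c] by metis
qed

text \<open>Slides the central operators to the right, past the \<open>Xop\<close>.\<close>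

lemma X_cop_commutator:
  assumes S: "cop a S" and T: "cop b T" and ST: "\<And>v. S (T v) = T (S v)"
  shows "Xop x r (S (Xop x s (T v))) - Xop x s (T (Xop x r (S v))) =
    form x x *V Kop (r + s) (ivec r) (S (T v))"
  unfolding cop_Xop[OF S] cop_Xop[OF T] ST Xop_self_commutator ..

end

section \<open>Constraints on the functionals given by the central operators\<close>

locale anisotropic_toroidal_module = toroidal_module sg br form sv act H
  for sg :: "complex \<Rightarrow> 'g::ab_group_add \<Rightarrow> 'g" and br form
    and sv :: "complex \<Rightarrow> 'v::ab_group_add \<Rightarrow> 'v" (infixr \<open>*V\<close> 75)
    and act :: "('g, 'n::finite) toroidal \<Rightarrow> 'v \<Rightarrow> 'v" and H +
  fixes x :: 'g
  assumes x_centralizes: "\<And>h. h \<in> H \<Longrightarrow> br h x = 0" and x_anisotropic: "form x x \<noteq> 0"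
begin

text \<open>Otherwise \<open>?P\<close> and \<open>?Q\<close> preserve a finite-dimensional weight
  space and their commutator is the nonzero scalar \<open>form x x\<close>.\<close>

lemma Kop_period:
  assumes \<gamma>: "\<gamma> \<in> periods"
  shows "Kop m (ivec \<gamma>) v = 0"
proof (rule ccontr)
  let ?K = "Kop m (ivec \<gamma>)"
  assume "?K v \<noteq> 0"
  then have K: "cop m ?K" "bij ?K" using cop_Kop Kop_nonzero_bij by blast+
  obtain T where T: "cop \<gamma> T" "bij T" using \<gamma> unfolding periods_def by blast
  note iT = cop_inv[OF T] and iK = cop_inv[OF K]
  \<comment> \<open>\<open>inv ?K\<close> turns the commutator into a scalar, \<open>T\<close>
    cancels \<open>inv T\<close>, and the degree \<open>\<gamma> - m\<close> offsets that of the
    loop operator in \<open>?Q\<close>.\<close>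
  let ?S = "\<lambda>v. T (inv ?K v)"
  have S: "cop (\<gamma> + - m) ?S" by (rule cop_compose[OF T(1) iK])
  have comm: "inv T (?S v) = ?S (inv T v)" for v
  proof -
    have "T (inv ?K (inv T v)) = T (inv ?K (inv T (?K (inv ?K v))))"
      by (simp add: bij_inv_simps[OF K(2)])
    also have "\<dots> = T (inv ?K (?K (inv T (inv ?K v))))"
      by (simp only: cop_Kop_commute[OF iT])
    also have "\<dots> = inv ?K v" by (simp add: bij_inv_simps[OF K(2)] bij_inv_simps[OF T(2)])
    finally show ?thesis by (simp add: bij_inv_simps[OF T(2)])
  qed
  let ?P = "\<lambda>v. Xop x \<gamma> (inv T v)" and ?Q = "\<lambda>v. Xop x (m - \<gamma>) (?S v)"
  have "hop (\<gamma> + - \<gamma>) ?P" by (rule hop_compose[OF hop_Xop[OF x_centralizes] cop_imp_hop[OF iT]])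
  then have P: "hop 0 ?P" by simp
  have "hop ((m - \<gamma>) + (\<gamma> + - m)) ?Q" by (rule hop_compose[OF hop_Xop[OF x_centralizes] cop_imp_hop[OF S]])
  then have Q: "hop 0 ?Q" by simp
  have PQ: "?P (?Q v) - ?Q (?P v) = form x x *V v" for v
    unfolding X_cop_commutator[OF iT S comm]
    by (simp add: bij_inv_simps[OF T(2)] bij_inv_simps[OF K(2)])
  obtain \<mu> w where w: "w \<in> wshift \<mu> 0" "w \<noteq> 0" by (rule weight_vector_exists)
  have "form x x = 0"
    by (rule V.scalar_commutator_zero[OF hopD(1)[OF P] hopD(1)[OF Q] finite_dim_wshift subspace_wshift
          _ _ PQ w]) (use hop_wshift[OF P, of _ \<mu> 0] hop_wshift[OF Q, of _ \<mu> 0] in simp_all)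
  then show False using x_anisotropic by simp
qed

text \<open>A functional taking rationally independent values at \<open>r\<^sub>1, r\<^sub>2\<close> would produce a
  Heisenberg algebra of rank two.\<close>

lemma functional_dependent:
  fixes r\<^sub>1 r\<^sub>2 :: "int^'n"
  defines "R \<equiv> \<lambda>p. (\<chi> i. fst p * r\<^sub>1 $ i + snd p * r\<^sub>2 $ i) :: int^'n"
  assumes z1: "bij (Kop m\<^sub>1 e\<^sub>1)" and z2: "bij (Kop m\<^sub>2 e\<^sub>2)"
    and \<psi>1: "\<And>r v. Kop m\<^sub>1 (ivec r) v = \<psi>\<^sub>1 r *V Kop m\<^sub>1 e\<^sub>1 v"
    and \<psi>2: "\<And>r v. Kop m\<^sub>2 (ivec r) v = \<psi>\<^sub>2 r *V Kop m\<^sub>2 e\<^sub>2 v"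
  shows "\<exists>p. p \<noteq> 0 \<and> c\<^sub>1 * \<psi>\<^sub>1 (R p) + c\<^sub>2 * \<psi>\<^sub>2 (R p) = 0"
proof (rule ccontr)
  assume "\<not> ?thesis"
  then have nz: "c\<^sub>1 * \<psi>\<^sub>1 (R p) + c\<^sub>2 * \<psi>\<^sub>2 (R p) \<noteq> 0" if "p \<noteq> 0" for p using that by blast
  let ?z1 = "Kop m\<^sub>1 e\<^sub>1" and ?z2 = "Kop m\<^sub>2 e\<^sub>2"
  have R_add: "R (p + p') = R p + R p'" and R_uminus: "R (- p) = - R p" and R_zero: "R 0 = 0" for p p'
    by (simp_all add: R_def vec_eq_iff algebra_simps)
  obtain \<mu> w where w: "w \<in> wshift \<mu> 0" "w \<noteq> 0" by (rule weight_vector_exists)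
  have z_nz: "?z1 w \<noteq> 0" "?z2 w \<noteq> 0"
    using w(2) z1 z2 V.linopD(3)[OF linop_Kop] by (metis bij_is_inj injD)+
  \<comment> \<open>By \<open>Kop_period\<close> both functionals vanish on periods, so no
    \<open>R p\<close> with \<open>p \<noteq> 0\<close> is a period. This removes all central terms
    in degrees \<open>m + R p\<close> with \<open>m\<close> a period and
    \<open>p \<noteq> 0\<close>.\<close>
  have \<psi>_zero: "\<psi>\<^sub>1 r = 0" "\<psi>\<^sub>2 r = 0" if "r \<in> periods" for r
    using Kop_period[OF that] \<psi>1[of r w] \<psi>2[of r w] z_nz by simp_all
  have m: "m\<^sub>1 \<in> periods" "m\<^sub>2 \<in> periods" using z_nz Kop_nonzero_period by blast+
  have R_periods: "R p \<notin> periods" if "p \<noteq> 0" for p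
    using nz[OF that] \<psi>_zero[of "R p"] by auto
  have R_periods': "m + R p \<notin> periods" if "p \<noteq> 0" "m \<in> periods" for m p
  proof
    assume "m + R p \<in> periods"
    from periods_add[OF this periods_uminus[OF that(2)]] have "R p \<in> periods" by simp
    then show False using R_periods that by blast
  qed
  have K0: "Kop k c v = 0" if "k \<notin> periods" for k c v using that Kop_nonzero_period by blast
  note i1 = cop_inv[OF cop_Kop z1] and i2 = cop_inv[OF cop_Kop z2]
  have comm12: "inv ?z1 (inv ?z2 v) = inv ?z2 (inv ?z1 v)" for v
  proof -
    have "inv ?z2 (inv ?z1 v) = inv ?z2 (inv ?z1 (?z2 (inv ?z2 v)))" by (simp add: bij_inv_simps[OF z2])
    also have "\<dots> = inv ?z2 (?z2 (inv ?z1 (inv ?z2 v)))" by (simp only: cop_Kop_commute[OF i1])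
    finally show ?thesis by (simp add: bij_inv_simps[OF z2])
  qed
  define q where "q = form x x"
  \<comment> \<open>Composing with the inverse central operator brings the degree back to
    \<open>R p\<close>.\<close>
  define Y1 where "Y1 = (\<lambda>p v. Xop x (m\<^sub>1 + R p) (inv ?z1 v))"
  define Y2 where "Y2 = (\<lambda>p v. Xop x (m\<^sub>2 + R p) (inv ?z2 v))"
  define X0 where "X0 = (\<lambda>p v. Xop x (R p) v)"
  have id: "cop 0 (\<lambda>v. v)" by (rule copI) (simp_all add: V.linop_def deg_val_simps)
  have hop: "hop (R p) (Y1 p)" "hop (R p) (Y2 p)" "hop (R p) (X0 p)" for p
  proof -
    have "hop ((m\<^sub>1 + R p) + - m\<^sub>1) (Y1 p)"
      unfolding Y1_def by (rule hop_compose[OF hop_Xop[OF x_centralizes] cop_imp_hop[OF i1]])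
    then show "hop (R p) (Y1 p)" by simp
    have "hop ((m\<^sub>2 + R p) + - m\<^sub>2) (Y2 p)"
      unfolding Y2_def by (rule hop_compose[OF hop_Xop[OF x_centralizes] cop_imp_hop[OF i2]])
    then show "hop (R p) (Y2 p)" by simp
    show "hop (R p) (X0 p)" unfolding X0_def by (rule hop_Xop[OF x_centralizes])
  qed
  have shift: "(m + R p) + (m' + R p') = (m + m') + R (p + p')"
    "(m + R p) + R p' = m + R (p + p')" "R p + R p' = R (p + p')" for m m' p p'
    by (simp_all add: R_add algebra_simps)
  have YY: "Y1 p (Y1 p' v) = Y1 p' (Y1 p v)" "Y1 p (Y2 p' v) = Y2 p' (Y1 p v)"
    "Y2 p (Y1 p' v) = Y1 p' (Y2 p v)" "Y2 p (Y2 p' v) = Y2 p' (Y2 p v)" if "p + p' \<noteq> 0" for p p' v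
  proof -
    have K: "Kop (m + m' + R (p + p')) c v = 0" if "m \<in> periods" "m' \<in> periods" for m m' c v
      using R_periods'[OF \<open>p + p' \<noteq> 0\<close> periods_add[OF that]] by (rule K0)
    show "Y1 p (Y1 p' v) = Y1 p' (Y1 p v)"
      using X_cop_commutator[OF i1 i1 refl, of x "m\<^sub>1 + R p" "m\<^sub>1 + R p'" v] K[OF m(1) m(1)]
      by (simp add: Y1_def shift)
    show "Y1 p (Y2 p' v) = Y2 p' (Y1 p v)"
      using X_cop_commutator[OF i1 i2 comm12, of x "m\<^sub>1 + R p" "m\<^sub>2 + R p'" v] K[OF m(1) m(2)]
      by (simp add: Y1_def Y2_def shift)
    show "Y2 p (Y1 p' v) = Y1 p' (Y2 p v)"
      using X_cop_commutator[OF i2 i1 comm12[symmetric], of x "m\<^sub>2 + R p" "m\<^sub>1 + R p'" v] K[OF m(2) m(1)]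
      by (simp add: Y1_def Y2_def shift)
    show "Y2 p (Y2 p' v) = Y2 p' (Y2 p v)"
      using X_cop_commutator[OF i2 i2 refl, of x "m\<^sub>2 + R p" "m\<^sub>2 + R p'" v] K[OF m(2) m(2)]
      by (simp add: Y2_def shift)
  qed
  have XX: "X0 p (X0 p' v) = X0 p' (X0 p v)" if "p + p' \<noteq> 0" for p p' v
    using Xop_self_commutator[of x "R p" "R p'" v] K0[OF R_periods[OF that]]
    by (simp add: X0_def shift)
  have YX1: "Y1 p (X0 p' v) - X0 p' (Y1 p v) = (if p + p' = 0 then (q * \<psi>\<^sub>1 (R p)) *V v else 0)" for p p' v
  proof -
    have "Y1 p (X0 p' v) - X0 p' (Y1 p v) = q *V Kop (m\<^sub>1 + R (p + p')) (ivec (m\<^sub>1 + R p)) (inv ?z1 v)"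
      using X_cop_commutator[OF i1 id refl, of x "m\<^sub>1 + R p" "R p'" v]
      by (simp add: Y1_def X0_def q_def shift)
    \<comment> \<open>By \<open>Kop_self\<close> the summand \<open>m\<^sub>1\<close> in the
      argument contributes nothing in degree \<open>m\<^sub>1\<close>.\<close>
    moreover have "Kop m\<^sub>1 (ivec (m\<^sub>1 + R p)) (inv ?z1 v) = \<psi>\<^sub>1 (R p) *V v"
      by (simp add: ivec_simps Kop_add Kop_self \<psi>1 bij_inv_simps[OF z1])
    ultimately show ?thesis using K0[OF R_periods'[OF _ m(1)]] by (simp add: R_zero)
  qed
  have YX2: "Y2 p (X0 p' v) - X0 p' (Y2 p v) = (if p + p' = 0 then (q * \<psi>\<^sub>2 (R p)) *V v else 0)" for p p' v
  proof -
    have "Y2 p (X0 p' v) - X0 p' (Y2 p v) = q *V Kop (m\<^sub>2 + R (p + p')) (ivec (m\<^sub>2 + R p)) (inv ?z2 v)"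
      using X_cop_commutator[OF i2 id refl, of x "m\<^sub>2 + R p" "R p'" v]
      by (simp add: Y2_def X0_def q_def shift)
    moreover have "Kop m\<^sub>2 (ivec (m\<^sub>2 + R p)) (inv ?z2 v) = \<psi>\<^sub>2 (R p) *V v"
      by (simp add: ivec_simps Kop_add Kop_self \<psi>2 bij_inv_simps[OF z2])
    ultimately show ?thesis using K0[OF R_periods'[OF _ m(2)]] by (simp add: R_zero)
  qed
  define Y where "Y = (\<lambda>p v. c\<^sub>1 *V Y1 p v + c\<^sub>2 *V Y2 p v)"
  define \<psi> where "\<psi> r = c\<^sub>1 * \<psi>\<^sub>1 r + c\<^sub>2 * \<psi>\<^sub>2 r" for r
  have \<psi>_uminus: "\<psi> (- r) = - \<psi> r" for r
  proof -
    have "(\<psi>\<^sub>1 (- r) + \<psi>\<^sub>1 r) *V ?z1 w = Kop m\<^sub>1 (ivec (- r) + ivec r) w"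
      "(\<psi>\<^sub>2 (- r) + \<psi>\<^sub>2 r) *V ?z2 w = Kop m\<^sub>2 (ivec (- r) + ivec r) w"
      by (simp_all only: Kop_add \<psi>1 \<psi>2 M.V.scale_left_distrib)
    then have "(\<psi>\<^sub>1 (- r) + \<psi>\<^sub>1 r) *V ?z1 w = 0" "(\<psi>\<^sub>2 (- r) + \<psi>\<^sub>2 r) *V ?z2 w = 0"
      by (simp_all add: ivec_simps Kop_zero)
    then have "\<psi>\<^sub>1 (- r) = - \<psi>\<^sub>1 r" "\<psi>\<^sub>2 (- r) = - \<psi>\<^sub>2 r" using z_nz by (simp_all add: eq_neg_iff_add_eq_0)
    then show ?thesis by (simp add: \<psi>_def)
  qed
  note lin1 = V.linopD[OF hopD(1)[OF hop(1)]] and lin2 = V.linopD[OF hopD(1)[OF hop(2)]]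
    and lin0 = V.linopD[OF hopD(1)[OF hop(3)]]
  have hop_Y: "hop (R p) (Y p)" for p
    unfolding Y_def by (rule hop_combine[OF hop(1,2)])
  have Y_comm: "Y p (Y p' v) = Y p' (Y p v)" if "p + p' \<noteq> 0" for p p' v
    using YY[OF that] by (simp add: Y_def lin1 lin2 algebra_simps)
  have YX: "Y p (X0 p' v) - X0 p' (Y p v) = (if p + p' = 0 then (q * \<psi> (R p)) *V v else 0)" for p p' v
  proof -
    have "Y p (X0 p' v) - X0 p' (Y p v) =
      c\<^sub>1 *V (Y1 p (X0 p' v) - X0 p' (Y1 p v)) + c\<^sub>2 *V (Y2 p (X0 p' v) - X0 p' (Y2 p v))"
      by (simp add: Y_def lin0 algebra_simps)
    then show ?thesis unfolding YX1 YX2 by (simp add: \<psi>_def algebra_simps)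
  qed
  \<comment> \<open>Lexicographic positivity splits the nonzero pairs into two halves exchanged by
    negation.\<close>
  define lexpos :: "int \<times> int \<Rightarrow> bool" where "lexpos p \<longleftrightarrow> fst p > 0 \<or> (fst p = 0 \<and> snd p > 0)" for p
  have lexpos: "lexpos p \<or> lexpos (- p)" if "p \<noteq> 0" for p
    using that by (auto simp: lexpos_def prod_eq_iff)
  have lexpos_add: "p + p' \<noteq> 0" if "lexpos p" "lexpos p'" for p p'
    using that by (auto simp: lexpos_def prod_eq_iff)
  have lexneg_add: "p + p' \<noteq> 0" if "\<not> lexpos p" "\<not> lexpos p'" "p \<noteq> 0" "p' \<noteq> 0" for p p'
    using that by (auto simp: lexpos_def prod_eq_iff)
  \<comment> \<open>Opposite nonzero degrees thus always pair a combined operator with a plain loop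
    operator, and only such pairs fail to commute.\<close>
  define E where "E p = (if lexpos p then Y p else X0 p)" for p
  have hop_E: "hop (R p) (E p)" for p by (simp add: E_def hop_Y hop(3))
  interpret heisenberg_rank_two sv E "\<lambda>p. q * \<psi> (R p)" "\<lambda>p. wshift \<mu> (R p)"
  proof unfold_locales
    show "V.linop (E p)" for p by (rule hopD(1)[OF hop_E])
    show "M.V.finite_dim (wshift \<mu> (R p))" for p by (rule finite_dim_wshift)
    show "M.V.subspace (wshift \<mu> (R p))" for p by (rule subspace_wshift)
    show "E p v \<in> wshift \<mu> (R (p' + p))" if "v \<in> wshift \<mu> (R p')" for p p' v
      using hop_wshift[OF hop_E that] by (simp add: R_add)
    show "q * \<psi> (R p) \<noteq> 0" if "p \<noteq> 0" for p
      using nz[OF that] x_anisotropic by (simp add: q_def \<psi>_def)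
    show "E p (E p' v) - E p' (E p v) = (if p + p' = 0 then (q * \<psi> (R p)) *V v else 0)"
      if "p \<noteq> 0" "p' \<noteq> 0" for p p' v
    proof -
      consider "lexpos p" "lexpos p'" | "lexpos p" "\<not> lexpos p'" | "\<not> lexpos p" "lexpos p'"
        | "\<not> lexpos p" "\<not> lexpos p'" by blast
      then show ?thesis
      proof cases
        case 1
        then show ?thesis using lexpos_add Y_comm by (simp add: E_def)
      next
        case 2
        then show ?thesis using YX by (simp add: E_def)
      next
        case 3
        have "X0 p (Y p' v) - Y p' (X0 p v) = - (if p' + p = 0 then (q * \<psi> (R p')) *V v else 0)"
          unfolding YX[of p' p v, symmetric] by simp
        moreover have "\<psi> (R p') = - \<psi> (R p)" if "p' + p = 0"
          using that \<psi>_uminus[of "R p"] by (simp add: eq_neg_iff_add_eq_0[symmetric] R_uminus)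
        ultimately show ?thesis using 3 by (auto simp: E_def add.commute)
      next
        case 4
        then show ?thesis using lexneg_add[OF 4 that] XX by (simp add: E_def)
      qed
    qed
  qed
  show False using zero_degree_space_trivial w by (auto simp: R_zero)
qed

text \<open>The scalars come from \<open>cop_proportional\<close>; integral linearity is recorded
  for two-term combinations, the shape of the map \<open>R\<close> in
  \<open>functional_dependent\<close>.\<close>

lemma Kop_functional:
  assumes z: "bij (Kop m e)"
  obtains \<psi> where "\<And>r v. Kop m (ivec r) v = \<psi> r *V Kop m e v"
    and "\<And>i j r s. \<psi> (\<chi> k. i * r $ k + j * s $ k) = of_int i * \<psi> r + of_int j * \<psi> s"
proof -
  have "\<exists>a. \<forall>v. Kop m (ivec r) v = a *V Kop m e v" for r
    by (rule cop_proportional[OF cop_Kop z cop_Kop])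
  then obtain \<psi> where \<psi>: "\<And>r v. Kop m (ivec r) v = \<psi> r *V Kop m e v" by metis
  obtain w where w: "Kop m e w \<noteq> 0"
  proof -
    obtain \<mu> v where "v \<in> wshift \<mu> 0" "v \<noteq> 0" by (rule weight_vector_exists)
    then show ?thesis using that[of "inv (Kop m e) v"] by (simp add: bij_inv_simps[OF z])
  qed
  have "\<psi> (\<chi> k. i * r $ k + j * s $ k) = of_int i * \<psi> r + of_int j * \<psi> s" for i j r s
  proof -
    have "ivec (\<chi> k. i * r $ k + j * s $ k) = of_int i *s ivec r + of_int j *s ivec s"
      by (simp add: ivec_def vec_eq_iff)
    then have "\<psi> (\<chi> k. i * r $ k + j * s $ k) *V Kop m e w = (of_int i * \<psi> r + of_int j * \<psi> s) *V Kop m e w"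
      unfolding \<psi>[symmetric] by (simp add: Kop_add Kop_scale \<psi> M.V.scale_left_distrib)
    then show ?thesis using w by simp
  qed
  with \<psi> show ?thesis by (rule that)
qed

text \<open>If this minor were nonzero, \<open>functional_dependent\<close> with coefficients
  \<open>1\<close> and \<open>t\<close> would make every real \<open>t\<close> a quotient of values
  at some integer pair \<open>p\<close>; but there are only countably many pairs.\<close>

lemma Kop_functionals_proportional:
  assumes z1: "bij (Kop m\<^sub>1 e\<^sub>1)" and z2: "bij (Kop m\<^sub>2 e\<^sub>2)"
    and \<psi>1: "\<And>r v. Kop m\<^sub>1 (ivec r) v = \<psi>\<^sub>1 r *V Kop m\<^sub>1 e\<^sub>1 v"
    and \<psi>2: "\<And>r v. Kop m\<^sub>2 (ivec r) v = \<psi>\<^sub>2 r *V Kop m\<^sub>2 e\<^sub>2 v"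
    and lin1: "\<And>i j r s. \<psi>\<^sub>1 (\<chi> k. i * r $ k + j * s $ k) = of_int i * \<psi>\<^sub>1 r + of_int j * \<psi>\<^sub>1 s"
    and lin2: "\<And>i j r s. \<psi>\<^sub>2 (\<chi> k. i * r $ k + j * s $ k) = of_int i * \<psi>\<^sub>2 r + of_int j * \<psi>\<^sub>2 s"
  shows "\<psi>\<^sub>1 r * \<psi>\<^sub>2 s = \<psi>\<^sub>1 s * \<psi>\<^sub>2 r"
proof (rule ccontr)
  assume D: "\<psi>\<^sub>1 r * \<psi>\<^sub>2 s \<noteq> \<psi>\<^sub>1 s * \<psi>\<^sub>2 r"
  define A where "A \<psi> p = of_int (fst p) * \<psi> r + of_int (snd p) * \<psi> s"
    for \<psi> :: "int^'n \<Rightarrow> complex" and p :: "int \<times> int"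
  have "t \<in> range (\<lambda>p. Re (- A \<psi>\<^sub>1 p / A \<psi>\<^sub>2 p))" for t :: real
  proof -
    obtain p where p: "p \<noteq> 0" "1 * A \<psi>\<^sub>1 p + of_real t * A \<psi>\<^sub>2 p = 0"
      using functional_dependent[OF z1 z2 \<psi>1 \<psi>2, of 1 r s "of_real t"]
      unfolding lin1 lin2 A_def by blast
    \<comment> \<open>If both values vanished, Cramer's rule with the nonzero minor would give
      \<open>p = 0\<close>.\<close>
    have "A \<psi>\<^sub>2 p \<noteq> 0"
    proof
      assume 2: "A \<psi>\<^sub>2 p = 0"
      then have 1: "A \<psi>\<^sub>1 p = 0" using p(2) by simp
      have "of_int (fst p) * (\<psi>\<^sub>1 r * \<psi>\<^sub>2 s - \<psi>\<^sub>1 s * \<psi>\<^sub>2 r) = A \<psi>\<^sub>1 p * \<psi>\<^sub>2 s - A \<psi>\<^sub>2 p * \<psi>\<^sub>1 s"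
        "of_int (snd p) * (\<psi>\<^sub>1 r * \<psi>\<^sub>2 s - \<psi>\<^sub>1 s * \<psi>\<^sub>2 r) = A \<psi>\<^sub>2 p * \<psi>\<^sub>1 r - A \<psi>\<^sub>1 p * \<psi>\<^sub>2 r"
        by (simp_all add: A_def algebra_simps)
      then have "fst p = 0" "snd p = 0" using D unfolding 1 2 by simp_all
      then show False using p(1) by (simp add: prod_eq_iff)
    qed
    then have "of_real t = - A \<psi>\<^sub>1 p / A \<psi>\<^sub>2 p"
      using p(2) by (simp add: field_simps eq_neg_iff_add_eq_0)
    then have "t = Re (- A \<psi>\<^sub>1 p / A \<psi>\<^sub>2 p)" by (metis Re_complex_of_real)
    then show ?thesis by blast
  qed
  then have "(UNIV :: real set) = range (\<lambda>p. Re (- A \<psi>\<^sub>1 p / A \<psi>\<^sub>2 p))" by blast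
  then show False using uncountable_UNIV_real by (metis countable_image countableI_type)
qed

text \<open>The functional of a single nonzero operator serves for all degrees.
  \<open>functional_dependent\<close> with second coefficient \<open>0\<close> bounds its rational
  rank by one, and the functionals in other degrees are proportional to it.\<close>

theorem rational_central_functional:
  assumes "Kop m c v \<noteq> 0"
  shows "\<exists>\<psi> :: int^'n \<Rightarrow> complex.
    (\<forall>i j r s. \<psi> (\<chi> k. i * r $ k + j * s $ k) = of_int i * \<psi> r + of_int j * \<psi> s) \<and>
    (\<forall>r s. \<exists>i j. (i, j) \<noteq> (0, 0) \<and> of_int i * \<psi> r + of_int j * \<psi> s = 0) \<and>
    (\<forall>k r w. \<psi> r = 0 \<longrightarrow> Kop k (ivec r) w = 0)"
proof -
  have z: "bij (Kop m c)" using assms by (rule Kop_nonzero_bij)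
  obtain \<psi> where \<psi>: "\<And>r v. Kop m (ivec r) v = \<psi> r *V Kop m c v"
    and lin: "\<And>i j r s. \<psi> (\<chi> k. i * r $ k + j * s $ k) = of_int i * \<psi> r + of_int j * \<psi> s"
    using Kop_functional[OF z] by metis
  obtain i where "Kop m (axis i 1) v \<noteq> 0" using assms Kop_axes_zero by blast
  then have i: "\<psi> (axis i 1) \<noteq> 0" using \<psi>[of "axis i 1" v] by (auto simp: ivec_simps)
  have dep: "\<exists>i j. (i, j) \<noteq> (0, 0) \<and> of_int i * \<psi> r + of_int j * \<psi> s = 0" for r s
    using functional_dependent[OF z z \<psi> \<psi>, of 1 r s 0] unfolding lin by (auto simp: zero_prod_def)
  have "Kop k (ivec r) w = 0" if r: "\<psi> r = 0" for k r w
  proof (rule ccontr)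
    assume nz: "Kop k (ivec r) w \<noteq> 0"
    have z': "bij (Kop k (ivec r))" using nz by (rule Kop_nonzero_bij)
    obtain \<psi>' where \<psi>': "\<And>s v. Kop k (ivec s) v = \<psi>' s *V Kop k (ivec r) v"
      and lin': "\<And>i j r s. \<psi>' (\<chi> k. i * r $ k + j * s $ k) = of_int i * \<psi>' r + of_int j * \<psi>' s"
      using Kop_functional[OF z'] by metis
    \<comment> \<open>The functional is normalized by \<open>Kop k (ivec r)\<close> itself, so it
      cannot vanish at \<open>r\<close>, whereas proportionality to \<psi> forces it to.\<close>
    have "\<psi>' r \<noteq> 0" using \<psi>'[of r w] nz by auto
    moreover have "\<psi> (axis i 1) * \<psi>' r = \<psi> r * \<psi>' (axis i 1)"
      by (rule Kop_functionals_proportional[OF z z' \<psi> \<psi>' lin lin'])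
    ultimately show False using i r by simp
  qed
  with lin dep show ?thesis by (intro exI[of _ \<psi>] conjI allI impI)
qed

end

section \<open>Unimodular matrices and rational functionals\<close>

lemma elementary_row_operation:
  fixes w :: "int^'n::finite"
  assumes "p \<noteq> q"
  obtains E :: "int^'n^'n" where "det E = 1"
    and "E *v w = (\<chi> k. if k = p then w $ p + c * w $ q else w $ k)"
proof
  let ?E = "(\<chi> k. if k = p then row p (mat 1) + c *s row q (mat 1) else row k (mat 1)) :: int^'n^'n"
  show "det ?E = 1" unfolding det_row_operation[OF assms] by simp
  have "(\<Sum>j\<in>UNIV. (mat 1 :: int^'n^'n) $ i $ j * w $ j) = w $ i" for i
    using matrix_vector_mul_lid[of w] by (simp add: matrix_vector_mult_def vec_eq_iff)
  then show "?E *v w = (\<chi> k. if k = p then w $ p + c * w $ q else w $ k)"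
    by (simp add: matrix_vector_mult_def vec_eq_iff row_def distrib_right sum.distrib mult.assoc
        flip: sum_distrib_left)
qed

text \<open>The Euclidean algorithm by elementary row operations.\<close>

lemma unimodular_reduction:
  fixes w :: "int^'n::finite"
  shows "\<exists>A. det A = 1 \<and> (\<forall>i. i \<noteq> i\<^sub>0 \<longrightarrow> (A *v w) $ i = 0)"
proof (induction "\<Sum>i\<in>UNIV. nat \<bar>w $ i\<bar>" arbitrary: w rule: less_induct)
  case less
  show ?case
  proof (cases "\<exists>p q. p \<noteq> q \<and> w $ p \<noteq> 0 \<and> w $ q \<noteq> 0")
    case True
    then obtain p q where pq: "p \<noteq> q" "w $ p \<noteq> 0" "w $ q \<noteq> 0" "\<bar>w $ q\<bar> \<le> \<bar>w $ p\<bar>"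
      by (metis linear)
    \<comment> \<open>This sign makes the new entry, up to sign, the difference of the two absolute
      values.\<close>
    define c where "c = - sgn (w $ p) * sgn (w $ q)"
    obtain E where E: "det E = 1" "E *v w = (\<chi> k. if k = p then w $ p + c * w $ q else w $ k)"
      by (rule elementary_row_operation[OF pq(1)])
    let ?w = "E *v w"
    have "\<bar>w $ p + c * w $ q\<bar> < \<bar>w $ p\<bar>"
      using pq by (auto simp: c_def sgn_if abs_if split: if_splits)
    then have "nat \<bar>?w $ p\<bar> < nat \<bar>w $ p\<bar>" by (simp add: E)
    then have "(\<Sum>i\<in>UNIV. nat \<bar>?w $ i\<bar>) < (\<Sum>i\<in>UNIV. nat \<bar>w $ i\<bar>)"
      by (intro sum_strict_mono_ex1) (auto simp: E)
    then obtain A where "det A = 1" "\<forall>i. i \<noteq> i\<^sub>0 \<longrightarrow> (A *v ?w) $ i = 0"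
      using less.hyps by blast
    then show ?thesis
      by (intro exI[of _ "A ** E"]) (simp add: det_mul E(1) matrix_vector_mul_assoc)
  next
    case False
    show ?thesis
    proof (cases "\<exists>p. p \<noteq> i\<^sub>0 \<and> w $ p \<noteq> 0")
      case True
      then obtain p where p: "p \<noteq> i\<^sub>0" "w $ p \<noteq> 0" by blast
      then have w0: "w $ k = 0" if "k \<noteq> p" for k using False that by blast
      \<comment> \<open>The single nonzero entry is moved to \<open>i\<^sub>0\<close>: it is added
        there and then subtracted at \<open>p\<close>.\<close>
      obtain E where E: "det E = 1" "E *v w = (\<chi> k. if k = i\<^sub>0 then w $ i\<^sub>0 + 1 * w $ p else w $ k)"
        by (rule elementary_row_operation[of i\<^sub>0 p w 1]) (use p in auto)
      obtain E' where E': "det E' = 1"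
        "E' *v (E *v w) = (\<chi> k. if k = p then (E *v w) $ p + (- 1) * (E *v w) $ i\<^sub>0 else (E *v w) $ k)"
        by (rule elementary_row_operation[OF p(1)])
      show ?thesis
        using p w0 by (intro exI[of _ "E' ** E"])
          (simp add: det_mul E(1) E'(1) matrix_vector_mul_assoc[symmetric] E'(2), simp add: E(2))
    next
      case False
      then show ?thesis by (intro exI[of _ "mat 1"]) auto
    qed
  qed
qed

text \<open>Up to a complex factor, \<psi> is the pairing with an integer vector \<open>w\<close>.
  If \<open>A *v w\<close> is supported at \<open>i\<^sub>0\<close>, all other columns of
  \<open>transpose A\<close> pair to zero with \<open>w\<close>.\<close>

lemma rational_functional_kernel_basis:
  fixes \<psi> :: "int^'n::finite \<Rightarrow> complex"
  assumes lin: "\<And>i j r s. \<psi> (\<chi> k. i * r $ k + j * s $ k) = of_int i * \<psi> r + of_int j * \<psi> s"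
    and dep: "\<And>r s. \<exists>i j. (i, j) \<noteq> (0, 0) \<and> of_int i * \<psi> r + of_int j * \<psi> s = 0"
  shows "\<exists>B :: int^'n^'n. det B = 1 \<and> (\<forall>i. i \<noteq> i\<^sub>0 \<longrightarrow> \<psi> (B *v axis i 1) = 0)"
proof -
  have expand: "\<psi> r = (\<Sum>i\<in>UNIV. of_int (r $ i) * \<psi> (axis i 1))" for r
  proof -
    have \<psi>0: "\<psi> 0 = 0" using lin[of 0 0 0 0] by (simp add: zero_vec_def)
    have "\<psi> (\<chi> k. if k \<in> S then r $ k else 0) = (\<Sum>i\<in>S. of_int (r $ i) * \<psi> (axis i 1))" for S
    proof (induction S rule: infinite_finite_induct)
      case (insert i S)
      let ?r = "(\<chi> k. if k \<in> S then r $ k else 0) :: int^'n"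
      have eq: "(\<chi> k. if k \<in> insert i S then r $ k else 0) = (\<chi> k. 1 * ?r $ k + r $ i * (axis i 1) $ k)"
        using insert.hyps by (auto simp: vec_eq_iff axis_def)
      show ?case unfolding eq lin insert.IH using insert.hyps by simp
    qed (simp_all add: \<psi>0 flip: zero_vec_def)
    from this[of UNIV] show ?thesis by simp
  qed
  show ?thesis
  proof (cases "\<forall>i. \<psi> (axis i 1) = 0")
    case True
    then have "\<psi> r = 0" for r by (simp add: expand[of r])
    then show ?thesis by (intro exI[of _ "mat 1"]) simp
  next
    case False
    then obtain l where l: "\<psi> (axis l 1) \<noteq> 0" by blast
    have "\<exists>a b. a \<noteq> 0 \<and> of_int a * \<psi> (axis i 1) = of_int b * \<psi> (axis l 1)" for i
    proof -
      obtain a b where ab: "(a, b) \<noteq> (0, 0)" "of_int a * \<psi> (axis i 1) + of_int b * \<psi> (axis l 1) = 0"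
        using dep by blast
      have "a \<noteq> 0" using ab l by auto
      moreover have "of_int a * \<psi> (axis i 1) = of_int (- b) * \<psi> (axis l 1)"
        using ab(2) by (simp add: eq_neg_iff_add_eq_0)
      ultimately show ?thesis by blast
    qed
    then obtain a b where ab: "\<And>i. a i \<noteq> 0"
      "\<And>i. of_int (a i) * \<psi> (axis i 1) = of_int (b i) * \<psi> (axis l 1)" by metis
    \<comment> \<open>Common denominator of the ratios \<open>b i / a i\<close>, whose numerators
      form \<open>w\<close>.\<close>
    define N where "N = (\<Prod>i\<in>UNIV. a i)"
    define w :: "int^'n" where "w = (\<chi> i. b i * (\<Prod>k\<in>UNIV - {i}. a k))"
    have N: "N \<noteq> 0" using ab(1) by (simp add: N_def)
    have "of_int N * \<psi> (axis i 1) = of_int (w $ i) * \<psi> (axis l 1)" for i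
    proof -
      have "N = (\<Prod>k\<in>UNIV - {i}. a k) * a i"
        unfolding N_def by (subst prod.remove[of _ i]) (simp_all add: mult.commute)
      then have "of_int N * \<psi> (axis i 1) = of_int (\<Prod>k\<in>UNIV - {i}. a k) * (of_int (a i) * \<psi> (axis i 1))"
        by simp
      also have "\<dots> = of_int (w $ i) * \<psi> (axis l 1)" unfolding ab(2) by (simp add: w_def)
      finally show ?thesis .
    qed
    then have Nw: "of_int N * \<psi> r = of_int (\<Sum>i\<in>UNIV. r $ i * w $ i) * \<psi> (axis l 1)" for r
      unfolding expand[of r] of_int_sum sum_distrib_left sum_distrib_right
      by (intro sum.cong refl) (metis (no_types, lifting) mult.assoc mult.left_commute of_int_mult)
    obtain A where A: "det A = 1" "\<And>i. i \<noteq> i\<^sub>0 \<Longrightarrow> (A *v w) $ i = 0"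
      using unimodular_reduction[of i\<^sub>0 w] by blast
    have "\<psi> (transpose A *v axis i 1) = 0" if "i \<noteq> i\<^sub>0" for i
    proof -
      have "(transpose A *v axis i 1) $ k = A $ i $ k" for k
        by (simp add: matrix_vector_mult_def transpose_def axis_def if_distrib cong: if_cong)
      then have "of_int N * \<psi> (transpose A *v axis i 1) = of_int ((A *v w) $ i) * \<psi> (axis l 1)"
        unfolding Nw by (simp add: matrix_vector_mult_def)
      then show ?thesis using A(2)[OF that] N by simp
    qed
    then show ?thesis using A(1) by (intro exI[of _ "transpose A"]) (simp add: det_transpose)
  qed
qed

section \<open>Descent along \<open>\<phi>\<close>\<close>

context form_lie_algebra
begin

lemma toroidal_phi_surj: "surj (toroidal_phi :: ('g, 'm::finite option) toroidal \<Rightarrow> _)"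
proof -
  let ?\<phi> = "toroidal_phi :: ('g, 'm option) toroidal \<Rightarrow> ('g, 'm) multiloop_affine"
  have add: "x \<in> range ?\<phi> \<Longrightarrow> y \<in> range ?\<phi> \<Longrightarrow> x + y \<in> range ?\<phi>" for x y
    using toroidal_phi_hom(1) by (metis (no_types, lifting) imageE rangeI)
  have id: "init_deg (join_deg a m) = m" "join_deg a m $ None = a" for a and m :: "int^'m"
    by (simp_all add: init_deg_def join_deg_def vec_eq_iff)
  have X: "(Poly_Mapping.single m (p, 0), 0) \<in> range ?\<phi>" for m p
  proof (induction p rule: pm_induct)
    case (single a X)
    have "?\<phi> (tau_X X (join_deg a m)) = (Poly_Mapping.single m (Poly_Mapping.single a X, 0), 0)"
      by (simp add: toroidal_phi_generators id)
    then show ?case by (metis rangeI)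
  next
    case (add p q)
    from add.IH(1) add.IH(2) have "(Poly_Mapping.single m (p, 0), 0) + (Poly_Mapping.single m (q, 0), 0) \<in> range ?\<phi>"
      by (rule \<open>\<And>y x. x \<in> range ?\<phi> \<Longrightarrow> y \<in> range ?\<phi> \<Longrightarrow> x + y \<in> range ?\<phi>\<close>)
    then show ?case by (simp flip: Poly_Mapping.single_add)
  qed
  have K: "(Poly_Mapping.single m (0, k), 0) \<in> range ?\<phi>" for m k
  proof -
    have "?\<phi> (toroidal_scale sg k (tau_K (join_deg 0 m) None)) = (Poly_Mapping.single m (0, k), 0)"
    proof -
      interpret P: vector_space "pm_scale sg :: complex \<Rightarrow> (int \<Rightarrow>\<^sub>0 'g) \<Rightarrow> _"
        by (rule vector_space_pm_scale) unfold_locales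
      have "affine_scale sg k (0, 1) = (0, k)"
        using vector_space_prod_scale(2)[OF P.vector_space_axioms
            vector_space_over_itself.vector_space_axioms]
        by (simp add: affine_scale_def)
      moreover have "affine_scale sg k 0 = 0"
        using vector_space_prod_scale(2)[OF P.vector_space_axioms
            vector_space_over_itself.vector_space_axioms]
        by (simp add: affine_scale_def zero_prod_def)
      ultimately show ?thesis
        by (simp add: toroidal_phi_hom toroidal_phi_generators id multiloop_affine_scale_eq pm_scale_single)
    qed
    then show ?thesis by (metis rangeI)
  qed
  have G: "(g, 0) \<in> range ?\<phi>" for g
  proof (induction g rule: pm_induct)
    case (single m p)
    have "(Poly_Mapping.single m (fst p, 0), 0) + (Poly_Mapping.single m (0, snd p), 0) \<in> range ?\<phi>"
      by (rule add[OF X K])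
    then show ?case by (simp flip: Poly_Mapping.single_add)
  next
    case (add f g)
    from add.IH(1) add.IH(2) have "(f, 0) + (g, 0) \<in> range ?\<phi>"
      by (rule \<open>\<And>y x. x \<in> range ?\<phi> \<Longrightarrow> y \<in> range ?\<phi> \<Longrightarrow> x + y \<in> range ?\<phi>\<close>)
    then show ?case by simp
  qed
  have "(g, c) \<in> range ?\<phi>" for g c
  proof -
    have "?\<phi> ((0, 0), c) = (0, c)" by (simp add: toroidal_phi_def lin_ext_def K_proj_props map_Pair0)
    then have "(0, c) \<in> range ?\<phi>" by (metis rangeI)
    from add[OF G[of g] this] show ?thesis by simp
  qed
  then show ?thesis by (metis surjI UNIV_eq_I surj_pair)
qed

text \<open>The loop part enters only the first components of the affine coefficients, and
  injectively, since \<open>init_deg r\<close> and \<open>r $ None\<close> determine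
  \<open>r\<close>; the central part enters only the second components. Hence both vanish
  separately.\<close>

lemma toroidal_phi_kernel:
  fixes f :: "int^('m::finite option) \<Rightarrow>\<^sub>0 'g"
  assumes "toroidal_phi ((f, z), c) = 0"
  shows "f = 0" "K_proj z = 0" "c = 0"
proof -
  define F :: "(int^('m option) \<Rightarrow>\<^sub>0 'g) \<Rightarrow> (int^'m \<Rightarrow>\<^sub>0 'g affine)" where
    "F = lin_ext (\<lambda>r X. Poly_Mapping.single (init_deg r) (Poly_Mapping.single (r $ None) X, 0))"
  have FE: "F f + Poly_Mapping.map (\<lambda>k. (0, k)) (K_proj z) = 0" and "c = 0"
    using assms by (simp_all add: toroidal_phi_def F_def zero_prod_def)
  then show "c = 0" by simp
  have F: "F (f + g) = F f + F g" for f g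
    unfolding F_def by (rule lin_ext_add) (simp add: Poly_Mapping.single_add[symmetric])
  have F1: "F (Poly_Mapping.single r X) =
    Poly_Mapping.single (init_deg r) (Poly_Mapping.single (r $ None) X, 0)" for r X
    unfolding F_def by (rule lin_ext_single) (simp add: zero_prod_def[symmetric])
  have snd_F: "snd (Poly_Mapping.lookup (F f) m) = 0" for f m
    by (induction f rule: pm_induct)
      (simp_all add: F F1 Poly_Mapping.lookup_add Poly_Mapping.lookup_single when_def)
  have lookup_F: "Poly_Mapping.lookup (fst (Poly_Mapping.lookup (F f) (init_deg r))) (r $ None) =
    Poly_Mapping.lookup f r" for f r
  proof (induction f rule: pm_induct)
    case (single s X)
    have "init_deg s = init_deg r \<and> s $ None = r $ None \<longleftrightarrow> s = r"
      using join_deg_props(2) by metis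
    then show ?case by (auto simp: F1 Poly_Mapping.lookup_single when_def)
  qed (simp add: F Poly_Mapping.lookup_add)
  have lookup_E: "Poly_Mapping.lookup (Poly_Mapping.map (\<lambda>k. (0 :: int \<Rightarrow>\<^sub>0 'g, k)) g) m = (0, Poly_Mapping.lookup g m)"
    for g :: "int^'m \<Rightarrow>\<^sub>0 complex" and m
    by (simp add: Poly_Mapping.map.rep_eq when_def zero_prod_def)
  have "Poly_Mapping.lookup (F f) m + (0, Poly_Mapping.lookup (K_proj z) m) = 0" for m
    using arg_cong[OF FE, of "\<lambda>g. Poly_Mapping.lookup g m"] by (simp add: Poly_Mapping.lookup_add lookup_E)
  then have eqs: "fst (Poly_Mapping.lookup (F f) m) = 0"
    "snd (Poly_Mapping.lookup (F f) m) + Poly_Mapping.lookup (K_proj z) m = 0" for m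
    by (simp_all add: prod_eq_iff)
  have "Poly_Mapping.lookup f r = 0" for r
    using lookup_F[of f r] eqs(1)[of "init_deg r"] by simp
  then show "f = 0" by (intro poly_mapping_eqI) simp
  show "K_proj z = 0" by (rule poly_mapping_eqI) (use eqs(2) snd_F in simp)
qed

text \<open>By \<open>toroidal_phi_kernel\<close> only central elements remain, and under
  \<open>K1\<close> and \<open>K2\<close> their action factors through
  \<open>K_proj\<close>.\<close>

lemma phi_kernel_acts_trivially:
  fixes a :: "('g, 'm::finite option) toroidal \<Rightarrow> 'v::ab_group_add \<Rightarrow> 'v"
  assumes "lie_module (toroidal_scale sg) (toroidal_bracket sg br form) sv a"
    and K1: "\<And>m i v. a (tau_K m (Some i)) v = 0"
    and K2: "\<And>m v. m $ None \<noteq> 0 \<Longrightarrow> a (tau_K m None) v = 0"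
    and x: "toroidal_phi x = 0"
  shows "a x v = 0"
proof -
  interpret M: lie_module "toroidal_scale sg" "toroidal_bracket sg br form" sv a by fact
  \<comment> \<open>The factored action: the coefficient at \<open>m\<close> multiplies
    \<open>t^m K_n\<close> with last exponent zero.\<close>
  define L where "L = lin_ext (\<lambda>m k. sv k (a (tau_K (join_deg 0 m) None) v))"
  have L_add: "L (g + h) = L g + L h" for g h
    unfolding L_def by (rule lin_ext_add) (simp add: M.V.scale_left_distrib)
  have a0: "a 0 v = 0" using M.act_add_left[of 0 0 v] by simp
  have aK: "a ((0, z), 0) v = L (K_proj z)" for z
  proof (induction z rule: centre_induct)
    case (single m c)
    have sum: "a ((0, \<Sum>i\<in>S. K_scale (c $ i) (tK m i)), 0) v = (\<Sum>i\<in>S. sv (c $ i) (a (tau_K m i) v))" for S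
    proof (induction S rule: infinite_finite_induct)
      case (insert i S)
      have "((0, \<Sum>i\<in>insert i S. K_scale (c $ i) (tK m i)), 0) =
        toroidal_scale sg (c $ i) (tau_K m i) + ((0, \<Sum>i\<in>S. K_scale (c $ i) (tK m i)), 0)"
        using insert.hyps by (simp add: tau_K_def toroidal_scale_eq pm_scale_zero)
      then show ?case using insert.hyps insert.IH by (simp only: M.act_add_left M.act_scale_left) simp
    qed (simp_all add: a0 flip: zero_prod_def)
    have "a ((0, K_class (Poly_Mapping.single m c)), 0) v = (\<Sum>i\<in>UNIV. sv (c $ i) (a (tau_K m i) v))"
      using sum[of UNIV] by (simp add: sum_K_scale_tK)
    also have "\<dots> = sv (c $ None) (a (tau_K m None) v)"
      by (simp add: UNIV_option_conv sum.reindex K1)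
    also have "\<dots> = L (K_proj (K_class (Poly_Mapping.single m c)))"
      using K2[of m v] by (simp add: K_proj_props L_def lin_ext_single join_deg_props(4) lin_ext_def)
    finally show ?case .
  next
    case (add y z)
    have "((0, y + z), 0) = ((0, y), 0) + (((0, z), 0) :: ('g, 'm option) toroidal)" by simp
    then show ?case using add by (simp only: M.act_add_left K_proj_props L_add)
  qed
  obtain f z c where xe: "x = ((f, z), c)" by (metis prod.exhaust)
  have "f = 0" "K_proj z = 0" "c = 0" using toroidal_phi_kernel x unfolding xe by blast+
  then show ?thesis by (simp add: xe aK) (simp add: L_def lin_ext_def)
qed

text \<open>A section of the surjection transports the action; two preimages differ by a kernel
  element, which acts by zero.\<close>

lemma descends_along_phi:
  fixes a :: "('g, 'm::finite option) toroidal \<Rightarrow> 'v::ab_group_add \<Rightarrow> 'v"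
  assumes "lie_module (toroidal_scale sg) (toroidal_bracket sg br form) sv a"
    and ker: "\<And>x v. toroidal_phi x = 0 \<Longrightarrow> a x v = 0"
  shows "\<exists>a'. lie_module (multiloop_affine_scale sg) (multiloop_affine_bracket sg br form) sv a' \<and>
    (\<forall>x. a' (toroidal_phi x) = a x)"
proof -
  interpret M: lie_module "toroidal_scale sg" "toroidal_bracket sg br form" sv a by fact
  interpret L: lie_algebra "multiloop_affine_scale sg :: complex \<Rightarrow> ('g, 'm) multiloop_affine \<Rightarrow> _"
    "multiloop_affine_bracket sg br form" by (rule lie_algebra_multiloop_affine)
  let ?\<phi> = "toroidal_phi :: ('g, 'm option) toroidal \<Rightarrow> ('g, 'm) multiloop_affine"
  define a' where "a' y = a (inv ?\<phi> y)" for y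
  have a': "a' (?\<phi> x) = a x" for x
  proof
    fix v
    let ?x = "inv ?\<phi> (?\<phi> x)"
    have "?\<phi> ((?x - x) + x) = ?\<phi> (?x - x) + ?\<phi> x" by (rule toroidal_phi_hom)
    moreover have "?\<phi> ?x = ?\<phi> x" by (rule surj_f_inv_f[OF toroidal_phi_surj])
    ultimately have "a (?x - x) v = 0" by (intro ker) simp
    then show "a' (?\<phi> x) v = a x v"
      using M.act_add_left[of "?x - x" x v] by (simp add: a'_def)
  qed
  have ex: "\<exists>x. y = ?\<phi> x" for y using toroidal_phi_surj by (metis surjD)
  have "lie_module (multiloop_affine_scale sg) (multiloop_affine_bracket sg br form) sv a'"
  proof unfold_locales
    fix x y c v w
    obtain x' y' where xy: "x = ?\<phi> x'" "y = ?\<phi> y'" using ex by metis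
    show "a' (x + y) v = a' x v + a' y v"
      unfolding xy toroidal_phi_hom(1)[symmetric] a' by (rule M.act_add_left)
    show "a' (multiloop_affine_scale sg c x) v = sv c (a' x v)"
      unfolding xy toroidal_phi_hom(2)[symmetric] a' by (rule M.act_scale_left)
    show "a' (multiloop_affine_bracket sg br form x y) v = a' x (a' y v) - a' y (a' x v)"
      unfolding xy toroidal_phi_hom(3)[symmetric] a' by (rule M.act_bracket)
    show "a' x (v + w) = a' x v + a' x w" unfolding xy a' by (rule M.act_add_right)
    show "a' x (sv c v) = sv c (a' x v)" unfolding xy a' by (rule M.act_scale_right)
  qed
  with a' show ?thesis by blast
qed

end

text \<open>The direction of the image is column \<open>j\<close> of \<open>B\<close>, so killing
  \<open>t^m K_j\<close> after the twist is a condition on that column.\<close>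

lemma toroidal_aut_tau_K:
  fixes B :: "int^'n::finite^'n"
  shows "toroidal_aut B (tau_K m j :: ('g::ab_group_add, 'n) toroidal) =
    ((0, K_class (Poly_Mapping.single (B *v m) (\<chi> i. of_int ((B *v axis j 1) $ i)))), 0)"
proof -
  have "deg_aut B 0 = (0 :: _ \<Rightarrow>\<^sub>0 'g)" "D_aut B 0 = 0"
    by (rule additive_zeroI(1), rule deg_aut_props D_aut_props)+
  moreover have "(\<Sum>k\<in>UNIV. of_int (B $ i $ k) * (axis j (1::complex)) $ k) = of_int ((B *v axis j 1) $ i)" for i
    by (simp add: matrix_vector_mult_def axis_def if_distrib cong: if_cong)
  ultimately show ?thesis by (simp add: tau_K_def tK_def toroidal_aut_eq K_aut_props)
qed

section \<open>Choice of the matrix and the twisted module\<close>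

context toroidal_module
begin

text \<open>Any nonzero central operator forces a nontrivial degree-zero action, hence an
  anisotropic Cartan element and a rational functional supplying the columns. If the centre acts by
  zero, the identity matrix serves.\<close>

lemma central_action_normal_form:
  "\<exists>B :: int^'n^'n. det B = 1 \<and>
    (\<forall>i m v. i \<noteq> i\<^sub>0 \<longrightarrow> Kop m (ivec (B *v axis i 1)) v = 0)"
proof (cases "\<exists>m c v. Kop m c v \<noteq> 0")
  case True
  then obtain m c v where nz: "Kop m c v \<noteq> 0" by blast
  have "\<exists>X v. Xop X 0 v \<noteq> 0"
    using Kop_axes_zero Kop_zero_if_g_trivial nz by blast
  then interpret faithful_toroidal_module sg br form sv act H by unfold_locales
  obtain x where "\<forall>h\<in>H. br h x = 0" "form x x \<noteq> 0" using anisotropic_cartan_element by blast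
  then interpret anisotropic_toroidal_module sg br form sv act H x by unfold_locales auto
  obtain \<psi> :: "int^'n \<Rightarrow> complex"
    where lin: "\<forall>i j r s. \<psi> (\<chi> k. i * r $ k + j * s $ k) = of_int i * \<psi> r + of_int j * \<psi> s"
      and dep: "\<forall>r s. \<exists>i j. (i, j) \<noteq> (0, 0) \<and> of_int i * \<psi> r + of_int j * \<psi> s = 0"
      and ker: "\<forall>k r w. \<psi> r = 0 \<longrightarrow> Kop k (ivec r) w = 0"
    using rational_central_functional[OF nz] by (elim exE conjE)
  have "\<exists>B :: int^'n^'n. det B = 1 \<and> (\<forall>i. i \<noteq> i\<^sub>0 \<longrightarrow> \<psi> (B *v axis i 1) = 0)"
    by (rule rational_functional_kernel_basis[OF lin[rule_format] dep[rule_format]])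
  with ker show ?thesis by blast
next
  case False
  then show ?thesis by (intro exI[of _ "mat 1"]) simp
qed

text \<open>The first claim is the choice of columns. For the second, \<open>Kop_self\<close> in
  degree \<open>B *v m\<close>, expanded along the columns, leaves only \<open>m $ i\<^sub>0\<close>
  times the operator in question.\<close>

lemma twist_tau_K:
  assumes B: "\<And>i m v. i \<noteq> i\<^sub>0 \<Longrightarrow> Kop m (ivec (B *v axis i 1)) v = 0"
  shows "i \<noteq> i\<^sub>0 \<Longrightarrow> twist B act (tau_K m i) v = 0"
    and "m $ i\<^sub>0 \<noteq> 0 \<Longrightarrow> twist B act (tau_K m i\<^sub>0) v = 0"
proof -
  let ?b = "\<lambda>j. B *v axis j 1"
  have tw: "twist B act (tau_K m j) v = Kop (B *v m) (ivec (?b j)) v" for j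
    by (simp add: twist_def toroidal_aut_tau_K Kop_def ivec_def)
  then show "i \<noteq> i\<^sub>0 \<Longrightarrow> twist B act (tau_K m i) v = 0" by (simp add: B)
  have Kop_sum: "Kop k (\<Sum>j\<in>S. of_int (m $ j) *s ivec (?b j)) v =
    (\<Sum>j\<in>S. of_int (m $ j) *V Kop k (ivec (?b j)) v)" for k S
    by (induction S rule: infinite_finite_induct) (simp_all add: Kop_zero Kop_add Kop_scale)
  have "ivec (B *v m) = (\<Sum>j\<in>UNIV. of_int (m $ j) *s ivec (?b j))"
    by (simp add: ivec_def vec_eq_iff matrix_vector_mult_def axis_def if_distrib mult.commute cong: if_cong)
  then have "0 = (\<Sum>j\<in>UNIV. of_int (m $ j) *V Kop (B *v m) (ivec (?b j)) v)"
    using Kop_self[of "B *v m" v] Kop_sum[of _ UNIV] by simp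
  also have "\<dots> = (\<Sum>j\<in>{i\<^sub>0}. of_int (m $ j) *V Kop (B *v m) (ivec (?b j)) v)"
    by (rule sum.mono_neutral_right) (simp_all add: B)
  finally show "twist B act (tau_K m i\<^sub>0) v = 0" if "m $ i\<^sub>0 \<noteq> 0"
    using that by (simp add: tw)
qed

end

theorem mainTheorem4:
  fixes sg :: "complex \<Rightarrow> 'g::ab_group_add \<Rightarrow> 'g"
    and br :: "'g \<Rightarrow> 'g \<Rightarrow> 'g"
    and form :: "'g \<Rightarrow> 'g \<Rightarrow> complex"
    and H :: "'g set"
    and sv :: "complex \<Rightarrow> 'v::ab_group_add \<Rightarrow> 'v"
    and act :: "('g, 'm::finite option) toroidal \<Rightarrow> 'v \<Rightarrow> 'v"
  assumes "lie_algebra sg br"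
    and "vector_space.finite_dim sg (UNIV :: 'g set)"
    and "lie_algebra.simple sg br"
    and "lie_algebra.invariant_form sg br form"
    and "nondegenerate_form form"
    and "lie_algebra.cartan_subalgebra sg br H"
    and "lie_module (toroidal_scale sg) (toroidal_bracket sg br form) sv act"
    and "lie_module.irreducible sv act"
    and "lie_module.weight_module sv act (tau_cartan sg H)"
    and "\<And>\<mu>. vector_space.finite_dim sv (lie_module.weight_space sv act (tau_cartan sg H) \<mu>)"
  shows "\<exists>B :: int^('m option)^('m option). (det B = 1 \<or> det B = - 1) \<and>
    (\<forall>m (i::'m). twist B act (tau_K m (Some i)) = (\<lambda>v. 0)) \<and>
    (\<forall>m. m $ None \<noteq> 0 \<longrightarrow> twist B act (tau_K m None) = (\<lambda>v. 0)) \<and>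
    (\<forall>x. toroidal_phi x = 0 \<longrightarrow> twist B act x = (\<lambda>v. 0)) \<and>
    (\<exists>act'. lie_module (multiloop_affine_scale sg) (multiloop_affine_bracket sg br form) sv act' \<and>
       (\<forall>x. act' (toroidal_phi x) = twist B act x))"
proof -
  interpret F: form_lie_algebra sg br form
    by (rule form_lie_algebra.intro[OF assms(1) form_lie_algebra_axioms.intro[OF assms(4)]])
  interpret toroidal_module sg br form sv act H
    by (intro toroidal_module.intro toroidal_module_axioms.intro F.form_lie_algebra_axioms assms)
  \<comment> \<open>\<open>None\<close> stands for the last variable, the only one whose central
    operators may survive.\<close>
  obtain B where B: "det B = 1"
    "\<And>i m v. i \<noteq> None \<Longrightarrow> Kop m (ivec (B *v axis i 1)) v = 0"
    using central_action_normal_form[of None] by blast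
  then have det: "det B = 1 \<or> det B = - 1" by simp
  note tw = twist_tau_K[where i\<^sub>0 = None and B = B, OF B(2)]
  have M: "lie_module (toroidal_scale sg) (toroidal_bracket sg br form) sv (twist B act)"
    by (rule lie_module_twist[OF det assms(1,4,7)])
  have K: "twist B act (tau_K m (Some i)) v = 0" for m i v
    by (rule tw(1)) simp_all
  have K': "twist B act (tau_K m None) v = 0" if "m $ None \<noteq> 0" for m v
    by (rule tw(2)) (use that in simp_all)
  have ker: "twist B act x v = 0" if "toroidal_phi x = 0" for x v
    by (rule F.phi_kernel_acts_trivially[OF M K K' that])
  show ?thesis
  proof (intro exI[of _ B] conjI allI impI)
    show "\<exists>act'. lie_module (multiloop_affine_scale sg) (multiloop_affine_bracket sg br form) sv act' \<and>
       (\<forall>x. act' (toroidal_phi x) = twist B act x)"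
      by (rule F.descends_along_phi[OF M ker])
  qed (rule det, (rule ext, rule K K' ker, assumption?)+)
qed

end
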